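(* For each $n\ge 1$ let $X_{n1},X_{n2},\dots,X_{nk_n}$ be independent, centered, square integrable real random variables, with $s_n^2=\sum_{j=1}^{k_n}\mathrm{Var}(X_{nj})>0$. Assume there exists $n_0$ such that for each $n\ge n_0$ and $1\le k\le k_n$ there are nonnegative numbers $A_{nk}$ and $B_n$ such that for each integer $m\ge 3$ $$\mathbf{E}|X_{nk}|^m\le m!\,A_{nk}^m\,B_n.$$ Let $(a_n)$ be a sequence of positive numbers with $a_n\to 0$, and assume in addition that $$A_{nk}=o(\sqrt{a_n}\,s_n)\ \text{ as } n\to\infty,\ \text{uniformly in } k,$$ and that there is a positive constant $C$ such that $$\frac{B_n}{s_n^2}\sum_{j=1}^{k_n}A_{nj}^2\le C\quad\text{for all } n\ge n_0.$$ Then $\{W_n\}$ satisfies the functional moderate deviation principle in $D[0,1]$ (uniform topology) with speed $a_n$ and good rate function $$I(z)=\tfrac12\int_0^1 (z'(u))^2\,du\ \text{ if } z(0)=0 \text{ and } z \text{ is absolutely continuous},\qquad I(z)=\infty\ \text{ otherwise.}$$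
   Context: $(k_n)$ is a sequence of positive integers; $\log 0=-\infty$. Independence is within each row $n$. Notation: $S_{n,0}=0$, $S_{nl}=\sum_{j=1}^{l}X_{nj}$, $S_n=S_{nk_n}$, $s_{ni}^2=\sum_{j=1}^{i}\mathrm{Var}(X_{nj})$ (with $s_{n,0}^2=0$), $s_n^2=s_{nk_n}^2$. The process $W_n$ is the random element of $D[0,1]$ (càdlàg functions on $[0,1]$) given by $W_n(t)=S_{n,i-1}/s_n$ for $t\in[s_{n,i-1}^2/s_n^2,\ s_{ni}^2/s_n^2)$, $1\le i\le k_n$, and $W_n(1)=S_n/s_n$. Functional moderate deviation principle: a family $\{W_n\}$ of random elements of $D[0,1]$, endowed with the uniform topology, satisfies the functional MDP with speed $a_n\to0$ and good rate function $I$ if the level sets $\{x: I(x)\le\alpha\}$ are compact for all $\alpha<\infty$ and for every Borel set $\Gamma\subset D[0,1]$, with interior $\Gamma^0$ and closure $\bar\Gamma$, $$-\inf_{z\in\Gamma^0}I(z)\le\liminf_n a_n\log\mathbf{P}(\sqrt{a_n}\,W_n\in\Gamma)\le\limsup_n a_n\log\mathbf{P}(\sqrt{a_n}\,W_n\in\Gamma)\le-\inf_{z\in\bar\Gamma}I(z).$$ *)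

theory Defs
  imports "HOL-Probability.Probability"
begin

section \<open>The space \<open>D[0,1]\<close> with the uniform norm\<close>

text \<open>
  Elements of \<open>D[0,1]\<close> are total functions normalised to vanish outside \<open>[0,1]\<close>, so that
  equality in the type is equality on \<open>[0,1]\<close>.
\<close>

definition cadlag_on_unit :: "(real \<Rightarrow> real) \<Rightarrow> bool" where
  "cadlag_on_unit f \<longleftrightarrow>
     (\<forall>t. 0 \<le> t \<and> t < 1 \<longrightarrow> (f \<longlongrightarrow> f t) (at_right t)) \<and>
     (\<forall>t. 0 < t \<and> t \<le> 1 \<longrightarrow> (\<exists>l. (f \<longlongrightarrow> l) (at_left t)))"

lemma cadlag_on_unit_const [simp]: "cadlag_on_unit (\<lambda>_. c)"
  unfolding cadlag_on_unit_def by (auto intro: tendsto_const)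

lemma cadlag_on_unit_add:
  "cadlag_on_unit f \<Longrightarrow> cadlag_on_unit g \<Longrightarrow> cadlag_on_unit (\<lambda>t. f t + g t)"
  unfolding cadlag_on_unit_def by (blast intro: tendsto_add)

lemma cadlag_on_unit_cmult: "cadlag_on_unit f \<Longrightarrow> cadlag_on_unit (\<lambda>t. c * f t)"
  unfolding cadlag_on_unit_def by (blast intro: tendsto_mult_left)

lemma cadlag_on_unit_sum:
  "(\<And>i. i \<in> I \<Longrightarrow> cadlag_on_unit (f i)) \<Longrightarrow> cadlag_on_unit (\<lambda>t. \<Sum>i\<in>I. f i t)"
  by (induction I rule: infinite_finite_induct) (auto intro: cadlag_on_unit_add)

lemma cadlag_on_unit_indicator: "cadlag_on_unit (indicator {a..<b})"
  unfolding cadlag_on_unit_def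
proof (intro conjI allI impI)
  fix t :: real
  have "\<forall>\<^sub>F x in at_right t. indicator {a..<b} x = (indicator {a..<b} t :: real)"
  proof -
    consider "t < a" | "a \<le> t" "t < b" | "b \<le> t" by linarith
    then show ?thesis
    proof cases
      case 1
      then show ?thesis
        using eventually_at_right_real[of t a] by (auto elim!: eventually_mono simp: indicator_def)
    next
      case 2
      then show ?thesis
        using eventually_at_right_real[of t b] by (auto elim!: eventually_mono simp: indicator_def)
    next
      case 3
      then show ?thesis
        using eventually_at_right_real[of t "t + 1"]
        by (auto elim!: eventually_mono simp: indicator_def)
    qed
  qed
  then show "((indicator {a..<b} :: real \<Rightarrow> real) \<longlongrightarrow> indicator {a..<b} t) (at_right t)"
    by (rule tendsto_eventually)
next
  fix t :: real
  have "\<exists>c. \<forall>\<^sub>F x in at_left t. indicator {a..<b} x = (c :: real)"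
  proof -
    consider "t \<le> a" | "a < t" "t \<le> b" | "b < t" by linarith
    then show ?thesis
    proof cases
      case 1
      then show ?thesis
        using eventually_at_left_real[of "t - 1" t]
        by (intro exI[of _ 0]) (auto elim!: eventually_mono simp: indicator_def)
    next
      case 2
      then show ?thesis
        using eventually_at_left_real[of a t]
        by (intro exI[of _ 1]) (auto elim!: eventually_mono simp: indicator_def)
    next
      case 3
      then show ?thesis
        using eventually_at_left_real[of b t]
        by (intro exI[of _ 0]) (auto elim!: eventually_mono simp: indicator_def)
    qed
  qed
  then show "\<exists>l. ((indicator {a..<b} :: real \<Rightarrow> real) \<longlongrightarrow> l) (at_left t)"
    by (blast intro: tendsto_eventually)
qed

lemma cadlag_on_unit_indicator_1: "cadlag_on_unit (indicator {1})"
  unfolding cadlag_on_unit_def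
proof (intro conjI allI impI)
  fix t :: real
  assume t: "0 \<le> t \<and> t < 1"
  then have "\<forall>\<^sub>F x in at_right t. indicator {1} x = (indicator {1} t :: real)"
    using eventually_at_right_real[of t 1] by (auto elim!: eventually_mono simp: indicator_def)
  then show "((indicator {1} :: real \<Rightarrow> real) \<longlongrightarrow> indicator {1} t) (at_right t)"
    by (rule tendsto_eventually)
next
  fix t :: real
  assume t: "0 < t \<and> t \<le> 1"
  then have "\<forall>\<^sub>F x in at_left t. indicator {1} x = (0 :: real)"
    using eventually_at_left_real[of 0 t] by (auto elim!: eventually_mono simp: indicator_def)
  then show "\<exists>l. ((indicator {1} :: real \<Rightarrow> real) \<longlongrightarrow> l) (at_left t)"
    by (blast intro: tendsto_eventually)
qed

lemma tendsto_locally_bounded: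
  fixes f :: "real \<Rightarrow> real"
  assumes "(f \<longlongrightarrow> l) F"
  shows "\<forall>\<^sub>F x in F. \<bar>f x\<bar> \<le> \<bar>l\<bar> + 1"
  using tendstoD[OF assms zero_less_one]
  by (auto elim!: eventually_mono simp: dist_real_def)

lemma cadlag_on_unit_bounded:
  assumes f: "cadlag_on_unit f"
  shows "\<exists>b. \<forall>t\<in>{0..1}. \<bar>f t\<bar> \<le> b"
proof -
  have "\<exists>U b. open U \<and> t \<in> U \<and> (\<forall>x\<in>U \<inter> {0..1}. \<bar>f x\<bar> \<le> b)" if t: "t \<in> {0..1}" for t
  proof -
    have r: "\<exists>b c. t < c \<and> (\<forall>x. t < x \<and> x < c \<and> x \<le> 1 \<longrightarrow> \<bar>f x\<bar> \<le> b)"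
    proof (cases "t < 1")
      case True
      then have "(f \<longlongrightarrow> f t) (at_right t)"
        using f t by (auto simp: cadlag_on_unit_def)
      then show ?thesis
        using tendsto_locally_bounded[of f "f t" "at_right t"]
        by (auto simp: eventually_at_right_field)
    next
      case False
      then show ?thesis
        by (intro exI[of _ 0] exI[of _ "t + 1"]) auto
    qed
    have l: "\<exists>b c. c < t \<and> (\<forall>x. c < x \<and> x < t \<and> 0 \<le> x \<longrightarrow> \<bar>f x\<bar> \<le> b)"
    proof (cases "0 < t")
      case True
      then obtain l where "(f \<longlongrightarrow> l) (at_left t)"
        using f t by (auto simp: cadlag_on_unit_def)
      then show ?thesis
        using tendsto_locally_bounded[of f l "at_left t"]
        by (auto simp: eventually_at_left_field)
    next
      case False
      then show ?thesis
        by (intro exI[of _ 0] exI[of _ "t - 1"]) auto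
    qed
    obtain b1 c1 where 1: "t < c1" "\<And>x. t < x \<Longrightarrow> x < c1 \<Longrightarrow> x \<le> 1 \<Longrightarrow> \<bar>f x\<bar> \<le> b1"
      using r by blast
    obtain b2 c2 where 2: "c2 < t" "\<And>x. c2 < x \<Longrightarrow> x < t \<Longrightarrow> 0 \<le> x \<Longrightarrow> \<bar>f x\<bar> \<le> b2"
      using l by blast
    have "\<bar>f x\<bar> \<le> max (max b1 b2) \<bar>f t\<bar>" if "x \<in> {c2<..<c1} \<inter> {0..1}" for x
      using that 1(2)[of x] 2(2)[of x] by (cases x t rule: linorder_cases) auto
    then show ?thesis
      using 1(1) 2(1)
      by (intro exI[of _ "{c2<..<c1}"] exI[of _ "max (max b1 b2) \<bar>f t\<bar>"]) auto
  qed
  then obtain U b where U: "\<And>t. t \<in> {0..1} \<Longrightarrow> open (U t) \<and> t \<in> U t \<and>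
      (\<forall>x\<in>U t \<inter> {0..1}. \<bar>f x\<bar> \<le> b t)"
    by metis
  obtain T where T: "T \<subseteq> {0..1::real}" "finite T" "{0..1} \<subseteq> (\<Union>t\<in>T. U t)"
    by (rule compactE_image[of "{0..1::real}" "{0..1}" U]) (use U in auto)
  have "\<bar>f x\<bar> \<le> (\<Sum>t\<in>T. \<bar>b t\<bar>)" if x: "x \<in> {0..1}" for x
  proof -
    obtain t where t: "t \<in> T" "x \<in> U t" using T(3) x by auto
    then have "\<bar>f x\<bar> \<le> b t" using U[of t] T(1) x by auto
    also have "\<dots> \<le> \<bar>b t\<bar>" by simp
    also have "\<dots> \<le> (\<Sum>t\<in>T. \<bar>b t\<bar>)"
      using T(2) t(1) by (intro member_le_sum) auto
    finally show ?thesis .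
  qed
  then show ?thesis by blast
qed

typedef cadlag = "{f. cadlag_on_unit f \<and> (\<forall>t. t \<notin> {0..1} \<longrightarrow> f t = 0)}"
  morphisms apply_cadlag Cadlag
  by (intro exI[of _ "\<lambda>_. 0"]) simp

setup_lifting type_definition_cadlag

lemma cadlag_eqI: "(\<And>t. t \<in> {0..1} \<Longrightarrow> apply_cadlag f t = apply_cadlag g t) \<Longrightarrow> f = g"
proof -
  assume eq: "\<And>t. t \<in> {0..1} \<Longrightarrow> apply_cadlag f t = apply_cadlag g t"
  have "apply_cadlag f t = apply_cadlag g t" for t
    using apply_cadlag[of f] apply_cadlag[of g] eq[of t] by (cases "t \<in> {0..1}") simp_all
  then have "apply_cadlag f = apply_cadlag g" by (rule ext)
  then show "f = g" by (simp only: apply_cadlag_inject)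
qed

lemma cadlag_bdd_above: "bdd_above ((\<lambda>t. \<bar>apply_cadlag f t\<bar>) ` {0..1})"
proof -
  have "cadlag_on_unit (apply_cadlag f)" using apply_cadlag[of f] by simp
  then obtain b where "\<forall>t\<in>{0..1}. \<bar>apply_cadlag f t\<bar> \<le> b"
    using cadlag_on_unit_bounded by blast
  then show ?thesis by (intro bdd_aboveI2) auto
qed

instantiation cadlag :: real_vector
begin

lift_definition zero_cadlag :: cadlag is "\<lambda>_. 0"
  by simp

lift_definition plus_cadlag :: "cadlag \<Rightarrow> cadlag \<Rightarrow> cadlag" is "\<lambda>f g t. f t + g t"
  by (auto intro: cadlag_on_unit_add)

lift_definition scaleR_cadlag :: "real \<Rightarrow> cadlag \<Rightarrow> cadlag" is "\<lambda>c f t. c * f t"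
  by (auto intro: cadlag_on_unit_cmult)

definition uminus_cadlag :: "cadlag \<Rightarrow> cadlag" where
  "uminus_cadlag f = (-1) *\<^sub>R f"

definition minus_cadlag :: "cadlag \<Rightarrow> cadlag \<Rightarrow> cadlag" where
  "minus_cadlag f g = f + (-1) *\<^sub>R g"

instance
  by standard
     (unfold uminus_cadlag_def minus_cadlag_def, (transfer; simp add: algebra_simps fun_eq_iff)+)

end

lemmas apply_cadlag_simps [simp] =
  zero_cadlag.rep_eq plus_cadlag.rep_eq scaleR_cadlag.rep_eq

instantiation cadlag :: real_normed_vector
begin

definition norm_cadlag :: "cadlag \<Rightarrow> real" where
  "norm_cadlag f = (SUP t\<in>{0..1}. \<bar>apply_cadlag f t\<bar>)"

definition dist_cadlag :: "cadlag \<Rightarrow> cadlag \<Rightarrow> real" where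
  "dist_cadlag f g = norm (f - g)"

definition sgn_cadlag :: "cadlag \<Rightarrow> cadlag" where
  "sgn_cadlag f = f /\<^sub>R norm f"

definition uniformity_cadlag :: "(cadlag \<times> cadlag) filter" where
  "uniformity_cadlag = (INF e\<in>{0<..}. principal {(x, y). dist x y < e})"

definition open_cadlag :: "cadlag set \<Rightarrow> bool" where
  "open_cadlag S = (\<forall>x\<in>S. \<forall>\<^sub>F (x', y) in uniformity. x' = x \<longrightarrow> y \<in> S)"

lemma abs_apply_cadlag_le_norm: "t \<in> {0..1} \<Longrightarrow> \<bar>apply_cadlag f t\<bar> \<le> norm f"
  unfolding norm_cadlag_def by (rule cSUP_upper[OF _ cadlag_bdd_above])

lemma norm_cadlag_le: "(\<And>t. t \<in> {0..1} \<Longrightarrow> \<bar>apply_cadlag f t\<bar> \<le> b) \<Longrightarrow> norm f \<le> b"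
  unfolding norm_cadlag_def by (rule cSUP_least) auto

instance
proof
  fix a :: real and f g :: cadlag
  show "norm f = 0 \<longleftrightarrow> f = 0"
  proof
    assume "norm f = 0"
    then show "f = 0"
      using abs_apply_cadlag_le_norm[of _ f] by (intro cadlag_eqI) auto
  next
    assume "f = 0"
    then show "norm f = 0"
      by (simp add: norm_cadlag_def)
  qed
  show "norm (f + g) \<le> norm f + norm g"
  proof (rule norm_cadlag_le)
    fix t :: real
    assume "t \<in> {0..1}"
    then show "\<bar>apply_cadlag (f + g) t\<bar> \<le> norm f + norm g"
      using abs_apply_cadlag_le_norm[of t f] abs_apply_cadlag_le_norm[of t g] by simp
  qed
  have le: "norm (c *\<^sub>R h) \<le> \<bar>c\<bar> * norm h" for c and h :: cadlag
    by (rule norm_cadlag_le)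
       (use abs_apply_cadlag_le_norm[of _ h] in \<open>auto simp: abs_mult intro!: mult_left_mono\<close>)
  show "norm (a *\<^sub>R f) = \<bar>a\<bar> * norm f"
  proof (cases "a = 0")
    case True
    then show ?thesis by (simp add: norm_cadlag_def)
  next
    case False
    have "norm f \<le> \<bar>inverse a\<bar> * norm (a *\<^sub>R f)"
      using le[of "inverse a" "a *\<^sub>R f"] False by simp
    then have "\<bar>a\<bar> * norm f \<le> norm (a *\<^sub>R f)"
      using False by (simp add: field_simps)
    then show ?thesis using le[of a f] by simp
  qed
qed (rule dist_cadlag_def sgn_cadlag_def uniformity_cadlag_def open_cadlag_def)+

end


section \<open>Moderate deviation principle\<close>

definition ln_ereal :: "real \<Rightarrow> ereal" where
  "ln_ereal p = (if p = 0 then -\<infinity> else ereal (ln p))"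

definition functional_mdp ::
  "(nat \<Rightarrow> 'a measure) \<Rightarrow> (nat \<Rightarrow> 'a \<Rightarrow> cadlag) \<Rightarrow> (nat \<Rightarrow> real) \<Rightarrow> (cadlag \<Rightarrow> ereal) \<Rightarrow> bool"
where
  "functional_mdp M W a I \<longleftrightarrow>
     (\<forall>n\<ge>1. W n \<in> borel_measurable (M n)) \<and>
     a \<longlonglongrightarrow> 0 \<and>
     (\<forall>\<alpha>::ereal. \<alpha> < \<infinity> \<longrightarrow> compact {x. I x \<le> \<alpha>}) \<and>
     (\<forall>\<Gamma>\<in>sets borel.
        (let L = (\<lambda>n. ereal (a n) *
                   ln_ereal (measure (M n) {\<omega>\<in>space (M n). sqrt (a n) *\<^sub>R W n \<omega> \<in> \<Gamma>}))
         in - (INF z\<in>interior \<Gamma>. I z) \<le> liminf L \<and>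
            liminf L \<le> limsup L \<and>
            limsup L \<le> - (INF z\<in>closure \<Gamma>. I z)))"


section \<open>The rate function\<close>

definition absolutely_continuous_on_unit :: "(real \<Rightarrow> real) \<Rightarrow> bool" where
  "absolutely_continuous_on_unit f \<longleftrightarrow>
     (\<forall>\<epsilon>>0. \<exists>\<delta>>0. \<forall>(N::nat) l r.
        (\<forall>i<N. 0 \<le> l i \<and> l i \<le> r i \<and> r i \<le> 1) \<and>
        disjoint_family_on (\<lambda>i. {l i<..<r i}) {..<N} \<and>
        (\<Sum>i<N. r i - l i) < \<delta> \<longrightarrow>
        (\<Sum>i<N. \<bar>f (r i) - f (l i)\<bar>) < \<epsilon>)"

text \<open>
  An absolutely continuous function is differentiable almost everywhere, so the arbitrary value
  of \<open>deriv\<close> at points of non-differentiability does not affect the integral below, which may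
  be infinite.
\<close>

definition mdp_rate :: "cadlag \<Rightarrow> ereal" where
  "mdp_rate z =
     (if apply_cadlag z 0 = 0 \<and> absolutely_continuous_on_unit (apply_cadlag z)
      then ereal (1/2) *
        enn2ereal (\<integral>\<^sup>+u\<in>{0..1}. ennreal ((deriv (apply_cadlag z) u)\<^sup>2) \<partial>lebesgue)
      else \<infinity>)"


section \<open>The partial sum process of one row\<close>

definition row_sum :: "(nat \<Rightarrow> 'a \<Rightarrow> real) \<Rightarrow> nat \<Rightarrow> 'a \<Rightarrow> real" where
  "row_sum X l \<omega> = (\<Sum>j=1..l. X j \<omega>)"

definition row_var :: "'a measure \<Rightarrow> (nat \<Rightarrow> 'a \<Rightarrow> real) \<Rightarrow> nat \<Rightarrow> real" where
  "row_var M X i = (\<Sum>j=1..i. prob_space.variance M (X j))"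

definition row_sd :: "'a measure \<Rightarrow> (nat \<Rightarrow> 'a \<Rightarrow> real) \<Rightarrow> nat \<Rightarrow> real" where
  "row_sd M X i = sqrt (row_var M X i)"

lemma row_var_0 [simp]: "row_var M X 0 = 0"
  by (simp add: row_var_def)

lemma row_var_mono: "i \<le> j \<Longrightarrow> row_var M X i \<le> row_var M X j"
  unfolding row_var_def by (rule sum_mono2) auto

lemma row_var_nonneg: "0 \<le> row_var M X i"
  using row_var_mono[of 0 i] by simp

lemma row_var_ratio_bounds:
  assumes "i \<le> k"
  shows "0 \<le> row_var M X i / row_var M X k" "row_var M X i / row_var M X k \<le> 1"
  using row_var_mono[OF assms, of M X] row_var_nonneg[of M X i] row_var_nonneg[of M X k]
  by (auto simp: divide_le_eq_1)

text \<open>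
  The half-open intervals below are pairwise disjoint, so the sum of indicators is a definition
  by cases; this is the content of \<open>partial_sum_process_eq\<close> and \<open>partial_sum_process_1\<close>.
\<close>

lift_definition partial_sum_process ::
  "'a measure \<Rightarrow> (nat \<Rightarrow> 'a \<Rightarrow> real) \<Rightarrow> nat \<Rightarrow> 'a \<Rightarrow> cadlag"
is "\<lambda>M X k \<omega> t.
      (\<Sum>i=1..k. row_sum X (i - 1) \<omega> / row_sd M X k *
         indicator {row_var M X (i - 1) / row_var M X k ..< row_var M X i / row_var M X k} t)
      + row_sum X k \<omega> / row_sd M X k * indicator {1} t"
proof (intro conjI allI impI)
  fix M :: "'a measure" and X :: "nat \<Rightarrow> 'a \<Rightarrow> real" and k \<omega>
  show "cadlag_on_unit (\<lambda>t.
      (\<Sum>i=1..k. row_sum X (i - 1) \<omega> / row_sd M X k *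
         indicator {row_var M X (i - 1) / row_var M X k ..< row_var M X i / row_var M X k} t)
      + row_sum X k \<omega> / row_sd M X k * indicator {1} t)"
    by (intro cadlag_on_unit_add cadlag_on_unit_sum cadlag_on_unit_cmult
          cadlag_on_unit_indicator cadlag_on_unit_indicator_1)
next
  fix M :: "'a measure" and X :: "nat \<Rightarrow> 'a \<Rightarrow> real" and k \<omega> and t :: real
  assume t: "t \<notin> {0..1}"
  have "t \<notin> {row_var M X (i - 1) / row_var M X k ..< row_var M X i / row_var M X k}"
    if "i \<in> {1..k}" for i
  proof -
    have "i - 1 \<le> k" "i \<le> k" using that by auto
    then show ?thesis
      using t row_var_ratio_bounds(1)[of "i - 1" k M X] row_var_ratio_bounds(2)[of i k M X]
      by auto
  qed
  then have "(\<Sum>i=1..k. row_sum X (i - 1) \<omega> / row_sd M X k *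
      indicator {row_var M X (i - 1) / row_var M X k ..< row_var M X i / row_var M X k} t) = 0"
    by (intro sum.neutral ballI) (simp add: indicator_def)
  moreover have "t \<noteq> 1" using t by auto
  ultimately show "(\<Sum>i=1..k. row_sum X (i - 1) \<omega> / row_sd M X k *
      indicator {row_var M X (i - 1) / row_var M X k ..< row_var M X i / row_var M X k} t)
      + row_sum X k \<omega> / row_sd M X k * indicator {1} t = 0"
    by simp
qed

lemma partial_sum_process_eq:
  assumes i: "i \<in> {1..k}"
    and t: "t \<in> {row_var M X (i - 1) / row_var M X k ..< row_var M X i / row_var M X k}"
  shows "apply_cadlag (partial_sum_process M X k \<omega>) t = row_sum X (i - 1) \<omega> / row_sd M X k"
proof -
  let ?J = "\<lambda>i. {row_var M X (i - 1) / row_var M X k ..< row_var M X i / row_var M X k}"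
  have "t \<notin> ?J j" if "j \<noteq> i" for j
  proof (cases "j < i")
    case True
    then have "row_var M X j / row_var M X k \<le> row_var M X (i - 1) / row_var M X k"
      by (intro divide_right_mono row_var_mono row_var_nonneg) auto
    then show ?thesis using t by auto
  next
    case False
    then have "row_var M X i / row_var M X k \<le> row_var M X (j - 1) / row_var M X k"
      using that by (intro divide_right_mono row_var_mono row_var_nonneg) auto
    then show ?thesis using t by auto
  qed
  then have "(\<Sum>j=1..k. row_sum X (j - 1) \<omega> / row_sd M X k * indicator (?J j) t) =
      (\<Sum>j=1..k. if j = i then row_sum X (i - 1) \<omega> / row_sd M X k else 0)"
    using t by (intro sum.cong) (auto simp: indicator_def)
  moreover have "t \<noteq> 1"
    using t row_var_ratio_bounds(2)[of i k M X] i by auto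
  ultimately show ?thesis
    using i by (simp add: partial_sum_process.rep_eq)
qed

lemma partial_sum_process_1:
  "apply_cadlag (partial_sum_process M X k \<omega>) 1 = row_sum X k \<omega> / row_sd M X k"
proof -
  have "1 \<notin> {row_var M X (i - 1) / row_var M X k ..< row_var M X i / row_var M X k}"
    if "i \<in> {1..k}" for i
    using that row_var_ratio_bounds(2)[of i k M X] by auto
  then have "(\<Sum>i=1..k. row_sum X (i - 1) \<omega> / row_sd M X k *
      indicator {row_var M X (i - 1) / row_var M X k ..< row_var M X i / row_var M X k} (1::real)) = 0"
    by (intro sum.neutral ballI) (simp add: indicator_def)
  then show ?thesis by (simp add: partial_sum_process.rep_eq)
qed

end

theory Submission
  imports Defs "HOL-Complex_Analysis.Great_Picard"
begin

text \<open>
  Cut \<open>[0,1]\<close> into \<open>m\<close> equal cells. The moment condition gives, for every block of a row, a Laplace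
  transform that is Gaussian up to \<open>exp (o(1) / a n)\<close>, uniformly in the block. For the vector of the
  \<open>m\<close> cell increments of the process, which are independent, exponential Chebyshev bounds on half-spaces
  and exponential tilting give the large deviation bounds with the discrete energy
  \<open>m / 2 * (\<Sum>i<m. (z ((i+1)/m) - z (i/m))\<^sup>2)\<close>, and Ottaviani's inequality makes the oscillation inside
  the cells negligible as \<open>m\<close> grows. The discrete energy of \<open>z\<close> is at most the rate of \<open>z\<close>, with equality
  for the linear interpolation; this transfers the bounds to the function space. The facts needed about the
  rate function rest on almost everywhere differentiability and the fundamental theorem of calculus
  for absolutely continuous functions, proved from Vitali's covering theorem. Its level sets
  are compact by the theorem of Arzela and Ascoli and Fatou's lemma.
\<close>

subsection \<open>Monotone functions\<close>

text \<open>The tilting parameter of a summand is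
  \<open>\<mu> = \<theta> / (sqrt (a n) * s n)\<close>. Its Taylor errors add up to at most a
  multiple of \<open>\<bar>\<mu>\<bar> * max A\<close> times
  \<open>\<mu>\<^sup>2 * B n * (\<Sum>j. (A n j)\<^sup>2)\<close>, that is o(1) times
  \<open>C * \<theta>\<^sup>2 / a n\<close>: the two assumptions on \<open>A\<close> act on exactly
  this scale. The fourth moments also force the variance share of each single summand to vanish, so
  that partial variances come close to every grid time. The rate is written with the pointwise
  \<open>deriv\<close>, which controls a path only if the path is the integral of its derivative.
  Level sets are therefore redescribed by bounds on sums of squared increments over lengths, taken
  over finite families of disjoint intervals. Such bounds involve finitely many values of the path
  and so survive limits. The uniform norm makes D[0,1] nonseparable; measurability of the process
  comes from factoring it through its finitely many partial sums. A closed set is treated through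
  its positive distance to a compact level set, so the only finite-dimensional upper bound needed is
  the one for complements of energy ellipsoids.\<close>

lemma emeasure_UN_intervals:
  fixes l r :: "'i \<Rightarrow> real"
  assumes "countable K" "\<And>i. i \<in> K \<Longrightarrow> l i \<le> r i"
    and "disjoint_family_on (\<lambda>i. {l i<..<r i}) K"
  shows "emeasure lborel (\<Union>i\<in>K. {l i<..<r i}) = (\<integral>\<^sup>+i. ennreal (r i - l i) \<partial>count_space K)"
proof -
  have "emeasure lborel (\<Union>i\<in>K. {l i<..<r i}) = (\<integral>\<^sup>+i. emeasure lborel {l i<..<r i} \<partial>count_space K)"
    using assms by (intro emeasure_UN_countable) auto
  also have "\<dots> = (\<integral>\<^sup>+i. ennreal (r i - l i) \<partial>count_space K)"
    using assms by (intro nn_integral_cong) auto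
  finally show ?thesis .
qed

lemma sum_disjoint_intervals_le:
  fixes l r :: "'i \<Rightarrow> real"
  assumes "finite K" "\<And>i. i \<in> K \<Longrightarrow> l i \<le> r i"
    and "disjoint_family_on (\<lambda>i. {l i<..<r i}) K"
    and sub: "(\<Union>i\<in>K. {l i<..<r i}) \<subseteq> U" and U: "U \<in> lmeasurable"
  shows "(\<Sum>i\<in>K. r i - l i) \<le> measure lebesgue U"
proof -
  have "(\<Sum>i\<in>K. r i - l i) = (\<Sum>i\<in>K. measure lebesgue {l i<..<r i})"
    using assms(2) by (intro sum.cong) auto
  also have "\<dots> = measure lebesgue (\<Union>i\<in>K. {l i<..<r i})"
    using assms(1,3) by (intro measure_finite_Union[symmetric]) (auto simp: assms(2))
  also have "\<dots> \<le> measure lebesgue U"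
    using sub U assms(1) by (intro measure_mono_fmeasurable) auto
  finally show ?thesis .
qed

text \<open>The increments of \<open>F\<close> are the lengths of the disjoint intervals \<open>{F (l i)<..<F (r i)}\<close>, so no
  continuity of \<open>F\<close> and no Stieltjes measure is needed.\<close>

lemma mono_increments_le:
  fixes F :: "real \<Rightarrow> real"
  assumes F: "mono F" and K: "countable K"
    and lr: "\<And>i. i \<in> K \<Longrightarrow> a \<le> l i \<and> l i \<le> r i \<and> r i \<le> b"
    and disj: "disjoint_family_on (\<lambda>i. {l i..r i}) K" and ab: "a \<le> b"
  shows "(\<integral>\<^sup>+i. ennreal (F (r i) - F (l i)) \<partial>count_space K) \<le> ennreal (F b - F a)"
proof -
  have "(\<integral>\<^sup>+i. ennreal (F (r i) - F (l i)) \<partial>count_space K)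
      = emeasure lborel (\<Union>i\<in>K. {F (l i)<..<F (r i)})"
  proof (rule emeasure_UN_intervals[symmetric, OF K])
    show "F (l i) \<le> F (r i)" if "i \<in> K" for i
      using lr[OF that] monoD[OF F] by blast
    show "disjoint_family_on (\<lambda>i. {F (l i)<..<F (r i)}) K"
      unfolding disjoint_family_on_def
    proof (intro ballI impI)
      fix i j assume ij: "i \<in> K" "j \<in> K" "i \<noteq> j"
      then have e: "{l i..r i} \<inter> {l j..r j} = {}"
        using disj by (auto simp: disjoint_family_on_def)
      have "r i < l j \<or> r j < l i"
      proof (rule ccontr)
        assume "\<not> (r i < l j \<or> r j < l i)"
        then have "max (l i) (l j) \<in> {l i..r i} \<inter> {l j..r j}"
          using lr[OF ij(1)] lr[OF ij(2)] by (simp add: max_def)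
        with e show False by blast
      qed
      then have "F (r i) \<le> F (l j) \<or> F (r j) \<le> F (l i)"
        using monoD[OF F, of "r i" "l j"] monoD[OF F, of "r j" "l i"] by auto
      then show "{F (l i)<..<F (r i)} \<inter> {F (l j)<..<F (r j)} = {}" by auto
    qed
  qed
  also have "\<dots> \<le> emeasure lborel {F a..F b}"
  proof (rule emeasure_mono)
    show "(\<Union>i\<in>K. {F (l i)<..<F (r i)}) \<subseteq> {F a..F b}"
    proof (intro UN_least subsetI)
      fix i y assume "i \<in> K" "y \<in> {F (l i)<..<F (r i)}"
      then show "y \<in> {F a..F b}"
        using lr[of i] monoD[OF F, of a "l i"] monoD[OF F, of "r i" b] by auto
    qed
  qed auto
  also have "\<dots> = ennreal (F b - F a)" using ab monoD[OF F, of a b] by simp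
  finally show ?thesis .
qed

text \<open>Closed balls of the line are intervals, so Vitali's theorem for balls applies once a
  pair \<open>(p, q)\<close> is read as centre and radius. \<open>P\<close> stays open because both
  steep and flat intervals will be selected; confinement to \<open>U\<close> later bounds their
  total length.\<close>

lemma Vitali_intervals:
  fixes S U :: "real set" and P :: "real \<Rightarrow> real \<Rightarrow> bool"
  assumes U: "open U" "S \<subseteq> U"
    and S: "\<And>x d. x \<in> S \<Longrightarrow> d > 0 \<Longrightarrow> \<exists>p q. p < x \<and> x < q \<and> q - p < d \<and> P p q"
  obtains C where "countable C" "\<And>i. i \<in> C \<Longrightarrow> fst i < snd i \<and> {fst i..snd i} \<subseteq> U \<and> P (fst i) (snd i)"
    "disjoint_family_on (\<lambda>i. {fst i..snd i}) C" "negligible (S - (\<Union>i\<in>C. {fst i..snd i}))"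
proof -
  define K where "K = {i. fst i < snd i \<and> {fst i..snd i} \<subseteq> U \<and> P (fst i) (snd i)}"
  define c e where "c i = (fst i + snd i) / 2" and "e i = (snd i - fst i) / 2" for i :: "real \<times> real"
  have "c i - e i = fst i" "c i + e i = snd i" for i
    by (simp_all add: c_def e_def diff_divide_distrib[symmetric] add_divide_distrib[symmetric])
  then have cb: "cball (c i) (e i) = {fst i..snd i}" for i
    by (simp add: cball_eq_atLeastAtMost)
  have 1: "0 < e i" if "i \<in> K" for i using that by (auto simp: K_def e_def)
  have 2: "\<exists>i. i \<in> K \<and> x \<in> cball (c i) (e i) \<and> e i < d" if x: "x \<in> S" "0 < d" for x d
  proof -
    obtain \<epsilon> where \<epsilon>: "\<epsilon> > 0" "ball x \<epsilon> \<subseteq> U"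
      using U x by (meson openE subsetD)
    obtain p q where pq: "p < x" "x < q" "q - p < min \<epsilon> d" "P p q"
      using S[of x "min \<epsilon> d"] x \<epsilon> by auto
    have "{p..q} \<subseteq> ball x \<epsilon>" using pq by (auto simp: dist_real_def)
    then have "(p, q) \<in> K" using pq \<epsilon> by (auto simp: K_def)
    then show ?thesis using pq x by (intro exI[of _ "(p,q)"]) (auto simp: cb, simp add: e_def)
  qed
  obtain C where C: "countable C" "C \<subseteq> K"
     "pairwise (\<lambda>i j. disjnt (cball (c i) (e i)) (cball (c j) (e j))) C"
     "negligible(S - (\<Union>i \<in> C. cball (c i) (e i)))"
    by (rule Vitali_covering_theorem_cballs[of K e S c, OF 1 2])
  show ?thesis
  proof (rule that[OF C(1)])
    show "fst i < snd i \<and> {fst i..snd i} \<subseteq> U \<and> P (fst i) (snd i)" if "i \<in> C" for i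
      using that C(2) by (auto simp: K_def)
    show "disjoint_family_on (\<lambda>i. {fst i..snd i}) C"
      using C(3) unfolding cb by (auto simp: disjoint_family_on_def pairwise_def disjnt_def)
    show "negligible (S - (\<Union>i\<in>C. {fst i..snd i}))"
      using C(4) unfolding cb .
  qed
qed

text \<open>Disjoint steep intervals cover \<open>S\<close> up to a null set. On each of them
  \<open>F\<close> grows by at least \<open>v\<close> times the length, while the total growth over
  disjoint intervals is at most \<open>F b - F a\<close>.\<close>

lemma mono_steep_emeasure_le:
  fixes F :: "real \<Rightarrow> real"
  assumes F: "mono F" and S: "S \<in> sets lebesgue" "S \<subseteq> {a<..<b}" and ab: "a \<le> b" and v: "0 \<le> v"
    and steep: "\<And>x d. x \<in> S \<Longrightarrow> d > 0 \<Longrightarrow> \<exists>p q. p < x \<and> x < q \<and> q - p < d \<and> v * (q - p) \<le> F q - F p"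
  shows "ennreal v * emeasure lebesgue S \<le> ennreal (F b - F a)"
proof -
  obtain C where C: "countable C" and
     Ci: "\<And>i. i \<in> C \<Longrightarrow> fst i < snd i \<and> {fst i..snd i} \<subseteq> {a<..<b} \<and> v * (snd i - fst i) \<le> F (snd i) - F (fst i)"
    and disj: "disjoint_family_on (\<lambda>i. {fst i..snd i}) C" and neg: "negligible (S - (\<Union>i\<in>C. {fst i..snd i}))"
    by (rule Vitali_intervals[OF open_greaterThanLessThan S(2),
          of "\<lambda>p q. v * (q - p) \<le> F q - F p"]) (use steep in auto)
  have UC: "(\<Union>i\<in>C. {fst i..snd i}) \<in> sets lebesgue" using C by (intro sets.countable_UN') auto
  have "emeasure lebesgue S \<le> emeasure lebesgue ((\<Union>i\<in>C. {fst i..snd i}) \<union> (S - (\<Union>i\<in>C. {fst i..snd i})))"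
    using S UC by (intro emeasure_mono) auto
  also have "\<dots> = emeasure lebesgue (\<Union>i\<in>C. {fst i..snd i})"
    using neg UC by (intro emeasure_Un_null_set) (auto simp: negligible_iff_null_sets)
  also have "\<dots> = (\<integral>\<^sup>+i. emeasure lebesgue {fst i..snd i} \<partial>count_space C)"
    using C disj by (intro emeasure_UN_countable) auto
  also have "\<dots> = (\<integral>\<^sup>+i. ennreal (snd i - fst i) \<partial>count_space C)"
    using Ci by (intro nn_integral_cong) (auto simp: less_imp_le)
  finally have "ennreal v * emeasure lebesgue S \<le> ennreal v * (\<integral>\<^sup>+i. ennreal (snd i - fst i) \<partial>count_space C)"
    by (rule mult_left_mono) auto
  also have "\<dots> = (\<integral>\<^sup>+i. ennreal v * ennreal (snd i - fst i) \<partial>count_space C)"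
    by (rule nn_integral_cmult[symmetric]) auto
  also have "\<dots> \<le> (\<integral>\<^sup>+i. ennreal (F (snd i) - F (fst i)) \<partial>count_space C)"
  proof (rule nn_integral_mono)
    fix i assume "i \<in> space (count_space C)"
    then have "i \<in> C" by simp
    from Ci[OF this] show "ennreal v * ennreal (snd i - fst i) \<le> ennreal (F (snd i) - F (fst i))"
      using v by (simp add: ennreal_mult[symmetric] ennreal_leI)
  qed
  also have "\<dots> \<le> ennreal (F b - F a)"
  proof (rule mono_increments_le[OF F C _ disj ab])
    fix i assume "i \<in> C"
    from Ci[OF this] have "fst i < snd i" "{fst i..snd i} \<subseteq> {a<..<b}" by auto
    moreover from this have "fst i \<in> {fst i..snd i}" "snd i \<in> {fst i..snd i}" by auto
    ultimately have "fst i \<in> {a<..<b}" "snd i \<in> {a<..<b}" "fst i < snd i" by blast+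
    then show "a \<le> fst i \<and> fst i \<le> snd i \<and> snd i \<le> b" by auto
  qed
  finally show ?thesis .
qed

lemma lmeasurable_outer_open:
  fixes S :: "'a::euclidean_space set"
  assumes S: "S \<in> lmeasurable" and e: "e > 0"
  obtains U where "open U" "S \<subseteq> U" "U \<in> lmeasurable" "measure lebesgue U < measure lebesgue S + e"
proof -
  obtain T where T: "open T" "S \<subseteq> T" "(T - S) \<in> lmeasurable" "emeasure lebesgue (T - S) < ennreal e"
    by (rule sets_lebesgue_outer_open[OF fmeasurableD[OF S] e])
  have un: "T = S \<union> (T - S)" using T by auto
  have "T \<in> lmeasurable" using S T(3) by (subst un) (rule fmeasurable.Un)
  moreover have "measure lebesgue T < measure lebesgue S + e"
  proof -
    have "measure lebesgue T \<le> measure lebesgue S + measure lebesgue (T - S)"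
      using S T(3) by (subst un) (intro measure_Un_le fmeasurableD)
    moreover have "measure lebesgue (T - S) < e"
      using T(3,4) e by (simp add: emeasure_eq_measure2 ennreal_less_iff)
    ultimately show ?thesis by simp
  qed
  ultimately show ?thesis using T that by blast
qed

text \<open>Cover \<open>S\<close> by flat intervals inside an open set of almost the same measure.
  Inside each flat interval the steep bound gives \<open>v\<close> times the measure of the part of
  \<open>S\<close> on the left and at most \<open>u\<close> times the length on the right. Summing
  yields \<open>v * m \<le> u * (m + \<epsilon>)\<close>, which forces \<open>m = 0\<close>.\<close>

lemma mono_steep_flat_null:
  fixes F :: "real \<Rightarrow> real"
  assumes F: "mono F" and S: "S \<in> sets lebesgue" "S \<subseteq> {a<..<b}" and ab: "a \<le> b" and uv: "0 \<le> u" "u < v"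
    and steep: "\<And>x d. x \<in> S \<Longrightarrow> d > 0 \<Longrightarrow> \<exists>p q. p < x \<and> x < q \<and> q - p < d \<and> v * (q - p) \<le> F q - F p"
    and flat: "\<And>x d. x \<in> S \<Longrightarrow> d > 0 \<Longrightarrow> \<exists>p q. p < x \<and> x < q \<and> q - p < d \<and> F q - F p \<le> u * (q - p)"
  shows "emeasure lebesgue S = 0"
proof -
  have Sl: "S \<in> lmeasurable"
    using S bounded_subset[OF bounded_Ioo[of a b], of S] by (intro bounded_set_imp_lmeasurable) auto
  define m where "m = measure lebesgue S"
  have em: "emeasure lebesgue S = ennreal m" using Sl by (simp add: m_def emeasure_eq_measure2)
  have m0: "m \<ge> 0" by (simp add: m_def)
  have key: "v * m \<le> u * (m + \<epsilon>)" if \<epsilon>: "\<epsilon> > 0" for \<epsilon>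
  proof -
    obtain U where U: "open U" "S \<subseteq> U" "U \<in> lmeasurable" "measure lebesgue U < m + \<epsilon>"
      unfolding m_def by (rule lmeasurable_outer_open[OF Sl \<epsilon>])
    obtain C where C: "countable C" and
       Ci: "\<And>i. i \<in> C \<Longrightarrow> fst i < snd i \<and> {fst i..snd i} \<subseteq> U \<and> F (snd i) - F (fst i) \<le> u * (snd i - fst i)"
      and disj: "disjoint_family_on (\<lambda>i. {fst i..snd i}) C" and neg: "negligible (S - (\<Union>i\<in>C. {fst i..snd i}))"
      by (rule Vitali_intervals[OF U(1,2),
            of "\<lambda>p q. F q - F p \<le> u * (q - p)"]) (use flat in auto)
    have UC: "(\<Union>i\<in>C. {fst i..snd i}) \<in> sets lebesgue" using C by (intro sets.countable_UN') auto
    have disj': "disjoint_family_on (\<lambda>i. S \<inter> {fst i..snd i}) C"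
      using disj unfolding disjoint_family_on_def by blast
    have "emeasure lebesgue S \<le> emeasure lebesgue ((\<Union>i\<in>C. S \<inter> {fst i..snd i}) \<union> (S - (\<Union>i\<in>C. {fst i..snd i})))"
      using S UC C by (intro emeasure_mono sets.Un sets.countable_UN') auto
    also have "\<dots> = emeasure lebesgue (\<Union>i\<in>C. S \<inter> {fst i..snd i})"
      using neg S C by (intro emeasure_Un_null_set sets.countable_UN') (auto simp: negligible_iff_null_sets)
    also have "\<dots> = (\<integral>\<^sup>+i. emeasure lebesgue (S \<inter> {fst i..snd i}) \<partial>count_space C)"
      using C disj' S by (intro emeasure_UN_countable) auto
    finally have "ennreal v * emeasure lebesgue S \<le> ennreal v * (\<integral>\<^sup>+i. emeasure lebesgue (S \<inter> {fst i..snd i}) \<partial>count_space C)"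
      by (rule mult_left_mono) auto
    also have "\<dots> = (\<integral>\<^sup>+i. ennreal v * emeasure lebesgue (S \<inter> {fst i..snd i}) \<partial>count_space C)"
      by (rule nn_integral_cmult[symmetric]) auto
    also have "\<dots> \<le> (\<integral>\<^sup>+i. ennreal u * emeasure lebesgue {fst i..snd i} \<partial>count_space C)"
    proof (rule nn_integral_mono)
      fix i assume "i \<in> space (count_space C)"
      then have "i \<in> C" by simp
      note c = Ci[OF this]
      \<comment> \<open>The steep bound wants a subset of an open interval, so the two endpoints are
        split off as a null set.\<close>
      have "emeasure lebesgue (S \<inter> {fst i..snd i}) \<le> emeasure lebesgue (S \<inter> {fst i<..<snd i} \<union> {fst i, snd i})"
        using S by (intro emeasure_mono sets.Un sets.Int) auto
      also have "\<dots> = emeasure lebesgue (S \<inter> {fst i<..<snd i})"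
        using S by (intro emeasure_Un_null_set) (auto simp: negligible_iff_null_sets[symmetric])
      finally have "ennreal v * emeasure lebesgue (S \<inter> {fst i..snd i}) \<le> ennreal v * emeasure lebesgue (S \<inter> {fst i<..<snd i})"
        by (rule mult_left_mono) auto
      also have "\<dots> \<le> ennreal (F (snd i) - F (fst i))"
        using c uv S steep by (intro mono_steep_emeasure_le[OF F]) auto
      also have "\<dots> \<le> ennreal (u * (snd i - fst i))" using c by (intro ennreal_leI) auto
      also have "\<dots> = ennreal u * emeasure lebesgue {fst i..snd i}"
        using c uv by (simp add: ennreal_mult less_imp_le)
      finally show "ennreal v * emeasure lebesgue (S \<inter> {fst i..snd i}) \<le> ennreal u * emeasure lebesgue {fst i..snd i}" .
    qed
    also have "\<dots> = ennreal u * (\<integral>\<^sup>+i. emeasure lebesgue {fst i..snd i} \<partial>count_space C)"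
      by (rule nn_integral_cmult) auto
    also have "(\<integral>\<^sup>+i. emeasure lebesgue {fst i..snd i} \<partial>count_space C) = emeasure lebesgue (\<Union>i\<in>C. {fst i..snd i})"
      using C disj by (intro emeasure_UN_countable[symmetric]) auto
    also have "ennreal u * emeasure lebesgue (\<Union>i\<in>C. {fst i..snd i}) \<le> ennreal u * emeasure lebesgue U"
      using Ci U by (intro mult_left_mono emeasure_mono) auto
    also have "emeasure lebesgue U = ennreal (measure lebesgue U)" using U(3) by (simp add: emeasure_eq_measure2)
    also have "ennreal u * ennreal (measure lebesgue U) \<le> ennreal u * ennreal (m + \<epsilon>)"
      using U(4) by (intro mult_left_mono ennreal_leI) auto
    finally show ?thesis
      using uv m0 \<epsilon> unfolding em by (simp add: ennreal_mult[symmetric] del: ennreal_plus)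
  qed
  have "m = 0"
  proof (rule ccontr)
    assume "m \<noteq> 0"
    with m0 have mp: "m > 0" by simp
    \<comment> \<open>This makes \<open>u * \<epsilon>\<close> at most half of
      \<open>(v - u) * m\<close>; the summand 1 in the denominator covers
      \<open>u = 0\<close>.\<close>
    define \<epsilon> where "\<epsilon> = (v - u) * m / (2 * (u + 1))"
    have \<epsilon>: "\<epsilon> > 0" using uv mp by (auto simp: \<epsilon>_def)
    have "(u+1) * \<epsilon> = (v-u) * m / 2" using uv by (simp add: \<epsilon>_def field_simps)
    moreover have "u * \<epsilon> \<le> (u+1) * \<epsilon>" using \<epsilon> by simp
    moreover have "(v - u) * m \<le> u * \<epsilon>" using key[OF \<epsilon>] by (simp add: algebra_simps)
    moreover have "(v-u) * m > 0" using uv mp by simp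
    ultimately show False by linarith
  qed
  then show ?thesis using em by simp
qed

text \<open>For a fixed length bound \<open>1 / Suc n\<close> the admissible points form a union of
  open intervals, whatever \<open>P\<close> is; the set is the countable intersection of
  these.\<close>

lemma Gdelta_straddle:
  fixes P :: "real \<Rightarrow> real \<Rightarrow> bool"
  shows "{x. \<forall>d>0. \<exists>p q. p < x \<and> x < q \<and> q - p < d \<and> P p q} \<in> sets borel"
proof -
  have "{x. \<forall>d>0. \<exists>p q. p < x \<and> x < q \<and> q - p < d \<and> P p q}
      = (\<Inter>n::nat. \<Union>i\<in>{i. snd i - fst i < 1 / Suc n \<and> P (fst i) (snd i)}. {fst i<..<snd i})" (is "?L = ?R")
  proof (intro set_eqI iffI)
    fix x assume "x \<in> ?L"
    then have d: "\<exists>p q. p < x \<and> x < q \<and> q - p < d \<and> P p q" if "d > 0" for d using that by blast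
    have "\<exists>i. snd i - fst i < 1 / Suc n \<and> P (fst i) (snd i) \<and> fst i < x \<and> x < snd i" for n
      using d[of "1 / Suc n"] by auto
    then show "x \<in> ?R" by simp
  next
    fix x assume x: "x \<in> ?R"
    show "x \<in> ?L"
    proof (intro CollectI allI impI)
      fix d :: real assume "d > 0"
      then obtain n where n: "1 / real (Suc n) < d" using nat_approx_posE by blast
      from x have "x \<in> (\<Union>i\<in>{i. snd i - fst i < 1 / Suc n \<and> P (fst i) (snd i)}. {fst i<..<snd i})" by blast
      then obtain i where i: "snd i - fst i < 1 / Suc n" "P (fst i) (snd i)" "fst i < x" "x < snd i" by auto
      then show "\<exists>p q. p < x \<and> x < q \<and> q - p < d \<and> P p q"
        using n by (intro exI[of _ "fst i"] exI[of _ "snd i"]) auto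
    qed
  qed
  moreover have "?R \<in> sets borel"
    by (intro sets.countable_INT'') (auto intro!: borel_open)
  ultimately show ?thesis by simp
qed

text \<open>Difference quotients are taken over intervals strictly containing the point: this makes the
  exceptional sets Borel, and at a point of continuity it yields the usual derivative.\<close>

lemma mono_differentiable_AE:
  fixes F :: "real \<Rightarrow> real"
  assumes F: "mono F"
  shows "negligible {x\<in>{a<..<b}. \<not> F differentiable at x}"
proof (cases "a < b")
  case False
  then show ?thesis by auto
next
  case ab: True
  \<comment> \<open>Arbitrarily short intervals around a point of \<open>H v\<close> have slope at
    least \<open>v\<close>, around a point of \<open>G u\<close> slope at most \<open>u\<close>. A
    point where the upper and lower derivates differ lies in both sets for some rationals
    \<open>u < v\<close>.\<close>
  define H where "H v = {x. \<forall>d>0. \<exists>p q. p < x \<and> x < q \<and> q - p < d \<and> v * (q - p) \<le> F q - F p}" for v :: real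
  define G where "G u = {x. \<forall>d>0. \<exists>p q. p < x \<and> x < q \<and> q - p < d \<and> F q - F p \<le> u * (q - p)}" for u :: real
  have [measurable]: "H v \<in> sets borel" "G v \<in> sets borel" for v
    unfolding H_def G_def by (rule Gdelta_straddle)+
  have HG: "negligible (H v \<inter> G u \<inter> {a<..<b})" if "0 \<le> u" "u < v" for u v
  proof -
    have "H v \<inter> G u \<inter> {a<..<b} \<in> sets borel" by measurable
    then have Sm: "H v \<inter> G u \<inter> {a<..<b} \<in> sets lebesgue" by auto
    have "emeasure lebesgue (H v \<inter> G u \<inter> {a<..<b}) = 0"
      by (rule mono_steep_flat_null[OF F Sm, of a b u v]) (use that ab in \<open>auto simp: H_def G_def\<close>)
    with Sm show ?thesis by (auto simp: negligible_iff_null_sets null_sets_def)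
  qed
  \<comment> \<open>These are the points with infinite upper derivate; the steep bound with every
    slope \<open>n\<close> leaves them no measure.\<close>
  have Hinf: "negligible ((\<Inter>n::nat. H (real n)) \<inter> {a<..<b})" (is "negligible ?S")
  proof -
    have Sm: "?S \<in> sets lebesgue" by (auto intro!: sets.Int sets.countable_INT'')
    have Sl: "?S \<in> lmeasurable"
      using Sm bounded_subset[OF bounded_Ioo[of a b], of ?S] by (intro bounded_set_imp_lmeasurable) auto
    have em: "emeasure lebesgue ?S = ennreal (measure lebesgue ?S)" using Sl by (simp add: emeasure_eq_measure2)
    have "real n * measure lebesgue ?S \<le> F b - F a" for n
    proof -
      have "ennreal (real n) * emeasure lebesgue ?S \<le> ennreal (F b - F a)"
        using ab Sm by (intro mono_steep_emeasure_le[OF F]) (auto simp: H_def)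
      then show ?thesis
        using monoD[OF F, of a b] ab unfolding em by (simp add: ennreal_mult[symmetric])
    qed
    then have "measure lebesgue ?S \<le> 0"
      using ex_less_of_nat_mult[of "measure lebesgue ?S" "F b - F a"] by (meson leI linorder_not_less)
    then show ?thesis using em Sm by (auto simp: negligible_iff_null_sets null_sets_def measure_nonneg antisym)
  qed
  define N where "N = (\<Union>(u,v)\<in>{(u,v). u \<in> \<rat> \<and> v \<in> \<rat> \<and> 0 \<le> u \<and> u < v}. H v \<inter> G u \<inter> {a<..<b})
      \<union> (\<Inter>n::nat. H (real n)) \<inter> {a<..<b} \<union> {x. \<not> isCont F x}"
  have "countable {(u,v). u \<in> \<rat> \<and> v \<in> \<rat> \<and> 0 \<le> u \<and> u < (v::real)}"
    by (rule countable_subset[of _ "\<rat> \<times> \<rat>"]) (auto intro: countable_rat)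
  then have "negligible (\<Union>(u,v)\<in>{(u,v). u \<in> \<rat> \<and> v \<in> \<rat> \<and> 0 \<le> u \<and> u < v}. H v \<inter> G u \<inter> {a<..<b})"
    by (intro negligible_countable_Union countable_image) (auto intro: HG)
  moreover have "negligible {x. \<not> isCont F x}"
    using mono_ctble_discont[OF F]
    by (auto simp: negligible_iff_null_sets intro!: null_sets_completionI countable_imp_null_set_lborel)
  ultimately have N: "negligible N"
    unfolding N_def using Hinf by (intro negligible_Un)
  have "F differentiable at x" if x: "x \<in> {a<..<b}" "x \<notin> N" for x
  proof -
    have cont: "isCont F x" using x by (auto simp: N_def)
    obtain n0 :: nat where n0: "x \<notin> H (real n0)" using x by (auto simp: N_def)
    have Hanti: "x \<in> H u" if "x \<in> H v" "u \<le> v" for u v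
    proof -
      have "u * (q - p) \<le> F q - F p" if "v * (q - p) \<le> F q - F p" "p < x" "x < q" for p q
        using mult_right_mono[OF \<open>u \<le> v\<close>, of "q - p"] that by linarith
      then show ?thesis using \<open>x \<in> H v\<close> unfolding H_def by blast
    qed
    have H0: "x \<in> H 0"
    proof -
      have "\<exists>p q. p < x \<and> x < q \<and> q - p < d \<and> 0 * (q - p) \<le> F q - F p" if "d > 0" for d
        using that by (intro exI[of _ "x - d/3"] exI[of _ "x + d/3"]) (auto intro!: monoD[OF F])
      then show ?thesis unfolding H_def by blast
    qed
    \<comment> \<open>The upper derivate at \<open>x\<close>, finite since \<open>x\<close> avoids
      some \<open>H (real n0)\<close>. It will be the derivative.\<close>
    define L where "L = Sup {v. x \<in> H v}"
    have bdd: "bdd_above {v. x \<in> H v}"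
    proof (rule bdd_aboveI)
      fix v assume "v \<in> {v. x \<in> H v}"
      then show "v \<le> real n0" using Hanti[of v "real n0"] n0 by (cases "v \<le> real n0") auto
    qed
    have L0: "0 \<le> L" unfolding L_def using H0 by (intro cSup_upper bdd) auto
    have up: "\<exists>d>0. \<forall>p q. p < x \<and> x < q \<and> q - p < d \<longrightarrow> F q - F p < v * (q - p)" if "L < v" for v
    proof -
      have "x \<notin> H v" using cSup_upper[OF _ bdd, of v] that by (auto simp: L_def)
      then show ?thesis by (auto simp: H_def not_le)
    qed
    have lo: "\<exists>d>0. \<forall>p q. p < x \<and> x < q \<and> q - p < d \<longrightarrow> u * (q - p) \<le> F q - F p" if "u < L" for u
    proof (cases "u < 0")
      case True
      have "u * (q - p) \<le> F q - F p" if "p < x" "x < q" for p q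
        using monoD[OF F, of p q] mult_nonpos_nonneg[of u "q - p"] True that by auto
      then show ?thesis by (intro exI[of _ 1]) auto
    next
      case False
      \<comment> \<open>Two rationals fit below \<open>L\<close>. The point lies in
        \<open>H v'\<close>, hence by the choice of \<open>N\<close> not in \<open>G u'\<close>, so
        slopes around \<open>x\<close> eventually exceed \<open>u'\<close> and thus
        \<open>u\<close>. Negative \<open>u\<close> were settled by monotonicity.\<close>
      obtain u' where u': "u' \<in> \<rat>" "u < u'" "u' < L" using Rats_dense_in_real[OF \<open>u < L\<close>] by blast
      obtain v' where v': "v' \<in> \<rat>" "u' < v'" "v' < L" using Rats_dense_in_real u' by blast
      obtain w where "x \<in> H w" "v' < w"
        using less_cSupD[of "{v. x \<in> H v}" v'] v'(3) H0 by (auto simp: L_def)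
      then have "x \<in> H v'" using Hanti[of w v'] by auto
      then have "x \<notin> G u'" using x u' v' False by (force simp: N_def)
      then obtain d where d: "d > 0" "\<And>p q. p < x \<Longrightarrow> x < q \<Longrightarrow> q - p < d \<Longrightarrow> u' * (q - p) < F q - F p"
        by (auto simp: G_def not_le)
      have "u * (q - p) \<le> F q - F p" if "p < x" "x < q" "q - p < d" for p q
        using d(2)[OF that] mult_right_mono[of u u' "q - p"] u' that by linarith
      then show ?thesis using d(1) by blast
    qed
    have Fl: "(F \<longlongrightarrow> F x) (at_left x)" and Fr: "(F \<longlongrightarrow> F x) (at_right x)"
      using cont unfolding isCont_def by (auto intro: tendsto_within_subset)
    have key: "\<exists>d>0. \<forall>y. \<bar>y - x\<bar> < d \<longrightarrow> \<bar>F y - F x - L * (y - x)\<bar> \<le> e * \<bar>y - x\<bar>" if e: "e > 0" for e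
    proof -
      obtain d1 where d1: "d1 > 0" "\<And>p q. p < x \<Longrightarrow> x < q \<Longrightarrow> q - p < d1 \<Longrightarrow> F q - F p < (L + e) * (q - p)"
        using up[of "L + e"] e by auto
      obtain d2 where d2: "d2 > 0" "\<And>p q. p < x \<Longrightarrow> x < q \<Longrightarrow> q - p < d2 \<Longrightarrow> (L - e) * (q - p) \<le> F q - F p"
        using lo[of "L - e"] e by auto
      \<comment> \<open>Halving leaves room on both sides: \<open>y\<close> is within
        \<open>d\<close> of \<open>x\<close>, and so is the auxiliary endpoint across
        \<open>x\<close>.\<close>
      define d where "d = min d1 d2 / 2"
      have d: "d > 0" using d1 d2 by (simp add: d_def)
      have str: "\<bar>F q - F p - L * (q - p)\<bar> \<le> e * (q - p)" if "p < x" "x < q" "q - p < 2 * d" for p q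
        using d1(2)[of p q] d2(2)[of p q] that by (auto simp: d_def algebra_simps abs_le_iff)
      have right: "\<bar>F y - F x - L * (y - x)\<bar> \<le> e * (y - x)" if "x < y" "y < x + d" for y
      proof -
        \<comment> \<open>The interval from \<open>p\<close> to \<open>y\<close> straddles
          \<open>x\<close>. Letting \<open>p\<close> tend to \<open>x\<close>, with \<open>F\<close>
          continuous there, gives the one-sided estimate.\<close>
        have "((\<lambda>p. e * (y - p) - \<bar>F y - F p - L * (y - p)\<bar>) \<longlongrightarrow> e * (y - x) - \<bar>F y - F x - L * (y - x)\<bar>) (at_left x)"
          by (intro tendsto_intros Fl)
        moreover have "\<forall>\<^sub>F p in at_left x. 0 \<le> e * (y - p) - \<bar>F y - F p - L * (y - p)\<bar>"
        proof (rule eventually_mono)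
          show "\<forall>\<^sub>F p in at_left x. p \<in> {x - d<..<x}"
            using eventually_at_left_real[of "x - d" x] d by simp
          show "0 \<le> e * (y - p) - \<bar>F y - F p - L * (y - p)\<bar>" if "p \<in> {x - d<..<x}" for p
            using str[of p y] that \<open>x < y\<close> \<open>y < x + d\<close> by auto
        qed
        ultimately have "0 \<le> e * (y - x) - \<bar>F y - F x - L * (y - x)\<bar>"
          by (rule tendsto_lowerbound) simp
        then show ?thesis by simp
      qed
      have left: "\<bar>F x - F y - L * (x - y)\<bar> \<le> e * (x - y)" if "y < x" "x - d < y" for y
      proof -
        have "((\<lambda>q. e * (q - y) - \<bar>F q - F y - L * (q - y)\<bar>) \<longlongrightarrow> e * (x - y) - \<bar>F x - F y - L * (x - y)\<bar>) (at_right x)"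
          by (intro tendsto_intros Fr)
        moreover have "\<forall>\<^sub>F q in at_right x. 0 \<le> e * (q - y) - \<bar>F q - F y - L * (q - y)\<bar>"
        proof (rule eventually_mono)
          show "\<forall>\<^sub>F q in at_right x. q \<in> {x<..<x + d}"
            using eventually_at_right_real[of x "x + d"] d by simp
          show "0 \<le> e * (q - y) - \<bar>F q - F y - L * (q - y)\<bar>" if "q \<in> {x<..<x + d}" for q
            using str[of y q] that \<open>y < x\<close> \<open>x - d < y\<close> by auto
        qed
        ultimately have "0 \<le> e * (x - y) - \<bar>F x - F y - L * (x - y)\<bar>"
          by (rule tendsto_lowerbound) simp
        then show ?thesis by simp
      qed
      have "\<bar>F y - F x - L * (y - x)\<bar> \<le> e * \<bar>y - x\<bar>" if "\<bar>y - x\<bar> < d" for y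
      proof (cases y x rule: linorder_cases)
        case less
        have "F y - F x - L * (y - x) = - (F x - F y - L * (x - y))" by (simp add: algebra_simps)
        then show ?thesis using left[of y] less that by simp
      qed (use right[of y] that in auto)
      then show ?thesis using d by blast
    qed
    have "(F has_derivative (*) L) (at x)"
      unfolding has_derivative_at_alt using key
      by (auto simp: bounded_linear_mult_right)
    then have "(F has_field_derivative L) (at x)" by (simp add: has_field_derivative_def)
    then show ?thesis using real_differentiable_def by blast
  qed
  then have "{x\<in>{a<..<b}. \<not> F differentiable at x} \<subseteq> N" by blast
  then show ?thesis using N negligible_subset by blast
qed

subsection \<open>Absolutely continuous functions\<close>

text \<open>Families indexed by an arbitrary finite set, such as the tagged intervals of a division,
  are renumbered to fit the definition.\<close>

lemma absolutely_continuous_on_unitD: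
  assumes "absolutely_continuous_on_unit f" "e > 0"
  shows "\<exists>\<delta>>0. \<forall>(I :: 'i set) (l :: 'i \<Rightarrow> real) r. finite I \<and> (\<forall>i\<in>I. 0 \<le> l i \<and> l i \<le> r i \<and> r i \<le> 1) \<and>
        disjoint_family_on (\<lambda>i. {l i<..<r i}) I \<and> (\<Sum>i\<in>I. r i - l i) < \<delta> \<longrightarrow>
        (\<Sum>i\<in>I. \<bar>f (r i) - f (l i)\<bar>) < e"
proof -
  obtain \<delta> where \<delta>: "\<delta> > 0" and D: "\<And>(N::nat) l r.
        (\<forall>i<N. 0 \<le> l i \<and> l i \<le> r i \<and> r i \<le> 1) \<and>
        disjoint_family_on (\<lambda>i. {l i<..<r i}) {..<N} \<and>
        (\<Sum>i<N. r i - l i) < \<delta> \<Longrightarrow>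
        (\<Sum>i<N. \<bar>f (r i) - f (l i)\<bar>) < e"
    using assms unfolding absolutely_continuous_on_unit_def by blast
  show ?thesis
  proof (intro exI[of _ \<delta>] conjI allI impI \<delta>)
    fix I :: "'i set" and l r
    assume "finite I \<and> (\<forall>i\<in>I. 0 \<le> l i \<and> l i \<le> r i \<and> r i \<le> 1) \<and>
        disjoint_family_on (\<lambda>i. {l i<..<r i}) I \<and> (\<Sum>i\<in>I. r i - l i) < \<delta>"
    then have I: "finite I" "\<And>i. i \<in> I \<Longrightarrow> 0 \<le> l i \<and> l i \<le> r i \<and> r i \<le> 1"
        "disjoint_family_on (\<lambda>i. {l i<..<r i}) I" "(\<Sum>i\<in>I. r i - l i) < \<delta>" by blast+
    obtain h where "bij_betw h {0..<card I} I" using ex_bij_betw_nat_finite[OF I(1)] by blast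
    then have h: "bij_betw h {..<card I} I" by (simp add: atLeast0LessThan)
    have hI: "h i \<in> I" if "i < card I" for i using h that by (auto simp: bij_betw_def)
    have hinj: "h i \<noteq> h j" if "i < card I" "j < card I" "i \<noteq> j" for i j
      using h that by (auto simp: bij_betw_def inj_on_def)
    have "(\<Sum>i<card I. \<bar>f (r (h i)) - f (l (h i))\<bar>) < e"
    proof (rule D, intro conjI allI impI)
      show "disjoint_family_on (\<lambda>i. {l (h i)<..<r (h i)}) {..<card I}"
        unfolding disjoint_family_on_def
      proof (intro ballI impI)
        fix i j assume "i \<in> {..<card I}" "j \<in> {..<card I}" "i \<noteq> j"
        then show "{l (h i)<..<r (h i)} \<inter> {l (h j)<..<r (h j)} = {}"
          using I(3) hI[of i] hI[of j] hinj[of i j] unfolding disjoint_family_on_def by blast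
      qed
      show "(\<Sum>i<card I. r (h i) - l (h i)) < \<delta>"
        using sum.reindex_bij_betw[OF h, of "\<lambda>i. r i - l i"] I(4) by simp
    qed (use I(2) hI in blast)+
    then show "(\<Sum>i\<in>I. \<bar>f (r i) - f (l i)\<bar>) < e"
      using sum.reindex_bij_betw[OF h, of "\<lambda>i. \<bar>f (r i) - f (l i)\<bar>"] by simp
  qed
qed

text \<open>On a cell shorter than the \<open>\<delta>\<close> belonging to \<open>e = 1\<close>,
  any disjoint family has variation below 1. Clamping the intervals to each of the \<open>M\<close>
  cells therefore bounds the whole variation by \<open>M\<close>.\<close>

lemma absolutely_continuous_on_unit_bounded_variation:
  assumes f: "absolutely_continuous_on_unit f"
  shows "\<exists>B. \<forall>(N::nat) (l :: nat \<Rightarrow> real) (r :: nat \<Rightarrow> real). (\<forall>i<N. 0 \<le> l i \<and> l i \<le> r i \<and> r i \<le> 1) \<and>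
     disjoint_family_on (\<lambda>i. {l i<..<r i}) {..<N} \<longrightarrow> (\<Sum>i<N. \<bar>f (r i) - f (l i)\<bar>) \<le> B"
proof -
  obtain \<delta> where \<delta>: "\<delta> > 0" and D: "\<And>(I :: nat set) l r. finite I \<and> (\<forall>i\<in>I. 0 \<le> l i \<and> l i \<le> r i \<and> r i \<le> 1) \<and>
        disjoint_family_on (\<lambda>i. {l i<..<r i}) I \<and> (\<Sum>i\<in>I. r i - l i) < \<delta> \<Longrightarrow>
        (\<Sum>i\<in>I. \<bar>f (r i) - f (l i)\<bar>) < 1"
    using absolutely_continuous_on_unitD[OF f zero_less_one] by blast
  obtain m where m: "1 / real (Suc m) < \<delta>" using nat_approx_posE[OF \<delta>] by blast
  define M where "M = Suc m"
  have M: "1 / real M < \<delta>" "M > 0" using m by (auto simp: M_def)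
  show ?thesis
  proof (intro exI[of _ "real M"] allI impI)
    fix N :: nat and l r :: "nat \<Rightarrow> real"
    assume "(\<forall>i<N. 0 \<le> l i \<and> l i \<le> r i \<and> r i \<le> 1) \<and> disjoint_family_on (\<lambda>i. {l i<..<r i}) {..<N}"
    then have lr: "\<And>i. i < N \<Longrightarrow> 0 \<le> l i \<and> l i \<le> r i \<and> r i \<le> 1"
      and disj: "disjoint_family_on (\<lambda>i. {l i<..<r i}) {..<N}" by blast+
    define t where "t c = real c / real M" for c
    have t: "t c \<le> t (Suc c)" "0 \<le> t c" "t 0 = 0" "t M = 1" for c
      using M(2) by (auto simp: t_def divide_right_mono)
    define cl where "cl c x = max (t c) (min x (t (Suc c)))" for c x
    \<comment> \<open>Clamped increments are rewritten with \<open>min\<close>, because in this form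
      the sum over the cells telescopes.\<close>
    have cl: "f (cl c x) - f (t c) = f (min x (t (Suc c))) - f (min x (t c))" if "0 \<le> x" "x \<le> 1" for c x
    proof (cases "t c \<le> x")
      case True
      then show ?thesis using t(1)[of c] by (auto simp: cl_def max_def min_def)
    next
      case False
      then have "cl c x = t c" "min x (t (Suc c)) = x" "min x (t c) = x" using t(1)[of c] by (auto simp: cl_def max_def min_def)
      then show ?thesis by simp
    qed
    have tel: "(\<Sum>c<M. f (cl c x) - f (t c)) = f x - f 0" if "0 \<le> x" "x \<le> 1" for x
    proof -
      have "(\<Sum>c<M. f (cl c x) - f (t c)) = (\<Sum>c<M. f (min x (t (Suc c))) - f (min x (t c)))"
        using cl[OF that] by simp
      also have "\<dots> = f (min x (t M)) - f (min x (t 0))" by (rule sum_lessThan_telescope)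
      also have "\<dots> = f x - f 0" using that t by simp
      finally show ?thesis .
    qed
    have split: "\<bar>f (r i) - f (l i)\<bar> \<le> (\<Sum>c<M. \<bar>f (cl c (r i)) - f (cl c (l i))\<bar>)" if "i < N" for i
    proof -
      have "f (r i) - f (l i) = (\<Sum>c<M. f (cl c (r i)) - f (cl c (l i)))"
        using tel[of "r i"] tel[of "l i"] lr[OF that] by (simp add: sum_subtractf)
      then show ?thesis by (metis sum_abs)
    qed
    have cell: "(\<Sum>i<N. \<bar>f (cl c (r i)) - f (cl c (l i))\<bar>) < 1" if c: "c < M" for c
    proof (rule D, intro conjI ballI)
      have t1: "t (Suc c) \<le> 1" using c by (simp add: t_def)
      have mono: "0 \<le> cl c (l i) \<and> cl c (l i) \<le> cl c (r i) \<and> cl c (r i) \<le> 1" if "i \<in> {..<N}" for i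
        using lr[of i] that t(1,2)[of c] t1 by (auto simp: cl_def max_def min_def)
      then show "0 \<le> cl c (l i)" "cl c (l i) \<le> cl c (r i)" "cl c (r i) \<le> 1" if "i \<in> {..<N}" for i
        using that by blast+
      have sub: "{cl c (l i)<..<cl c (r i)} \<subseteq> {l i<..<r i} \<inter> {t c..t (Suc c)}" for i
        using t(1)[of c] by (auto simp: cl_def less_max_iff_disj min_less_iff_disj)
      then show dj: "disjoint_family_on (\<lambda>i. {cl c (l i)<..<cl c (r i)}) {..<N}"
        using disj unfolding disjoint_family_on_def by blast
      have "(\<Sum>i<N. cl c (r i) - cl c (l i)) \<le> measure lebesgue {t c..t (Suc c)}"
        using mono sub by (intro sum_disjoint_intervals_le dj) auto
      also have "\<dots> = t (Suc c) - t c" using t(1)[of c] by simp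
      also have "\<dots> < \<delta>" using M by (simp add: t_def diff_divide_distrib[symmetric])
      finally show "(\<Sum>i<N. cl c (r i) - cl c (l i)) < \<delta>" .
    qed simp
    have "(\<Sum>i<N. \<bar>f (r i) - f (l i)\<bar>) \<le> (\<Sum>i<N. \<Sum>c<M. \<bar>f (cl c (r i)) - f (cl c (l i))\<bar>)"
      using split by (intro sum_mono) auto
    also have "\<dots> = (\<Sum>c<M. \<Sum>i<N. \<bar>f (cl c (r i)) - f (cl c (l i))\<bar>)" by (rule sum.swap)
    also have "\<dots> \<le> (\<Sum>c<M. 1)" using cell by (intro sum_mono less_imp_le) auto
    finally show "(\<Sum>i<N. \<bar>f (r i) - f (l i)\<bar>) \<le> real M" by simp
  qed
qed

text \<open>With \<open>V\<close> the variation function, \<open>V\<close> and \<open>V - f\<close> are monotone.\<close>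

lemma absolutely_continuous_on_unit_differentiable_AE:
  assumes f: "absolutely_continuous_on_unit f"
  shows "negligible {x\<in>{0<..<1}. \<not> f differentiable at x}"
proof -
  obtain B where B: "\<And>(N::nat) (l :: nat \<Rightarrow> real) (r :: nat \<Rightarrow> real). (\<forall>i<N. 0 \<le> l i \<and> l i \<le> r i \<and> r i \<le> 1) \<and>
     disjoint_family_on (\<lambda>i. {l i<..<r i}) {..<N} \<Longrightarrow> (\<Sum>i<N. \<bar>f (r i) - f (l i)\<bar>) \<le> B"
    using absolutely_continuous_on_unit_bounded_variation[OF f] by blast
  \<comment> \<open>Variation is measured by disjoint intervals instead of partitions: appending the
    interval from \<open>x\<close> to \<open>y\<close> to a family for \<open>x\<close> gives a
    family for \<open>y\<close>, which yields \<open>incr\<close> at once.\<close>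
  define VS where "VS x = {(\<Sum>i<N. \<bar>f (r i) - f (l i)\<bar>) | (N::nat) l r.
     (\<forall>i<N. 0 \<le> l i \<and> l i \<le> r i \<and> r i \<le> x) \<and> disjoint_family_on (\<lambda>i. {l i<..<r i}) {..<N}}" for x
  define V where "V x = Sup (VS x)" for x
  have ne: "VS x \<noteq> {}" for x
    by (auto simp: VS_def disjoint_family_on_def intro!: exI[of _ "0::nat"])
  have bdd: "bdd_above (VS x)" if "x \<le> 1" for x
  proof (rule bdd_aboveI)
    fix s assume "s \<in> VS x"
    then obtain N :: nat and l r :: "nat \<Rightarrow> real" where s: "s = (\<Sum>i<N. \<bar>f (r i) - f (l i)\<bar>)"
      "\<And>i. i < N \<Longrightarrow> 0 \<le> l i \<and> l i \<le> r i \<and> r i \<le> x" "disjoint_family_on (\<lambda>i. {l i<..<r i}) {..<N}"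
      by (auto simp: VS_def)
    show "s \<le> B" unfolding s(1) using s(2) that by (intro B conjI s(3)) force
  qed
  have incr: "V x + \<bar>f y - f x\<bar> \<le> V y" if xy: "0 \<le> x" "x \<le> y" "y \<le> 1" for x y
  proof -
    have "s + \<bar>f y - f x\<bar> \<in> VS y" if "s \<in> VS x" for s
    proof -
      obtain N :: nat and l r :: "nat \<Rightarrow> real" where s: "s = (\<Sum>i<N. \<bar>f (r i) - f (l i)\<bar>)"
        "\<And>i. i < N \<Longrightarrow> 0 \<le> l i \<and> l i \<le> r i \<and> r i \<le> x" "disjoint_family_on (\<lambda>i. {l i<..<r i}) {..<N}"
        using \<open>s \<in> VS x\<close> by (auto simp: VS_def)
      define l' r' where "l' = l(N := x)" and "r' = r(N := y)"
      have "s + \<bar>f y - f x\<bar> = (\<Sum>i<Suc N. \<bar>f (r' i) - f (l' i)\<bar>)"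
        by (simp add: s l'_def r'_def)
      moreover have "\<forall>i<Suc N. 0 \<le> l' i \<and> l' i \<le> r' i \<and> r' i \<le> y"
        using s(2) xy by (force simp: l'_def r'_def less_Suc_eq)
      moreover have "disjoint_family_on (\<lambda>i. {l' i<..<r' i}) {..<Suc N}"
        unfolding disjoint_family_on_def
      proof (intro ballI impI)
        fix i j assume ij: "i \<in> {..<Suc N}" "j \<in> {..<Suc N}" "i \<noteq> j"
        have "{l i<..<r i} \<inter> {l j<..<r j} = {}" if "i < N" "j < N"
          using s(3) that ij(3) unfolding disjoint_family_on_def by blast
        then show "{l' i<..<r' i} \<inter> {l' j<..<r' j} = {}"
          using ij s(2)[of i] s(2)[of j] by (auto simp: l'_def r'_def less_Suc_eq split: if_splits)
      qed
      ultimately show ?thesis unfolding VS_def by blast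
    qed
    then have "s \<le> V y - \<bar>f y - f x\<bar>" if "s \<in> VS x" for s
      using cSup_upper[OF _ bdd[OF xy(3)], of "s + \<bar>f y - f x\<bar>"] that by (auto simp: V_def)
    then have "V x \<le> V y - \<bar>f y - f x\<bar>" unfolding V_def by (intro cSup_least[OF ne]) auto
    then show ?thesis by simp
  qed
  \<comment> \<open>Clamping to [0,1] extends the two monotone functions to the whole line, where
    the differentiability theorem is stated.\<close>
  define c where "c t = max 0 (min t (1::real))" for t
  have c: "0 \<le> c t" "c t \<le> 1" "s \<le> t \<Longrightarrow> c s \<le> c t" for s t by (auto simp: c_def)
  have F1: "mono (\<lambda>t. V (c t))"
  proof (rule monoI)
    fix s t :: real assume "s \<le> t"
    then show "V (c s) \<le> V (c t)"
      using incr[of "c s" "c t"] c[of s] c[of t] c(3)[of s t] by auto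
  qed
  have F2: "mono (\<lambda>t. V (c t) - f (c t))"
  proof (rule monoI)
    fix s t :: real assume "s \<le> t"
    then show "V (c s) - f (c s) \<le> V (c t) - f (c t)"
      using incr[of "c s" "c t"] c[of s] c[of t] c(3)[of s t] by auto
  qed
  have "f differentiable at x" if x: "x \<in> {0<..<1}" "(\<lambda>t. V (c t)) differentiable at x" "(\<lambda>t. V (c t) - f (c t)) differentiable at x" for x
  proof -
    have "(\<lambda>t. V (c t) - (V (c t) - f (c t))) differentiable at x"
      by (intro differentiable_diff x)
    then show ?thesis
      by (rule differentiable_transform_within[where d="min x (1 - x)"])
        (use x in \<open>auto simp: c_def dist_real_def\<close>)
  qed
  then have "{x\<in>{0<..<1}. \<not> f differentiable at x} \<subseteq>
     {x\<in>{0<..<1}. \<not> (\<lambda>t. V (c t)) differentiable at x} \<union> {x\<in>{0<..<1}. \<not> (\<lambda>t. V (c t) - f (c t)) differentiable at x}"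
    by blast
  moreover have "negligible ({x\<in>{0<..<1}. \<not> (\<lambda>t. V (c t)) differentiable at x} \<union> {x\<in>{0<..<1}. \<not> (\<lambda>t. V (c t) - f (c t)) differentiable at x})"
    by (intro negligible_Un mono_differentiable_AE F1 F2)
  ultimately show ?thesis by (rule negligible_subset[rotated])
qed

text \<open>The tags at points of non-differentiability are confined to a small open set, where absolute
  continuity bounds the increments.\<close>

lemma absolutely_continuous_on_unit_has_integral:
  assumes f: "absolutely_continuous_on_unit f" and ab: "0 \<le> a" "a \<le> b" "b \<le> 1"
  shows "((\<lambda>x. if x \<in> {0<..<1} \<and> f differentiable at x then deriv f x else 0) has_integral f b - f a) {a..b}"
    (is "(?g has_integral _) _")
  unfolding has_integral_real
proof (intro allI impI)
  fix e :: real assume e: "e > 0"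
  define G where "G = {x\<in>{0<..<1}. f differentiable at x}"
  define N where "N = {0..1} - G"
  have "negligible ({x\<in>{0<..<1}. \<not> f differentiable at x} \<union> {0,1})"
    by (intro negligible_Un absolutely_continuous_on_unit_differentiable_AE[OF f]) auto
  then have negN: "negligible N"
    by (rule negligible_subset) (auto simp: N_def G_def)
  obtain \<delta> where \<delta>: "\<delta> > 0" and D: "\<And>(I :: (real \<times> real set) set) l r. finite I \<and> (\<forall>i\<in>I. 0 \<le> l i \<and> l i \<le> r i \<and> r i \<le> 1) \<and>
        disjoint_family_on (\<lambda>i. {l i<..<r i}) I \<and> (\<Sum>i\<in>I. r i - l i) < \<delta> \<Longrightarrow>
        (\<Sum>i\<in>I. \<bar>f (r i) - f (l i)\<bar>) < e/2"
    using absolutely_continuous_on_unitD[OF f half_gt_zero[OF e]] by blast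
  obtain U where U: "open U" "N \<subseteq> U" "U \<in> lmeasurable" "measure lebesgue U < measure lebesgue N + \<delta>"
    using lmeasurable_outer_open[OF negligible_imp_measurable[OF negN] \<delta>] by blast
  have U\<delta>: "measure lebesgue U < \<delta>" using U(4) negligible_imp_measure0[OF negN] by simp
  \<comment> \<open>The errors at good tags sum to at most \<open>e' * (b - a)\<close>; the 1 in the
    denominator covers \<open>a = b\<close>.\<close>
  define e' where "e' = e / (2 * (b - a + 1))"
  have e': "e' > 0" "e' * (b - a) \<le> e / 2"
    using e ab by (auto simp: e'_def divide_simps mult_left_mono)
  have "\<exists>d>0. \<forall>y. \<bar>y - x\<bar> < d \<longrightarrow> \<bar>f y - f x - ?g x * (y - x)\<bar> \<le> e' * \<bar>y - x\<bar>" if "x \<in> G" for x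
  proof -
    have "(f has_field_derivative deriv f x) (at x)"
      using that by (simp add: G_def DERIV_deriv_iff_real_differentiable)
    then have "(f has_derivative (*) (deriv f x)) (at x)" by (simp add: has_field_derivative_def)
    then show ?thesis using e'(1) that unfolding has_derivative_at_alt G_def by auto
  qed
  then obtain d where d: "\<And>x. x \<in> G \<Longrightarrow> d x > 0"
     "\<And>x y. x \<in> G \<Longrightarrow> \<bar>y - x\<bar> < d x \<Longrightarrow> \<bar>f y - f x - ?g x * (y - x)\<bar> \<le> e' * \<bar>y - x\<bar>"
    by metis
  \<comment> \<open>At a good tag the gauge enforces the linear approximation of \<open>f\<close>;
    at an exceptional tag in [0,1] it forces the interval into the small open set
    \<open>U\<close>.\<close>
  define \<gamma> where "\<gamma> x = (if x \<in> G then ball x (d x) else if x \<in> N then U else UNIV)" for x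
  have "gauge \<gamma>" unfolding gauge_def \<gamma>_def using U d by auto
  moreover have "norm ((\<Sum>(x, k)\<in>\<D>. measure lborel k *\<^sub>R ?g x) - (f b - f a)) < e"
    if T: "\<D> tagged_division_of {a..b}" and fine: "\<gamma> fine \<D>" for \<D>
  proof -
    have fin: "finite \<D>" using T by auto
    have shape: "\<exists>p q. k = {p..q} \<and> p \<le> x \<and> x \<le> q \<and> a \<le> p \<and> q \<le> b" if xk: "(x, k) \<in> \<D>" for x k
    proof -
      obtain p q where k: "k = {p..q}" using tagged_division_ofD(4)[OF T xk] by auto
      have "x \<in> k" "k \<subseteq> {a..b}" using tagged_division_ofD(2,3)[OF T xk] by auto
      then show ?thesis using k by auto
    qed
    define \<D>1 where "\<D>1 = {i\<in>\<D>. fst i \<in> G}"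
    define \<D>2 where "\<D>2 = {i\<in>\<D>. fst i \<notin> G}"
    have fin12: "finite \<D>1" "finite \<D>2" and un: "\<D> = \<D>1 \<union> \<D>2" "\<D>1 \<inter> \<D>2 = {}"
      using fin by (auto simp: \<D>1_def \<D>2_def)
    define h where "h i = measure lborel (snd i) * ?g (fst i) - (f (Sup (snd i)) - f (Inf (snd i)))" for i
    have "(\<Sum>(x, k)\<in>\<D>. measure lborel k *\<^sub>R ?g x) - (f b - f a) = (\<Sum>i\<in>\<D>. h i)"
      using additive_tagged_division_1[OF ab(2) T, of f]
      by (simp add: h_def sum_subtractf case_prod_unfold)
    also have "\<bar>\<dots>\<bar> \<le> (\<Sum>i\<in>\<D>. \<bar>h i\<bar>)" by (rule sum_abs)
    also have "\<dots> = (\<Sum>i\<in>\<D>1. \<bar>h i\<bar>) + (\<Sum>i\<in>\<D>2. \<bar>h i\<bar>)"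
      unfolding un(1) using fin12 un(2) by (rule sum.union_disjoint)
    also have "(\<Sum>i\<in>\<D>1. \<bar>h i\<bar>) \<le> e / 2"
    proof -
      have "(\<Sum>i\<in>\<D>1. \<bar>h i\<bar>) \<le> (\<Sum>i\<in>\<D>1. e' * measure lborel (snd i))"
      proof (rule sum_mono)
        fix i assume i: "i \<in> \<D>1"
        obtain x k where ik: "i = (x, k)" by (cases i)
        with i have xk: "(x, k) \<in> \<D>" "x \<in> G" by (auto simp: \<D>1_def)
        obtain p q where pq: "k = {p..q}" "p \<le> x" "x \<le> q" using shape[OF xk(1)] by blast
        have "k \<subseteq> \<gamma> x" using fine xk(1) by (auto simp: fine_def)
        then have "k \<subseteq> ball x (d x)" using xk(2) by (simp add: \<gamma>_def)
        moreover have "p \<in> k" "q \<in> k" using pq by auto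
        ultimately have "\<bar>p - x\<bar> < d x" "\<bar>q - x\<bar> < d x" by (auto simp: dist_real_def)
        then have "\<bar>f p - f x - ?g x * (p - x)\<bar> \<le> e' * (x - p)" "\<bar>f q - f x - ?g x * (q - x)\<bar> \<le> e' * (q - x)"
          using d(2)[OF xk(2), of p] d(2)[OF xk(2), of q] pq by auto
        \<comment> \<open>The tag lies between \<open>p\<close> and \<open>q\<close>, so the errors
          \<open>e' * (x - p)\<close> and \<open>e' * (q - x)\<close> add up to
          \<open>e' * (q - p)\<close>.\<close>
        then have "\<bar>(q - p) * ?g x - (f q - f p)\<bar> \<le> e' * (q - p)"
          unfolding abs_le_iff by (simp only: right_diff_distrib left_diff_distrib mult.commute[of _ "?g x"]) linarith
        moreover have "measure lborel k = q - p" "Sup k = q" "Inf k = p" using pq by auto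
        ultimately show "\<bar>h i\<bar> \<le> e' * measure lborel (snd i)"
          unfolding h_def ik fst_conv snd_conv by (simp only:)
      qed
      also have "\<dots> \<le> (\<Sum>i\<in>\<D>. e' * measure lborel (snd i))"
        using e' fin by (intro sum_mono2) (auto simp: \<D>1_def)
      also have "\<dots> = e' * (\<Sum>(x,k)\<in>\<D>. measure lborel k)" by (simp add: sum_distrib_left case_prod_unfold)
      also have "(\<Sum>(x,k)\<in>\<D>. measure lborel k) = b - a"
        using additive_content_tagged_division[of \<D> a b] T ab by simp
      finally show ?thesis using e'(2) by simp
    qed
    also have "(\<Sum>i\<in>\<D>2. \<bar>h i\<bar>) < e / 2"
    proof -
      define l r where "l i = Inf (snd i)" and "r i = Sup (snd i)" for i :: "real \<times> real set"
      have s2: "snd i = {l i..r i} \<and> 0 \<le> l i \<and> l i \<le> r i \<and> r i \<le> 1 \<and> snd i \<subseteq> U" if i: "i \<in> \<D>2" for i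
      proof -
        obtain x k where ik: "i = (x, k)" by (cases i)
        with i have xk: "(x, k) \<in> \<D>" "x \<notin> G" by (auto simp: \<D>2_def)
        obtain p q where pq: "k = {p..q}" "p \<le> x" "x \<le> q" "a \<le> p" "q \<le> b" using shape[OF xk(1)] by blast
        then have "x \<in> N" using ab xk by (auto simp: N_def)
        moreover have "k \<subseteq> \<gamma> x" using fine xk(1) by (auto simp: fine_def)
        ultimately have "k \<subseteq> U" using xk(2) by (simp add: \<gamma>_def)
        then show ?thesis using pq ab by (auto simp: l_def r_def ik)
      qed
      have dj: "disjoint_family_on (\<lambda>i. {l i<..<r i}) \<D>2"
        unfolding disjoint_family_on_def
      proof (intro ballI impI)
        fix i j assume ij: "i \<in> \<D>2" "j \<in> \<D>2" "i \<noteq> j"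
        then have "interior (snd i) \<inter> interior (snd j) = {}"
          using tagged_division_ofD(5)[OF T, of "fst i" "snd i" "fst j" "snd j"] by (auto simp: \<D>2_def)
        then show "{l i<..<r i} \<inter> {l j<..<r j} = {}" using s2[OF ij(1)] s2[OF ij(2)] by (metis interior_atLeastAtMost_real)
      qed
      have "(\<Sum>i\<in>\<D>2. r i - l i) \<le> measure lebesgue U"
      proof (rule sum_disjoint_intervals_le[OF fin12(2) _ dj _ U(3)])
        show "(\<Union>i\<in>\<D>2. {l i<..<r i}) \<subseteq> U"
        proof (rule UN_least)
          fix i assume "i \<in> \<D>2"
          from s2[OF this] have "{l i..r i} \<subseteq> U" by metis
          moreover have "{l i<..<r i} \<subseteq> {l i..r i}" by auto
          ultimately show "{l i<..<r i} \<subseteq> U" by blast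
        qed
      qed (use s2 in blast)
      then have "(\<Sum>i\<in>\<D>2. \<bar>f (r i) - f (l i)\<bar>) < e / 2"
        using U\<delta> s2 fin12(2) dj by (intro D) auto
      moreover have "(\<Sum>i\<in>\<D>2. \<bar>h i\<bar>) = (\<Sum>i\<in>\<D>2. \<bar>f (r i) - f (l i)\<bar>)"
      proof (rule sum.cong)
        fix i assume "i \<in> \<D>2"
        then have "?g (fst i) = 0" by (auto simp: \<D>2_def G_def)
        then show "\<bar>h i\<bar> = \<bar>f (r i) - f (l i)\<bar>" by (simp add: h_def l_def r_def abs_minus_commute)
      qed simp
      ultimately show ?thesis by simp
    qed
    finally show ?thesis by simp
  qed
  ultimately show "\<exists>\<gamma>. gauge \<gamma> \<and> (\<forall>\<D>. \<D> tagged_division_of {a..b} \<and> \<gamma> fine \<D> \<longrightarrow>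
      norm ((\<Sum>(x, k)\<in>\<D>. measure lborel k *\<^sub>R ?g x) - (f b - f a)) < e)"
    by (intro exI[of _ \<gamma>] conjI allI impI) (assumption, elim conjE, assumption)
qed

subsection \<open>The rate function\<close>

lemma apply_cadlag_diff: "apply_cadlag (f - g) t = apply_cadlag f t - apply_cadlag g t"
  unfolding minus_cadlag_def plus_cadlag.rep_eq scaleR_cadlag.rep_eq by simp

lemma mdp_rate_leD:
  assumes I: "mdp_rate z \<le> ereal \<alpha>"
  shows "apply_cadlag z 0 = 0" "absolutely_continuous_on_unit (apply_cadlag z)"
    "(\<integral>\<^sup>+u\<in>{0..1}. ennreal ((deriv (apply_cadlag z) u)\<^sup>2) \<partial>lebesgue) \<le> ennreal (2 * \<alpha>)" "0 \<le> \<alpha>"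
proof -
  define E where "E = (\<integral>\<^sup>+u\<in>{0..1}. ennreal ((deriv (apply_cadlag z) u)\<^sup>2) \<partial>lebesgue)"
  show 1: "apply_cadlag z 0 = 0" "absolutely_continuous_on_unit (apply_cadlag z)"
    using I by (auto simp: mdp_rate_def split: if_splits)
  then have le: "ereal (1/2) * enn2ereal E \<le> ereal \<alpha>"
    using I by (simp add: mdp_rate_def E_def)
  show "0 \<le> \<alpha>"
  proof -
    have "0 \<le> ereal (1/2) * enn2ereal E" by (intro ereal_0_le_mult) auto
    then have "0 \<le> ereal \<alpha>" using le order_trans by blast
    then show ?thesis by simp
  qed
  show "E \<le> ennreal (2 * \<alpha>)"
  proof (cases E)
    case (real r)
    then show ?thesis using le by (auto intro!: ennreal_leI)
  next
    case top
    then show ?thesis using le by simp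
  qed
qed

lemma mdp_rate_leI:
  assumes "apply_cadlag z 0 = 0" "absolutely_continuous_on_unit (apply_cadlag z)"
    "(\<integral>\<^sup>+u\<in>{0..1}. ennreal ((deriv (apply_cadlag z) u)\<^sup>2) \<partial>lebesgue) \<le> ennreal (2 * \<alpha>)" "0 \<le> \<alpha>"
  shows "mdp_rate z \<le> ereal \<alpha>"
proof -
  define E where "E = (\<integral>\<^sup>+u\<in>{0..1}. ennreal ((deriv (apply_cadlag z) u)\<^sup>2) \<partial>lebesgue)"
  have le: "E \<le> ennreal (2 * \<alpha>)" using assms by (simp add: E_def)
  obtain r where r: "E = ennreal r" "r \<ge> 0" using le by (cases E) (auto simp: top_unique)
  then have "r \<le> 2 * \<alpha>" using le assms(4) by simp
  then have "ereal (1/2) * enn2ereal E \<le> ereal \<alpha>" using r by simp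
  then show ?thesis using assms(1,2) by (simp add: mdp_rate_def E_def)
qed

text \<open>On each interval the squared increment over the length is at most the integral of the
  squared derivative, by Cauchy-Schwarz; disjointness allows these integrals to be summed.\<close>

lemma absolutely_continuous_on_unit_energy:
  fixes f :: "real \<Rightarrow> real" and l r :: "'i \<Rightarrow> real"
  assumes f: "absolutely_continuous_on_unit f"
    and E: "(\<integral>\<^sup>+u\<in>{0..1}. ennreal ((deriv f u)\<^sup>2) \<partial>lebesgue) \<le> ennreal K" and K: "0 \<le> K"
    and I: "finite I" "\<And>i. i \<in> I \<Longrightarrow> 0 \<le> l i \<and> l i < r i \<and> r i \<le> 1"
    and disj: "disjoint_family_on (\<lambda>i. {l i<..<r i}) I"
  shows "(\<Sum>i\<in>I. (f (r i) - f (l i))\<^sup>2 / (r i - l i)) \<le> K"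
proof -
  \<comment> \<open>This truncated derivative is measurable because it is the integrand of the
    fundamental theorem; measurability of \<open>deriv f\<close> itself is not at hand.\<close>
  define g where "g x = (if x \<in> {0<..<1} \<and> f differentiable at x then deriv f x else 0)" for x
  have gi: "(g has_integral f b - f a) {a..b}" if "0 \<le> a" "a \<le> b" "b \<le> 1" for a b
    using absolutely_continuous_on_unit_has_integral[OF f that] unfolding g_def .
  have "(\<lambda>x. g x * indicator {0..1} x) \<in> lebesgue \<rightarrow>\<^sub>M borel"
    by (rule has_integral_implies_lebesgue_measurable_real[OF gi]) auto
  also have "(\<lambda>x. g x * indicator {0..1} x) = g" by (auto simp: g_def indicator_def)
  finally have gm[measurable]: "g \<in> lebesgue \<rightarrow>\<^sub>M borel" .
  have nn: "(\<integral>\<^sup>+x. ennreal ((g x)\<^sup>2) \<partial>lebesgue) \<le> ennreal K"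
  proof -
    have "(\<integral>\<^sup>+x. ennreal ((g x)\<^sup>2) \<partial>lebesgue) \<le> (\<integral>\<^sup>+u\<in>{0..1}. ennreal ((deriv f u)\<^sup>2) \<partial>lebesgue)"
      by (intro nn_integral_mono) (auto simp: g_def indicator_def)
    then show ?thesis using E order_trans by blast
  qed
  have gint: "integrable lebesgue (\<lambda>x. (g x)\<^sup>2)"
    using nn by (intro integrableI_bounded) (auto simp: less_top[symmetric] top_unique intro: le_less_trans)
  have gK: "(LINT x|lebesgue. (g x)\<^sup>2) \<le> K"
  proof -
    have "ennreal (LINT x|lebesgue. (g x)\<^sup>2) = (\<integral>\<^sup>+x. ennreal ((g x)\<^sup>2) \<partial>lebesgue)"
      using gint by (intro nn_integral_eq_integral[symmetric]) auto
    then have "ennreal (LINT x|lebesgue. (g x)\<^sup>2) \<le> ennreal K" using nn by simp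
    then show ?thesis using K by (simp add: ennreal_le_iff)
  qed
  have sint: "set_integrable lebesgue {a..b} (\<lambda>x. (g x)\<^sup>2)" for a b
    unfolding set_integrable_def using gint by (intro integrable_mult_indicator) auto
  have cs: "(f b - f a)\<^sup>2 / (b - a) \<le> (LINT x:{a..b}|lebesgue. (g x)\<^sup>2)" if ab: "0 \<le> a" "a < b" "b \<le> 1" for a b
  proof -
    \<comment> \<open>Cauchy-Schwarz in linear form: integrate
      \<open>2 * c * g x - c\<^sup>2 \<le> (g x)\<^sup>2\<close> with \<open>c\<close> the mean
      slope, which is optimal.\<close>
    define c where "c = (f b - f a) / (b - a)"
    have i1: "((\<lambda>x. (g x)\<^sup>2) has_integral (LINT x:{a..b}|lebesgue. (g x)\<^sup>2)) {a..b}"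
      by (rule has_integral_set_lebesgue[OF sint])
    have i2: "((\<lambda>x. 2 * c * g x - c\<^sup>2) has_integral (2 * c * (f b - f a) - (b - a) * c\<^sup>2)) {a..b}"
      using ab has_integral_const_real[of "c\<^sup>2" a b] by (intro has_integral_diff has_integral_mult_right gi) auto
    have "2 * c * (f b - f a) - (b - a) * c\<^sup>2 \<le> (LINT x:{a..b}|lebesgue. (g x)\<^sup>2)"
    proof (rule has_integral_le[OF i2 i1])
      show "2 * c * g x - c\<^sup>2 \<le> (g x)\<^sup>2" for x
        using zero_le_power2[of "g x - c"] by (simp add: power2_diff algebra_simps)
    qed
    moreover have slope: "2 * (u / d) * u - d * (u / d)\<^sup>2 = u\<^sup>2 / d" if "d > 0" for u d :: real
      using that by (simp add: power2_eq_square field_simps)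
    have "2 * c * (f b - f a) - (b - a) * c\<^sup>2 = (f b - f a)\<^sup>2 / (b - a)"
      unfolding c_def using ab by (intro slope) simp
    ultimately show ?thesis by simp
  qed
  have "(\<Sum>i\<in>I. (f (r i) - f (l i))\<^sup>2 / (r i - l i)) \<le> (\<Sum>i\<in>I. LINT x:{l i..r i}|lebesgue. (g x)\<^sup>2)"
    using I(2) by (intro sum_mono cs) auto
  also have "\<dots> = (LINT x|lebesgue. (\<Sum>i\<in>I. indicator {l i..r i} x *\<^sub>R (g x)\<^sup>2))"
    unfolding set_lebesgue_integral_def using sint
    by (intro Bochner_Integration.integral_sum[symmetric]) (auto simp: set_integrable_def)
  also have "\<dots> \<le> (LINT x|lebesgue. (g x)\<^sup>2)"
  proof (rule integral_mono_AE)
    show "integrable lebesgue (\<lambda>x. \<Sum>i\<in>I. indicator {l i..r i} x *\<^sub>R (g x)\<^sup>2)"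
      using sint by (intro Bochner_Integration.integrable_sum) (auto simp: set_integrable_def)
    \<comment> \<open>Only the open intervals are disjoint, while the integrals run over closed
      ones; common endpoints form a finite null set.\<close>
    have "(\<Union>i\<in>I. {l i, r i}) \<in> null_sets lebesgue"
      using I(1) by (simp add: negligible_iff_null_sets[symmetric] negligible_finite)
    then have "AE x in lebesgue. x \<notin> (\<Union>i\<in>I. {l i, r i})" by (rule AE_not_in)
    then show "AE x in lebesgue. (\<Sum>i\<in>I. indicator {l i..r i} x *\<^sub>R (g x)\<^sup>2) \<le> (g x)\<^sup>2"
    proof (eventually_elim)
      fix x assume x: "x \<notin> (\<Union>i\<in>I. {l i, r i})"
      have "(\<Sum>i\<in>I. indicator {l i..r i} x *\<^sub>R (g x)\<^sup>2) = (\<Sum>i\<in>I. indicator {l i<..<r i} x) * (g x)\<^sup>2"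
        unfolding sum_distrib_right using x by (intro sum.cong) (auto simp: indicator_def)
      also have "(\<Sum>i\<in>I. indicator {l i<..<r i} x) = (indicator (\<Union>i\<in>I. {l i<..<r i}) x :: real)"
        using disj I(1) by (rule indicator_UN_disjoint[symmetric, rotated])
      also have "\<dots> * (g x)\<^sup>2 \<le> (g x)\<^sup>2" by (auto simp: indicator_def)
      finally show "(\<Sum>i\<in>I. indicator {l i..r i} x *\<^sub>R (g x)\<^sup>2) \<le> (g x)\<^sup>2" .
    qed
  qed (rule gint)
  also have "\<dots> \<le> K" by (rule gK)
  finally show ?thesis .
qed

lemma mdp_rate_energy:
  fixes l r :: "'i \<Rightarrow> real"
  assumes "mdp_rate z \<le> ereal \<alpha>"
    and "finite I" "\<And>i. i \<in> I \<Longrightarrow> 0 \<le> l i \<and> l i < r i \<and> r i \<le> 1"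
    and "disjoint_family_on (\<lambda>i. {l i<..<r i}) I"
  shows "(\<Sum>i\<in>I. (apply_cadlag z (r i) - apply_cadlag z (l i))\<^sup>2 / (r i - l i)) \<le> 2 * \<alpha>"
  using mdp_rate_leD[OF assms(1)] by (intro absolutely_continuous_on_unit_energy assms) auto

text \<open>The energy bound for a single interval. It supplies equicontinuity on level sets and the
  modulus of continuity used in the lower bound.\<close>

lemma mdp_rate_Hoelder:
  assumes "mdp_rate z \<le> ereal \<alpha>" "s \<in> {0..1}" "t \<in> {0..1}"
  shows "\<bar>apply_cadlag z s - apply_cadlag z t\<bar> \<le> sqrt (2 * \<alpha> * \<bar>s - t\<bar>)"
proof -
  have *: "\<bar>apply_cadlag z t - apply_cadlag z s\<bar> \<le> sqrt (2 * \<alpha> * \<bar>t - s\<bar>)" if "0 \<le> s" "s < t" "t \<le> 1" for s t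
  proof -
    have "(apply_cadlag z t - apply_cadlag z s)\<^sup>2 / (t - s) \<le> 2 * \<alpha>"
      using mdp_rate_energy[OF assms(1), of "{()}" "\<lambda>_. s" "\<lambda>_. t"] that
      by (auto simp: disjoint_family_on_def)
    then have "(apply_cadlag z t - apply_cadlag z s)\<^sup>2 \<le> 2 * \<alpha> * \<bar>t - s\<bar>"
      using that by (simp add: field_simps)
    then show ?thesis by (rule real_le_rsqrt[of "\<bar>_\<bar>", simplified])
  qed
  show ?thesis
    using *[of s t] *[of t s] assms(2,3) mdp_rate_leD(4)[OF assms(1)]
    by (cases s t rule: linorder_cases) (auto simp: abs_minus_commute)
qed

text \<open>By Cauchy-Schwarz the squared sum of the absolute increments is at most the energy times
  the total length.\<close>

lemma absolutely_continuous_on_unit_of_energy: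
  assumes E: "\<And>(I :: nat set) l r. finite I \<Longrightarrow> (\<forall>i\<in>I. 0 \<le> l i \<and> l i < r i \<and> r i \<le> 1) \<Longrightarrow>
      disjoint_family_on (\<lambda>i. {l i<..<r i}) I \<Longrightarrow>
      (\<Sum>i\<in>I. (f (r i) - f (l i))\<^sup>2 / (r i - l i)) \<le> K"
    and K: "0 \<le> K"
  shows "absolutely_continuous_on_unit f"
  unfolding absolutely_continuous_on_unit_def
proof (intro allI impI)
  fix e :: real assume e: "e > 0"
  \<comment> \<open>Chosen so that \<open>(K + 1) * \<delta> = e\<^sup>2\<close>; using
    \<open>K + 1\<close> keeps the inequality strict also for \<open>K = 0\<close>.\<close>
  define \<delta> where "\<delta> = e\<^sup>2 / (K + 1)"
  have \<delta>: "\<delta> > 0" "(K + 1) * \<delta> = e\<^sup>2" using e K by (auto simp: \<delta>_def)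
  show "\<exists>\<delta>>0. \<forall>(N::nat) l r.
        (\<forall>i<N. 0 \<le> l i \<and> l i \<le> r i \<and> r i \<le> 1) \<and>
        disjoint_family_on (\<lambda>i. {l i<..<r i}) {..<N} \<and>
        (\<Sum>i<N. r i - l i) < \<delta> \<longrightarrow>
        (\<Sum>i<N. \<bar>f (r i) - f (l i)\<bar>) < e"
  proof (intro exI[of _ \<delta>] conjI allI impI \<delta>(1), elim conjE)
    fix N :: nat and l r :: "nat \<Rightarrow> real"
    assume lr: "\<forall>i<N. 0 \<le> l i \<and> l i \<le> r i \<and> r i \<le> 1"
      and disj: "disjoint_family_on (\<lambda>i. {l i<..<r i}) {..<N}" and len: "(\<Sum>i<N. r i - l i) < \<delta>"
    \<comment> \<open>Degenerate intervals are dropped: they contribute no increment, and the energy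
      hypothesis requires positive lengths.\<close>
    define I where "I = {i. i < N \<and> l i < r i}"
    have fin: "finite I" by (simp add: I_def)
    have En: "(\<Sum>i\<in>I. (f (r i) - f (l i))\<^sup>2 / (r i - l i)) \<le> K"
      using lr disj by (intro E fin) (auto simp: I_def intro: disjoint_family_on_mono[rotated])
    have "(\<Sum>i<N. \<bar>f (r i) - f (l i)\<bar>) = (\<Sum>i\<in>I. \<bar>f (r i) - f (l i)\<bar>)"
    proof (rule sum.mono_neutral_right)
      show "\<forall>i\<in>{..<N} - I. \<bar>f (r i) - f (l i)\<bar> = 0"
      proof
        fix i assume "i \<in> {..<N} - I"
        then have "l i = r i" using lr by (auto simp: I_def not_less intro: antisym)
        then show "\<bar>f (r i) - f (l i)\<bar> = 0" by simp
      qed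
    qed (auto simp: I_def)
    also have "\<dots> = (\<Sum>i\<in>I. (\<bar>f (r i) - f (l i)\<bar> / sqrt (r i - l i)) * sqrt (r i - l i))"
      by (intro sum.cong) (auto simp: I_def)
    finally have "(\<Sum>i<N. \<bar>f (r i) - f (l i)\<bar>)\<^sup>2
        \<le> (\<Sum>i\<in>I. (\<bar>f (r i) - f (l i)\<bar> / sqrt (r i - l i))\<^sup>2) * (\<Sum>i\<in>I. (sqrt (r i - l i))\<^sup>2)"
      using Cauchy_Schwarz_ineq_sum[of "\<lambda>i. \<bar>f (r i) - f (l i)\<bar> / sqrt (r i - l i)" "\<lambda>i. sqrt (r i - l i)" I] by simp
    also have "(\<Sum>i\<in>I. (\<bar>f (r i) - f (l i)\<bar> / sqrt (r i - l i))\<^sup>2) = (\<Sum>i\<in>I. (f (r i) - f (l i))\<^sup>2 / (r i - l i))"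
      by (intro sum.cong) (auto simp: I_def power_divide)
    also have "(\<Sum>i\<in>I. (sqrt (r i - l i))\<^sup>2) = (\<Sum>i\<in>I. r i - l i)"
      by (intro sum.cong) (auto simp: I_def)
    also have "(\<Sum>i\<in>I. (f (r i) - f (l i))\<^sup>2 / (r i - l i)) * (\<Sum>i\<in>I. r i - l i) \<le> (K + 1) * (\<Sum>i\<in>I. r i - l i)"
      using En by (intro mult_right_mono sum_nonneg) (auto simp: I_def)
    also have "(\<Sum>i\<in>I. r i - l i) \<le> (\<Sum>i<N. r i - l i)"
      using lr by (intro sum_mono2) (auto simp: I_def)
    also have "(K + 1) * (\<Sum>i<N. r i - l i) < (K + 1) * \<delta>"
      using len K by simp
    finally have "(\<Sum>i<N. \<bar>f (r i) - f (l i)\<bar>)\<^sup>2 < e\<^sup>2" using K \<delta> by simp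
    then show "(\<Sum>i<N. \<bar>f (r i) - f (l i)\<bar>) < e" by (rule power2_less_imp_less) (use e in simp)
  qed
qed

section \<open>Energies on uniform grids\<close>

lemma nn_integral_grid_step:
  fixes c :: "nat \<Rightarrow> real"
  assumes m: "m > 0" and c: "\<And>i. 0 \<le> c i"
  shows "(\<integral>\<^sup>+u. (\<Sum>i<m. ennreal (c i) * indicator {real i / m..<(real i + 1) / m} u) \<partial>lebesgue) = ennreal ((\<Sum>i<m. c i) / m)"
proof -
  have "(\<integral>\<^sup>+u. (\<Sum>i<m. ennreal (c i) * indicator {real i / m..<(real i + 1) / m} u) \<partial>lebesgue)
      = (\<Sum>i<m. \<integral>\<^sup>+u. ennreal (c i) * indicator {real i / m..<(real i + 1) / m} u \<partial>lebesgue)"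
    by (rule nn_integral_sum) (auto intro!: borel_measurable_times_ennreal borel_measurable_indicator)
  also have "\<dots> = (\<Sum>i<m. ennreal (c i / m))"
  proof (rule sum.cong)
    fix i
    have "(\<integral>\<^sup>+u. ennreal (c i) * indicator {real i / m..<(real i + 1) / m} u \<partial>lebesgue)
       = ennreal (c i) * emeasure lebesgue {real i / m..<(real i + 1) / m}"
      by (rule nn_integral_cmult_indicator) auto
    also have "emeasure lebesgue {real i / m..<(real i + 1) / m} = ennreal (1 / m)"
      using m by (simp add: divide_right_mono diff_divide_distrib[symmetric])
    finally show "(\<integral>\<^sup>+u. ennreal (c i) * indicator {real i / m..<(real i + 1) / m} u \<partial>lebesgue) = ennreal (c i / m)"
      using c[of i] by (simp add: ennreal_mult[symmetric])
  qed simp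
  also have "\<dots> = ennreal ((\<Sum>i<m. c i) / m)"
    using c by (simp add: sum_divide_distrib)
  finally show ?thesis .
qed

lemma grid_step_eq:
  fixes c :: "nat \<Rightarrow> ennreal"
  assumes "j < m" "real j / m \<le> u" "u < (real j + 1) / m"
  shows "(\<Sum>i<m. c i * indicator {real i / m..<(real i + 1) / m} u) = c j"
proof -
  have m: "m > 0" using assms by simp
  have "(\<Sum>i<m. c i * indicator {real i / m..<(real i + 1) / m} u) = (\<Sum>i<m. if i = j then c j else 0)"
  proof (rule sum.cong)
    fix i
    have "u \<in> {real i / m..<(real i + 1) / m} \<longleftrightarrow> i = j"
    proof
      assume "u \<in> {real i / m..<(real i + 1) / m}"
      then have "real i / m < (real j + 1) / m" "real j / m < (real i + 1) / m" using assms by auto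
      then have "real i < real j + 1" "real j < real i + 1" using m by (auto simp: divide_less_cancel)
      then show "i = j" by linarith
    qed (use assms in auto)
    then show "c i * indicator {real i / m..<(real i + 1) / m} u = (if i = j then c j else 0)"
      by (auto simp: indicator_def)
  qed simp
  then show ?thesis using assms by simp
qed

text \<open>Fatou's lemma for the slopes of \<open>f\<close> on the uniform grids.\<close>

lemma deriv_energy_le:
  fixes f :: "real \<Rightarrow> real"
  assumes f: "absolutely_continuous_on_unit f"
    and K: "\<And>m. m > 0 \<Longrightarrow> real m * (\<Sum>i<m. (f ((real i + 1) / m) - f (real i / m))\<^sup>2) \<le> K"
  shows "(\<integral>\<^sup>+u\<in>{0..1}. ennreal ((deriv f u)\<^sup>2) \<partial>lebesgue) \<le> ennreal K"
proof -
  \<comment> \<open>The squared slope of \<open>f\<close> on the cell \<open>i\<close> of the grid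
    with \<open>m\<close> cells. The step function \<open>q\<close> uses \<open>Suc m\<close> to
    avoid the empty grid.\<close>
  define d where "d m i = (real m * (f ((real i + 1) / m) - f (real i / m)))\<^sup>2" for m i :: nat
  define q where "q m u = (\<Sum>i<Suc m. ennreal (d (Suc m) i) * indicator {real i / Suc m..<(real i + 1) / Suc m} u)" for m u
  have [measurable]: "q m \<in> borel_measurable lebesgue" for m
    unfolding q_def by (intro borel_measurable_sum borel_measurable_times_ennreal borel_measurable_indicator) auto
  have qi: "(\<integral>\<^sup>+u. q m u \<partial>lebesgue) \<le> ennreal K" for m
  proof -
    have "(\<integral>\<^sup>+u. q m u \<partial>lebesgue) = ennreal ((\<Sum>i<Suc m. d (Suc m) i) / Suc m)"
      unfolding q_def by (rule nn_integral_grid_step) (auto simp: d_def)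
    also have "(\<Sum>i<Suc m. d (Suc m) i) / Suc m = real (Suc m) * (\<Sum>i<Suc m. (f ((real i + 1) / Suc m) - f (real i / Suc m))\<^sup>2)"
      unfolding d_def power_mult_distrib sum_distrib_left[symmetric] by (simp add: power2_eq_square)
    also have "ennreal \<dots> \<le> ennreal K" using K[of "Suc m"] by (intro ennreal_leI) simp
    finally show ?thesis .
  qed
  have lim: "(\<lambda>m. q m u) \<longlonglongrightarrow> ennreal ((deriv f u)\<^sup>2)" if u: "u \<in> {0<..<1}" "f differentiable at u" for u
  proof -
    \<comment> \<open>The index of the half-open cell containing \<open>u\<close>.\<close>
    define p where "p m = real (nat \<lfloor>real (Suc m) * u\<rfloor>)" for m
    have p: "p m \<le> real (Suc m) * u" "real (Suc m) * u < p m + 1" for m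
    proof -
      have "p m = of_int \<lfloor>real (Suc m) * u\<rfloor>" using u by (simp add: p_def)
      then show "p m \<le> real (Suc m) * u" "real (Suc m) * u < p m + 1" by linarith+
    qed
    have qeq: "q m u = ennreal ((real (Suc m) * (f ((p m + 1) / Suc m) - f (p m / Suc m)))\<^sup>2)" for m
    proof -
      have "real (Suc m) * u < real (Suc m)" using u by simp
      then have "p m < real (Suc m)" using p(1)[of m] by linarith
      then have "q m u = ennreal (d (Suc m) (nat \<lfloor>real (Suc m) * u\<rfloor>))"
        using p[of m] unfolding q_def p_def
        by (intro grid_step_eq) (auto simp: divide_le_eq less_divide_eq mult.commute simp del: of_nat_Suc)
      then show ?thesis by (simp add: d_def p_def)
    qed
    have "(\<lambda>m. real (Suc m) * (f ((p m + 1) / Suc m) - f (p m / Suc m))) \<longlonglongrightarrow> deriv f u"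
    proof (rule LIMSEQ_I)
      fix e :: real assume e: "e > 0"
      have "(f has_derivative (*) (deriv f u)) (at u)"
        using u(2) by (simp add: has_field_derivative_def[symmetric] DERIV_deriv_iff_real_differentiable)
      then obtain dd where dd: "dd > 0" "\<And>y. \<bar>y - u\<bar> < dd \<Longrightarrow> \<bar>f y - f u - deriv f u * (y - u)\<bar> \<le> e/2 * \<bar>y - u\<bar>"
        unfolding has_derivative_at_alt using e by (metis half_gt_zero real_norm_def)
      obtain n0 where n0: "1 / real (Suc n0) < dd" using nat_approx_posE[OF dd(1)] by blast
      have "\<bar>real (Suc m) * (f ((p m + 1) / Suc m) - f (p m / Suc m)) - deriv f u\<bar> < e" if "m \<ge> n0" for m
      proof -
        define M where "M = real (Suc m)"
        have M: "M > 0" by (simp add: M_def)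
        have "1 / M \<le> 1 / real (Suc n0)" using that unfolding M_def by (intro divide_left_mono) auto
        then have Md: "1 / M < dd" using n0 by simp
        define y1 y2 where "y1 = p m / M" and "y2 = (p m + 1) / M"
        have y: "y1 \<le> u" "u < y2" "y2 - y1 = 1 / M"
          using p[of m] M by (auto simp: y1_def y2_def M_def field_simps)
        have "\<bar>f y1 - f u - deriv f u * (y1 - u)\<bar> \<le> e/2 * (u - y1)" "\<bar>f y2 - f u - deriv f u * (y2 - u)\<bar> \<le> e/2 * (y2 - u)"
          using dd(2)[of y1] dd(2)[of y2] y Md by auto
        \<comment> \<open>Since \<open>u\<close> lies between \<open>y1\<close> and
          \<open>y2\<close>, the two one-sided errors add up to \<open>e/2\<close> times the cell
          length, so slopes of cells containing \<open>u\<close> converge to the derivative although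
          \<open>u\<close> is no endpoint in general.\<close>
        then have "\<bar>f y2 - f y1 - deriv f u * (y2 - y1)\<bar> \<le> e/2 * (y2 - y1)"
          unfolding abs_le_iff by (simp only: right_diff_distrib) linarith
        then have "M * \<bar>f y2 - f y1 - deriv f u * (1 / M)\<bar> \<le> M * (e/2 * (1 / M))"
          unfolding y(3) using M by (intro mult_left_mono) auto
        also have "M * \<bar>f y2 - f y1 - deriv f u * (1 / M)\<bar> = \<bar>M * (f y2 - f y1 - deriv f u * (1 / M))\<bar>"
          using M by (simp add: abs_mult)
        also have "M * (f y2 - f y1 - deriv f u * (1 / M)) = M * (f y2 - f y1) - deriv f u"
          using M by (simp add: right_diff_distrib)
        finally have "\<bar>M * (f y2 - f y1) - deriv f u\<bar> \<le> e / 2" using M by simp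
        then show ?thesis using e unfolding y1_def y2_def M_def by linarith
      qed
      then show "\<exists>no. \<forall>n\<ge>no. norm (real (Suc n) * (f ((p n + 1) / Suc n) - f (p n / Suc n)) - deriv f u) < e"
        by auto
    qed
    then show ?thesis unfolding qeq by (intro tendsto_ennrealI tendsto_power)
  qed
  have "negligible ({x\<in>{0<..<1}. \<not> f differentiable at x} \<union> {0,1})"
    by (intro negligible_Un absolutely_continuous_on_unit_differentiable_AE[OF f]) auto
  then have "AE u in lebesgue. u \<notin> {x\<in>{0<..<1}. \<not> f differentiable at x} \<union> {0,1}"
    by (intro AE_not_in) (simp add: negligible_iff_null_sets)
  then have "(\<integral>\<^sup>+u\<in>{0..1}. ennreal ((deriv f u)\<^sup>2) \<partial>lebesgue) \<le> (\<integral>\<^sup>+u. liminf (\<lambda>m. q m u) \<partial>lebesgue)"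
  proof (intro nn_integral_mono_AE, eventually_elim)
    fix u assume u: "u \<notin> {x\<in>{0<..<1}. \<not> f differentiable at x} \<union> {0,1}"
    show "ennreal ((deriv f u)\<^sup>2) * indicator {0..1} u \<le> liminf (\<lambda>m. q m u)"
    proof (cases "u \<in> {0..1}")
      case True
      then have "(\<lambda>m. q m u) \<longlonglongrightarrow> ennreal ((deriv f u)\<^sup>2)" using u by (intro lim) auto
      then have "liminf (\<lambda>m. q m u) = ennreal ((deriv f u)\<^sup>2)" by (intro lim_imp_Liminf) auto
      then show ?thesis by (simp add: indicator_def)
    qed simp
  qed
  also have "\<dots> \<le> liminf (\<lambda>m. \<integral>\<^sup>+u. q m u \<partial>lebesgue)"
    by (rule nn_integral_liminf) measurable
  also have "\<dots> \<le> ennreal K"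
    by (rule Liminf_le) (use qi in auto)
  finally show ?thesis .
qed

lemma disjoint_grid_cells:
  fixes m :: nat
  shows "disjoint_family_on (\<lambda>i. {real i / m<..<(real i + 1) / m}) J"
  unfolding disjoint_family_on_def
proof (intro ballI impI)
  fix i j :: nat assume "i \<noteq> j"
  then have "real i + 1 \<le> real j \<or> real j + 1 \<le> real i" by linarith
  then have "(real i + 1) / m \<le> real j / m \<or> (real j + 1) / m \<le> real i / m"
    by (auto intro: divide_right_mono)
  then show "{real i / m<..<(real i + 1) / m} \<inter> {real j / m<..<(real j + 1) / m} = {}" by auto
qed

text \<open>The converse of \<open>mdp_rate_energy\<close>. Together they describe a level set by
  conditions on finitely many path values at a time, which is what makes the rate lower
  semicontinuous.\<close>

lemma mdp_rate_leI_energy: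
  assumes 0: "apply_cadlag z 0 = 0" and \<alpha>: "0 \<le> \<alpha>"
    and E: "\<And>(I :: nat set) l r. finite I \<Longrightarrow> (\<forall>i\<in>I. 0 \<le> l i \<and> l i < r i \<and> r i \<le> 1) \<Longrightarrow>
      disjoint_family_on (\<lambda>i. {l i<..<r i}) I \<Longrightarrow>
      (\<Sum>i\<in>I. (apply_cadlag z (r i) - apply_cadlag z (l i))\<^sup>2 / (r i - l i)) \<le> 2 * \<alpha>"
  shows "mdp_rate z \<le> ereal \<alpha>"
proof (rule mdp_rate_leI[OF 0 _ _ \<alpha>])
  show ac: "absolutely_continuous_on_unit (apply_cadlag z)"
    by (rule absolutely_continuous_on_unit_of_energy[OF E]) (use \<alpha> in auto)
  show "(\<integral>\<^sup>+u\<in>{0..1}. ennreal ((deriv (apply_cadlag z) u)\<^sup>2) \<partial>lebesgue) \<le> ennreal (2 * \<alpha>)"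
  proof (rule deriv_energy_le[OF ac])
    fix m :: nat assume m: "m > 0"
    have "(\<Sum>i<m. (apply_cadlag z ((real i + 1) / m) - apply_cadlag z (real i / m))\<^sup>2 / ((real i + 1) / m - real i / m)) \<le> 2 * \<alpha>"
    proof (rule E)
      show "\<forall>i\<in>{..<m}. 0 \<le> real i / m \<and> real i / m < (real i + 1) / m \<and> (real i + 1) / m \<le> 1"
        using m by (auto simp: divide_strict_right_mono)
      show "disjoint_family_on (\<lambda>i. {real i / m<..<(real i + 1) / m}) {..<m}"
        by (rule disjoint_grid_cells)
    qed simp
    then show "real m * (\<Sum>i<m. (apply_cadlag z ((real i + 1) / m) - apply_cadlag z (real i / m))\<^sup>2) \<le> 2 * \<alpha>"
      by (simp add: diff_divide_distrib[symmetric] sum_distrib_left mult.commute)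
  qed
qed

section \<open>Continuous paths, compactness and linear interpolation\<close>

lemma cadlag_on_unit_continuous:
  fixes g :: "real \<Rightarrow> real"
  assumes g: "continuous_on {0..1} g"
  shows "cadlag_on_unit (\<lambda>t. if t \<in> {0..1} then g t else 0)"
  unfolding cadlag_on_unit_def
proof (intro conjI allI impI)
  fix t :: real assume t: "0 \<le> t \<and> t < 1"
  have "(g \<longlongrightarrow> g t) (at t within {0..1})" using g t by (auto simp: continuous_on_def)
  then have "(g \<longlongrightarrow> g t) (at t within {t..1})" by (rule tendsto_within_subset) (use t in auto)
  then have "(g \<longlongrightarrow> g t) (at_right t)" using t by (simp add: at_within_Icc_at_right)
  moreover have "\<forall>\<^sub>F x in at_right t. g x = (if x \<in> {0..1} then g x else 0)"
  proof (rule eventually_mono)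
    show "\<forall>\<^sub>F x in at_right t. x \<in> {t<..<1}" using eventually_at_right_real[of t 1] t by simp
  qed (use t in auto)
  ultimately have "((\<lambda>t. if t \<in> {0..1} then g t else 0) \<longlongrightarrow> g t) (at_right t)"
    by (rule Lim_transform_eventually)
  then show "((\<lambda>t. if t \<in> {0..1} then g t else 0) \<longlongrightarrow> (if t \<in> {0..1} then g t else 0)) (at_right t)"
    using t by simp
next
  fix t :: real assume t: "0 < t \<and> t \<le> 1"
  have "(g \<longlongrightarrow> g t) (at t within {0..1})" using g t by (auto simp: continuous_on_def)
  then have "(g \<longlongrightarrow> g t) (at t within {0..t})" by (rule tendsto_within_subset) (use t in auto)
  then have "(g \<longlongrightarrow> g t) (at_left t)" using t by (simp add: at_within_Icc_at_left)
  moreover have "\<forall>\<^sub>F x in at_left t. g x = (if x \<in> {0..1} then g x else 0)"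
  proof (rule eventually_mono)
    show "\<forall>\<^sub>F x in at_left t. x \<in> {0<..<t}" using eventually_at_left_real[of 0 t] t by simp
  qed (use t in auto)
  ultimately have "((\<lambda>t. if t \<in> {0..1} then g t else 0) \<longlongrightarrow> g t) (at_left t)"
    by (rule Lim_transform_eventually)
  then show "\<exists>l. ((\<lambda>t. if t \<in> {0..1} then g t else 0) \<longlongrightarrow> l) (at_left t)" by blast
qed

lemma cadlag_of_continuous:
  fixes g :: "real \<Rightarrow> real"
  assumes g: "continuous_on {0..1} g"
  obtains z where "\<And>t. t \<in> {0..1} \<Longrightarrow> apply_cadlag z t = g t"
proof
  fix t :: real assume "t \<in> {0..1}"
  then show "apply_cadlag (Cadlag (\<lambda>t. if t \<in> {0..1} then g t else 0)) t = g t"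
    using cadlag_on_unit_continuous[OF g] by (subst Cadlag_inverse) auto
qed

text \<open>The Hoelder bound gives equicontinuity, and the energy bounds pass to the uniform limit.
  Treating the empty level set first reduces the extended real \<open>\<alpha>\<close> to a
  nonnegative real.\<close>

lemma compact_mdp_rate_level:
  assumes "\<alpha> < \<infinity>"
  shows "compact {z. mdp_rate z \<le> \<alpha>}"
proof (cases "\<exists>z. mdp_rate z \<le> \<alpha>")
  case False
  then show ?thesis by simp
next
  case True
  then obtain z0 where z0: "mdp_rate z0 \<le> \<alpha>" by blast
  have "0 \<le> mdp_rate z0" by (simp add: mdp_rate_def)
  then have "0 \<le> \<alpha>" using z0 order_trans by blast
  then obtain a where a: "\<alpha> = ereal a" "0 \<le> a" using assms by (cases \<alpha>) auto
  show ?thesis unfolding compact_eq_seq_compact_metric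
  proof (rule seq_compactI)
    fix z :: "nat \<Rightarrow> cadlag" assume "\<forall>n. z n \<in> {z. mdp_rate z \<le> \<alpha>}"
    then have z: "mdp_rate (z n) \<le> ereal a" for n by (simp add: a)
    obtain g k where g: "continuous_on {0..1} g" "strict_mono (k :: nat \<Rightarrow> nat)"
       and lim: "\<And>e. 0 < e \<Longrightarrow> \<exists>N. \<forall>n x. n \<ge> N \<and> x \<in> {0..1} \<longrightarrow> norm (apply_cadlag (z (k n)) x - g x) < e"
    proof (rule Arzela_Ascoli[of "{0..1}" "\<lambda>n. apply_cadlag (z n)" "sqrt (2 * a)"])
      show "norm (apply_cadlag (z n) x) \<le> sqrt (2 * a)" if x: "x \<in> {0..1}" for n x
      proof -
        have "\<bar>apply_cadlag (z n) x - apply_cadlag (z n) 0\<bar> \<le> sqrt (2 * a * \<bar>x - 0\<bar>)"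
          using x by (intro mdp_rate_Hoelder[OF z]) auto
        also have "\<dots> \<le> sqrt (2 * a)" using x a by (simp add: mult_left_le)
        finally show ?thesis using mdp_rate_leD(1)[OF z[of n]] by simp
      qed
      show "\<exists>d>0. \<forall>n y. y \<in> {0..1} \<and> norm (x - y) < d \<longrightarrow> norm (apply_cadlag (z n) x - apply_cadlag (z n) y) < e"
        if xe: "x \<in> {0..1}" "0 < e" for x e
      \<comment> \<open>This distance makes the Hoelder bound
        \<open>sqrt (2 * a * \<bar>x - y\<bar>)\<close> smaller than \<open>e\<close>, also for
        \<open>a = 0\<close>.\<close>
      proof (intro exI[of _ "e\<^sup>2 / (2 * a + 1)"] conjI allI impI)
        show "0 < e\<^sup>2 / (2 * a + 1)" using xe a by simp
        fix n y assume y: "y \<in> {0..1} \<and> norm (x - y) < e\<^sup>2 / (2 * a + 1)"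
        have "\<bar>apply_cadlag (z n) x - apply_cadlag (z n) y\<bar> \<le> sqrt (2 * a * \<bar>x - y\<bar>)"
          using xe y by (intro mdp_rate_Hoelder[OF z]) auto
        also have "2 * a * \<bar>x - y\<bar> < e\<^sup>2"
        proof -
          have "2 * a * \<bar>x - y\<bar> \<le> (2 * a + 1) * \<bar>x - y\<bar>" by (simp add: algebra_simps)
          also have "\<dots> < e\<^sup>2" using y a by (simp add: less_divide_eq mult.commute)
          finally show ?thesis .
        qed
        then have "sqrt (2 * a * \<bar>x - y\<bar>) < e" using xe by (intro real_less_lsqrt) auto
        finally show "norm (apply_cadlag (z n) x - apply_cadlag (z n) y) < e" by simp
      qed
    qed auto
    obtain w where w: "\<And>t. t \<in> {0..1} \<Longrightarrow> apply_cadlag w t = g t"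
      using cadlag_of_continuous[OF g(1)] by blast
    have conv: "(z \<circ> k) \<longlonglongrightarrow> w"
    proof (rule metric_LIMSEQ_I)
      fix e :: real assume e: "e > 0"
      obtain N where "\<forall>n x. n \<ge> N \<and> x \<in> {0..1} \<longrightarrow> norm (apply_cadlag (z (k n)) x - g x) < e/2"
        using lim[OF half_gt_zero[OF e]] by (elim exE)
      then have N: "\<And>n x. n \<ge> N \<Longrightarrow> x \<in> {0..1} \<Longrightarrow> norm (apply_cadlag (z (k n)) x - g x) < e/2"
        by blast
      have "dist ((z \<circ> k) n) w < e" if "n \<ge> N" for n
      proof -
        have "norm (z (k n) - w) \<le> e/2"
        proof (rule norm_cadlag_le)
          fix t :: real assume t: "t \<in> {0..1}"
          show "\<bar>apply_cadlag (z (k n) - w) t\<bar> \<le> e/2"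
            using N[OF that t] w[OF t] by (simp add: apply_cadlag_diff)
        qed
        then have "dist (z (k n)) w \<le> e/2" unfolding dist_norm .
        then show ?thesis using e unfolding o_apply by linarith
      qed
      then show "\<exists>no. \<forall>n\<ge>no. dist ((z \<circ> k) n) w < e" by (intro exI[of _ N] allI impI)
    qed
    have pt: "(\<lambda>n. apply_cadlag (z (k n)) t) \<longlonglongrightarrow> apply_cadlag w t" if t: "t \<in> {0..1}" for t
    proof (rule LIMSEQ_I)
      fix e :: real assume "e > 0"
      then show "\<exists>no. \<forall>n\<ge>no. norm (apply_cadlag (z (k n)) t - apply_cadlag w t) < e"
        using lim[of e] t w[OF t] by auto
    qed
    have "mdp_rate w \<le> ereal a"
    proof (rule mdp_rate_leI_energy)
      have "(\<lambda>n. 0) \<longlonglongrightarrow> apply_cadlag w 0" using pt[of 0] mdp_rate_leD(1)[OF z] by simp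
      then show "apply_cadlag w 0 = 0" by (simp add: LIMSEQ_const_iff)
      fix I :: "nat set" and l r :: "nat \<Rightarrow> real"
      assume I: "finite I" "\<forall>i\<in>I. 0 \<le> l i \<and> l i < r i \<and> r i \<le> 1" "disjoint_family_on (\<lambda>i. {l i<..<r i}) I"
      have "(\<lambda>n. \<Sum>i\<in>I. (apply_cadlag (z (k n)) (r i) - apply_cadlag (z (k n)) (l i))\<^sup>2 / (r i - l i))
          \<longlonglongrightarrow> (\<Sum>i\<in>I. (apply_cadlag w (r i) - apply_cadlag w (l i))\<^sup>2 / (r i - l i))"
        using I(2) by (intro tendsto_sum tendsto_divide tendsto_power tendsto_diff pt tendsto_const) force+
      then show "(\<Sum>i\<in>I. (apply_cadlag w (r i) - apply_cadlag w (l i))\<^sup>2 / (r i - l i)) \<le> 2 * a"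
      proof (rule LIMSEQ_le_const2, intro exI[of _ 0] allI impI)
        fix n
        show "(\<Sum>i\<in>I. (apply_cadlag (z (k n)) (r i) - apply_cadlag (z (k n)) (l i))\<^sup>2 / (r i - l i)) \<le> 2 * a"
          by (rule mdp_rate_energy[OF z I(1) _ I(3)]) (use I(2) in blast)
      qed
    qed (rule a)
    then show "\<exists>l\<in>{z. mdp_rate z \<le> \<alpha>}. \<exists>r. strict_mono r \<and> (z \<circ> r) \<longlonglongrightarrow> l"
      using conv g(2) by (intro bexI[of _ w] exI[of _ k]) (auto simp: a)
  qed
qed

text \<open>Attaches to the values of the process at the grid times a path whose rate is bounded by
  the discrete energy. The upper bound compares the process with this path, for which the inequality
  is enough.\<close>

lemma cadlag_linear_interpolation:
  fixes y :: "nat \<Rightarrow> real"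
  assumes y0: "y 0 = 0" and m: "m > 0"
  obtains p where "mdp_rate p \<le> ereal (real m / 2 * (\<Sum>i<m. (y (Suc i) - y i)\<^sup>2))"
    "\<And>i t. i < m \<Longrightarrow> real i / m \<le> t \<Longrightarrow> t \<le> (real i + 1) / m \<Longrightarrow>
        apply_cadlag p t = y i + (real m * t - i) * (y (Suc i) - y i)"
proof -
  define D where "D i = y (Suc i) - y i" for i
  \<comment> \<open>A ramp rising from 0 to 1 across the cell \<open>i\<close>. As a sum of ramps
    the interpolation is visibly continuous and Lipschitz, with no gluing at grid points.\<close>
  define c where "c i t = max 0 (min 1 (real m * t - real i))" for i t
  define g where "g t = (\<Sum>i<m. D i * c i t)" for t
  have geq: "g t = y i + (real m * t - i) * D i" if i: "i < m" and t: "real i / m \<le> t" "t \<le> (real i + 1) / m" for i t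
  proof -
    have t': "real i \<le> real m * t" "real m * t \<le> real i + 1"
      using t m by (auto simp: field_simps)
    have "{..<m} = {..<i} \<union> {i} \<union> {Suc i..<m}" using i by auto
    then have "g t = (\<Sum>j\<in>{..<i} \<union> {i} \<union> {Suc i..<m}. D j * c j t)" by (simp add: g_def)
    also have "\<dots> = (\<Sum>j<i. D j * c j t) + D i * c i t + (\<Sum>j=Suc i..<m. D j * c j t)"
      by (subst sum.union_disjoint; auto)+
    also have "(\<Sum>j<i. D j * c j t) = (\<Sum>j<i. y (Suc j) - y j)"
    proof (rule sum.cong)
      fix j assume "j \<in> {..<i}"
      then have "real j + 1 \<le> real i" by auto
      then show "D j * c j t = y (Suc j) - y j" using t' by (simp add: c_def D_def)
    qed simp
    also have "\<dots> = y i" using y0 by (simp add: sum_lessThan_telescope)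
    also have "(\<Sum>j=Suc i..<m. D j * c j t) = 0"
    proof (rule sum.neutral, intro ballI)
      fix j assume "j \<in> {Suc i..<m}"
      then have "real i + 1 \<le> real j" by auto
      then show "D j * c j t = 0" using t' by (simp add: c_def)
    qed
    also have "c i t = real m * t - i" using t' by (simp add: c_def)
    finally show ?thesis by (simp add: mult.commute)
  qed
  define L where "L = (\<Sum>i<m. \<bar>D i\<bar>) * m"
  have L0: "L \<ge> 0" by (simp add: L_def sum_nonneg)
  have lip: "\<bar>g t - g s\<bar> \<le> L * \<bar>t - s\<bar>" for s t
  proof -
    have "g t - g s = (\<Sum>i<m. D i * (c i t - c i s))"
      by (simp add: g_def sum_subtractf right_diff_distrib)
    also have "\<bar>\<dots>\<bar> \<le> (\<Sum>i<m. \<bar>D i * (c i t - c i s)\<bar>)" by (rule sum_abs)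
    also have "\<dots> \<le> (\<Sum>i<m. \<bar>D i\<bar> * (m * \<bar>t - s\<bar>))"
    proof (rule sum_mono)
      fix i
      have "\<bar>max 0 (min 1 (x - r)) - max 0 (min 1 (x' - r))\<bar> \<le> \<bar>x - x'\<bar>" for x x' r :: real
        by (auto simp: max_def min_def abs_if)
      then have "\<bar>c i t - c i s\<bar> \<le> \<bar>real m * t - real m * s\<bar>" unfolding c_def .
      also have "\<dots> = m * \<bar>t - s\<bar>" by (simp add: right_diff_distrib[symmetric] abs_mult)
      finally show "\<bar>D i * (c i t - c i s)\<bar> \<le> \<bar>D i\<bar> * (m * \<bar>t - s\<bar>)"
        by (simp add: abs_mult mult_left_mono)
    qed
    also have "\<dots> = L * \<bar>t - s\<bar>" by (simp add: L_def sum_distrib_right mult.assoc)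
    finally show ?thesis .
  qed
  have gc: "continuous_on {0..1} g"
    unfolding g_def c_def by (intro continuous_intros)
  obtain p where p: "\<And>t. t \<in> {0..1} \<Longrightarrow> apply_cadlag p t = g t"
    using cadlag_of_continuous[OF gc] by blast
  have peq: "apply_cadlag p t = y i + (real m * t - i) * D i" if "i < m" "real i / m \<le> t" "t \<le> (real i + 1) / m" for i t
  proof -
    have "0 \<le> real i / m" "(real i + 1) / m \<le> 1" using that m by auto
    then have "t \<in> {0..1}" using that(2,3) unfolding atLeastAtMost_iff by linarith
    then show ?thesis using p geq[OF that] by simp
  qed
  have ac: "absolutely_continuous_on_unit (apply_cadlag p)"
    unfolding absolutely_continuous_on_unit_def
  proof (intro allI impI)
    fix e :: real assume e: "e > 0"
    show "\<exists>\<delta>>0. \<forall>(N::nat) l r.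
        (\<forall>i<N. 0 \<le> l i \<and> l i \<le> r i \<and> r i \<le> 1) \<and>
        disjoint_family_on (\<lambda>i. {l i<..<r i}) {..<N} \<and>
        (\<Sum>i<N. r i - l i) < \<delta> \<longrightarrow>
        (\<Sum>i<N. \<bar>apply_cadlag p (r i) - apply_cadlag p (l i)\<bar>) < e"
    proof (intro exI[of _ "e / (L + 1)"] conjI allI impI, goal_cases)
      case 1
      then show ?case using e L0 by simp
    next
      case (2 N l r)
      have "(\<Sum>i<N. \<bar>apply_cadlag p (r i) - apply_cadlag p (l i)\<bar>) \<le> (\<Sum>i<N. L * (r i - l i))"
      proof (rule sum_mono)
        fix i assume "i \<in> {..<N}"
        then have i: "0 \<le> l i" "l i \<le> r i" "r i \<le> 1" using 2 by auto
        then show "\<bar>apply_cadlag p (r i) - apply_cadlag p (l i)\<bar> \<le> L * (r i - l i)"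
          using lip[of "r i" "l i"] p[of "r i"] p[of "l i"] by simp
      qed
      also have "\<dots> = L * (\<Sum>i<N. r i - l i)" by (simp add: sum_distrib_left)
      also have "\<dots> \<le> L * (e / (L + 1))" using 2 L0 by (intro mult_left_mono) auto
      also have "\<dots> < e" using e L0 by (simp add: field_simps)
      finally show ?case .
    qed
  qed
  have der: "deriv (apply_cadlag p) u = real m * D i" if "i < m" "real i / m < u" "u < (real i + 1) / m" for i u
  proof (rule DERIV_imp_deriv)
    have "((\<lambda>t. y i + (real m * t - i) * D i) has_field_derivative real m * D i) (at u)"
      by (auto intro!: derivative_eq_intros)
    then show "(apply_cadlag p has_field_derivative real m * D i) (at u)"
      by (rule has_field_derivative_transform_within_open[where S="{real i / m<..<(real i + 1) / m}"])
        (use that peq in auto)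
  qed
  define q where "q u = (\<Sum>i<m. ennreal ((real m * D i)\<^sup>2) * indicator {real i / m..<(real i + 1) / m} u)" for u
  have "negligible ((\<lambda>i. real i / m) ` {..m})" by (rule negligible_finite) auto
  then have "AE u in lebesgue. u \<notin> (\<lambda>i. real i / m) ` {..m}"
    by (intro AE_not_in) (simp add: negligible_iff_null_sets)
  then have "(\<integral>\<^sup>+u\<in>{0..1}. ennreal ((deriv (apply_cadlag p) u)\<^sup>2) \<partial>lebesgue) \<le> (\<integral>\<^sup>+u. q u \<partial>lebesgue)"
  proof (intro nn_integral_mono_AE, eventually_elim)
    fix u assume u: "u \<notin> (\<lambda>i. real i / m) ` {..m}"
    show "ennreal ((deriv (apply_cadlag p) u)\<^sup>2) * indicator {0..1} u \<le> q u"
    proof (cases "u \<in> {0..1}")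
      case True
      \<comment> \<open>The point 1 is the grid point with index \<open>m\<close>; it has to be
        excluded since the half-open cells do not reach it.\<close>
      have "u \<noteq> 1" using u m by (force simp: image_iff)
      then have u1: "u < 1" using True by auto
      define i where "i = nat \<lfloor>real m * u\<rfloor>"
      have ri: "real i = of_int \<lfloor>real m * u\<rfloor>" using True by (simp add: i_def)
      then have i: "real i \<le> real m * u" "real m * u < real i + 1" by linarith+
      have "real m * u < real m" using u1 m by simp
      then have im: "i < m" using i by linarith
      have "real i / m \<noteq> u" using u im by (force simp: image_iff)
      moreover have "real i / m \<le> u" "u < (real i + 1) / m" using i m by (auto simp: field_simps)
      ultimately have iu: "real i / m < u" "u < (real i + 1) / m" by auto
      then have "q u = ennreal ((real m * D i)\<^sup>2)" unfolding q_def by (intro grid_step_eq im) auto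
      then show ?thesis using der[OF im iu] True by simp
    qed simp
  qed
  also have "(\<integral>\<^sup>+u. q u \<partial>lebesgue) = ennreal ((\<Sum>i<m. (real m * D i)\<^sup>2) / m)"
    unfolding q_def by (rule nn_integral_grid_step[OF m]) auto
  also have "(\<Sum>i<m. (real m * D i)\<^sup>2) / m = 2 * (real m / 2 * (\<Sum>i<m. (D i)\<^sup>2))"
    unfolding power_mult_distrib sum_distrib_left[symmetric] using m by (simp add: power2_eq_square)
  finally have "mdp_rate p \<le> ereal (real m / 2 * (\<Sum>i<m. (D i)\<^sup>2))"
    using peq[of 0 0] m y0 by (intro mdp_rate_leI ac) (auto intro!: mult_nonneg_nonneg sum_nonneg)
  then show ?thesis using peq that by (simp add: D_def)
qed

subsection \<open>Sums of independent random variables\<close>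

text \<open>The second-order lower bound for the logarithm of \<open>1 + w\<close>. It must hold for
  all nonnegative \<open>w\<close>: beyond 1 the exponent is negative and the left side is at most
  1.\<close>

lemma exp_minus_square_le:
  fixes w :: real
  assumes "0 \<le> w"
  shows "exp (w - w\<^sup>2) \<le> 1 + w"
proof (cases "w \<le> 1")
  case True
  then have "w - w\<^sup>2 \<le> ln (1 + w)" using assms by (intro ln_one_plus_pos_lower_bound)
  then have "exp (w - w\<^sup>2) \<le> exp (ln (1 + w))" by simp
  then show ?thesis using assms by simp
next
  case False
  then have "w - w\<^sup>2 \<le> 0" using assms by (simp add: power2_eq_square)
  then have "exp (w - w\<^sup>2) \<le> 1" unfolding exp_le_one_iff .
  then show ?thesis using assms by linarith
qed

context prob_space
begin

text \<open>Integrate the exponential series termwise. The terms of order 0, 1, 2 are exact; from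
  order 3 on the factorial cancels and leaves a geometric series with ratio
  \<open>\<bar>\<mu>\<bar> * A\<close>, and the condition that this is at most 1/2 produces the
  factor 2.\<close>

lemma mgf_taylor:
  fixes X :: "'a \<Rightarrow> real"
  assumes rv[measurable]: "random_variable borel X" and int2: "integrable M (\<lambda>x. (X x)\<^sup>2)"
    and c: "expectation X = 0" and A: "0 \<le> A" and B: "0 \<le> B"
    and mom: "\<And>m. m \<ge> 3 \<Longrightarrow> integrable M (\<lambda>x. \<bar>X x\<bar> ^ m) \<and>
       expectation (\<lambda>x. \<bar>X x\<bar> ^ m) \<le> fact m * A ^ m * B"
    and lam: "\<bar>\<mu>\<bar> * A \<le> 1/2"
  shows "integrable M (\<lambda>x. exp (\<mu> * X x))"
    and "\<bar>expectation (\<lambda>x. exp (\<mu> * X x)) - 1 - \<mu>\<^sup>2 / 2 * expectation (\<lambda>x. (X x)\<^sup>2)\<bar> \<le> 2 * B * (\<bar>\<mu>\<bar> * A) ^ 3"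
proof -
  define q where "q = \<bar>\<mu>\<bar> * A"
  have q: "0 \<le> q" "q \<le> 1/2" using A lam by (auto simp: q_def)
  define f where "f m x = (\<mu> * X x) ^ m /\<^sub>R fact m" for m x
  have intX: "integrable M X" using square_integrable_imp_integrable[OF rv int2] .
  have norm_f: "norm (f m x) = \<bar>\<mu>\<bar> ^ m / fact m * \<bar>X x\<bar> ^ m" for m x
    by (simp add: f_def abs_mult power_mult_distrib power_abs divide_inverse mult_ac)
  have int_abs: "integrable M (\<lambda>x. \<bar>X x\<bar> ^ m)" for m
  proof -
    consider "m = 0" | "m = 1" | "m = 2" | "m \<ge> 3" by linarith
    then show ?thesis using intX int2 mom by cases auto
  qed
  have fm[measurable]: "f m \<in> borel_measurable M" for m unfolding f_def by measurable
  have int_f: "integrable M (f m)" for m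
  proof (rule Bochner_Integration.integrable_bound)
    show "integrable M (\<lambda>x. \<bar>\<mu>\<bar> ^ m / fact m * \<bar>X x\<bar> ^ m)" using int_abs by simp
    show "AE x in M. norm (f m x) \<le> norm (\<bar>\<mu>\<bar> ^ m / fact m * \<bar>X x\<bar> ^ m)"
      by (simp only: norm_f) (auto simp: abs_mult)
  qed measurable
  have tail: "(\<integral>x. norm (f m x) \<partial>M) \<le> B * q ^ m" if "m \<ge> 3" for m
  proof -
    have "(\<integral>x. norm (f m x) \<partial>M) = \<bar>\<mu>\<bar> ^ m / fact m * expectation (\<lambda>x. \<bar>X x\<bar> ^ m)"
      unfolding norm_f by simp
    also have "\<dots> \<le> \<bar>\<mu>\<bar> ^ m / fact m * (fact m * A ^ m * B)"
      using mom[OF that] by (intro mult_left_mono) auto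
    also have "\<dots> = B * q ^ m" by (simp add: q_def power_mult_distrib)
    finally show ?thesis .
  qed
  have geo: "summable (\<lambda>m. B * q ^ m)" using q by (intro summable_mult summable_geometric) auto
  have summ: "summable (\<lambda>m. \<integral>x. norm (f m x) \<partial>M)"
    by (rule summable_comparison_test'[OF geo, of 3]) (use tail in \<open>auto intro!: integral_nonneg_AE\<close>)
  have AEs: "AE x in M. summable (\<lambda>m. norm (f m x))"
    unfolding f_def using summable_norm_exp by (intro AE_I2) blast
  have fexp: "(\<Sum>m. f m x) = exp (\<mu> * X x)" for x by (simp add: f_def exp_def)
  show "integrable M (\<lambda>x. exp (\<mu> * X x))"
    using integrable_suminf[OF int_f AEs summ] by (simp add: fexp)
  have E: "expectation (\<lambda>x. exp (\<mu> * X x)) = (\<Sum>m. expectation (f m))"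
    using integral_suminf[OF int_f AEs summ] by (simp add: fexp)
  have le_norm: "\<bar>expectation (f m)\<bar> \<le> (\<integral>x. norm (f m x) \<partial>M)" for m
    using integral_norm_bound[of M "f m"] by simp
  have summE: "summable (\<lambda>m. expectation (f m))"
    by (rule summable_comparison_test'[OF summ, of 0]) (use le_norm in auto)
  have E3: "expectation (\<lambda>x. exp (\<mu> * X x)) = (\<Sum>m. expectation (f (m + 3))) + (\<Sum>m<3. expectation (f m))"
    unfolding E by (rule suminf_split_initial_segment[OF summE])
  have first: "(\<Sum>m<3. expectation (f m)) = 1 + \<mu>\<^sup>2 / 2 * expectation (\<lambda>x. (X x)\<^sup>2)"
  proof -
    have "f 0 = (\<lambda>x. 1)" "f 1 = (\<lambda>x. \<mu> * X x)" "f 2 = (\<lambda>x. \<mu>\<^sup>2 / 2 * (X x)\<^sup>2)"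
      by (simp_all add: f_def fun_eq_iff power_mult_distrib)
    then have "expectation (f 0) = 1" "expectation (f 1) = 0" "expectation (f 2) = \<mu>\<^sup>2 / 2 * expectation (\<lambda>x. (X x)\<^sup>2)"
      using c by (simp_all add: prob_space)
    then show ?thesis by (simp add: numeral_3_eq_3 numeral_2_eq_2)
  qed
  have "\<bar>\<Sum>m. expectation (f (m + 3))\<bar> \<le> (\<Sum>m. B * q ^ (m + 3))"
  proof -
    have s: "summable (\<lambda>m. B * q ^ (m + 3))" using summable_ignore_initial_segment[OF geo] .
    have "norm (expectation (f (m + 3))) \<le> B * q ^ (m + 3)" for m
      unfolding real_norm_def by (rule order.trans[OF le_norm tail]) simp
    then show ?thesis using norm_suminf_le[OF _ s] by (metis real_norm_def)
  qed
  also have "(\<Sum>m. B * q ^ (m + 3)) = B * q ^ 3 * (1 / (1 - q))"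
  proof -
    have "(\<Sum>m. B * q ^ (m + 3)) = (\<Sum>m. B * q ^ 3 * q ^ m)" by (simp add: power_add mult_ac)
    also have "\<dots> = B * q ^ 3 * (\<Sum>m. q ^ m)" using q by (intro suminf_mult summable_geometric) auto
    also have "(\<Sum>m. q ^ m) = 1 / (1 - q)" using q by (intro suminf_geometric) auto
    finally show ?thesis .
  qed
  also have "\<dots> \<le> B * q ^ 3 * 2"
    using q B by (intro mult_left_mono) (auto simp: field_simps)
  finally show "\<bar>expectation (\<lambda>x. exp (\<mu> * X x)) - 1 - \<mu>\<^sup>2 / 2 * expectation (\<lambda>x. (X x)\<^sup>2)\<bar> \<le> 2 * B * (\<bar>\<mu>\<bar> * A) ^ 3"
    using E3 first by (simp add: q_def)
qed

lemma expectation_square_le: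
  fixes Y :: "'a \<Rightarrow> real"
  assumes "integrable M Y" "integrable M (\<lambda>x. (Y x)\<^sup>2)"
  shows "(expectation Y)\<^sup>2 \<le> expectation (\<lambda>x. (Y x)\<^sup>2)"
  using variance_eq[OF assms] variance_positive[of Y] by simp

text \<open>Jensen's inequality for the square of \<open>X\<close>. It serves twice: in the
  expansion of the logarithm and to show that single summands have a negligible share of the
  variance.\<close>

lemma expectation_power4_bound:
  fixes X :: "'a \<Rightarrow> real"
  assumes int2: "integrable M (\<lambda>x. (X x)\<^sup>2)"
    and mom: "integrable M (\<lambda>x. \<bar>X x\<bar> ^ 4)" "expectation (\<lambda>x. \<bar>X x\<bar> ^ 4) \<le> K"
  shows "(expectation (\<lambda>x. (X x)\<^sup>2))\<^sup>2 \<le> K"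
proof -
  have eq: "\<bar>X x\<bar> ^ 4 = ((X x)\<^sup>2)\<^sup>2" for x by (simp add: power_even_abs flip: power_mult)
  show ?thesis
    using expectation_square_le[OF int2] mom unfolding eq by simp
qed

text \<open>Here \<open>\<mu>\<^sup>2 * expectation (\<lambda>x. (X x)\<^sup>2)\<close> may be large for a single summand; the fourth moment
  controls its square, which is all that the expansion of the logarithm requires.\<close>

lemma mgf_lower:
  fixes X :: "'a \<Rightarrow> real"
  assumes rv[measurable]: "random_variable borel X" and int2: "integrable M (\<lambda>x. (X x)\<^sup>2)"
    and c: "expectation X = 0" and A: "0 \<le> A" and B: "0 \<le> B"
    and mom: "\<And>m. m \<ge> 3 \<Longrightarrow> integrable M (\<lambda>x. \<bar>X x\<bar> ^ m) \<and>
       expectation (\<lambda>x. \<bar>X x\<bar> ^ m) \<le> fact m * A ^ m * B"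
    and lam: "\<bar>\<mu>\<bar> * A \<le> 1/2"
  shows "exp (\<mu>\<^sup>2 / 2 * expectation (\<lambda>x. (X x)\<^sup>2) - 2 * B * (\<bar>\<mu>\<bar> * A) ^ 3 - 6 * B * (\<bar>\<mu>\<bar> * A) ^ 4)
      \<le> expectation (\<lambda>x. exp (\<mu> * X x))"
proof -
  note T = mgf_taylor[OF assms]
  define \<sigma> where "\<sigma> = expectation (\<lambda>x. (X x)\<^sup>2)"
  have \<sigma>0: "0 \<le> \<sigma>" by (simp add: \<sigma>_def)
  have "\<sigma>\<^sup>2 \<le> fact 4 * A ^ 4 * B"
    unfolding \<sigma>_def using mom[of 4] by (intro expectation_power4_bound int2) auto
  then have \<sigma>4: "\<sigma>\<^sup>2 \<le> 24 * A ^ 4 * B" by (simp add: fact_numeral)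
  \<comment> \<open>A lower bound for the transform minus 1. It may be negative; then the bound 1
    that follows from centring takes over.\<close>
  define w where "w = \<mu>\<^sup>2 / 2 * \<sigma> - 2 * B * (\<bar>\<mu>\<bar> * A) ^ 3"
  have ge1: "1 \<le> expectation (\<lambda>x. exp (\<mu> * X x))"
  proof -
    have "1 = expectation (\<lambda>x. 1 + \<mu> * X x)"
      using c square_integrable_imp_integrable[OF rv int2] by (simp add: prob_space)
    also have "\<dots> \<le> expectation (\<lambda>x. exp (\<mu> * X x))"
      using T(1) square_integrable_imp_integrable[OF rv int2] by (intro integral_mono) (auto simp: exp_ge_add_one_self)
    finally show ?thesis .
  qed
  have ge: "1 + w \<le> expectation (\<lambda>x. exp (\<mu> * X x))" using T(2) unfolding w_def \<sigma>_def by linarith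
  \<comment> \<open>The constant 6 is \<open>fact 4 / 4\<close>, the 4 coming from squaring
    \<open>\<mu>\<^sup>2 / 2\<close>.\<close>
  have w_sq: "w\<^sup>2 \<le> 6 * B * (\<bar>\<mu>\<bar> * A) ^ 4" if "0 \<le> w"
  proof -
    have "w \<le> \<mu>\<^sup>2 / 2 * \<sigma>" using A B by (simp add: w_def)
    then have "w\<^sup>2 \<le> (\<mu>\<^sup>2 / 2 * \<sigma>)\<^sup>2" using that by (rule power_mono)
    also have "\<dots> = \<mu> ^ 4 / 4 * \<sigma>\<^sup>2" by (simp add: power_mult_distrib power_divide flip: power_mult)
    also have "\<dots> \<le> \<mu> ^ 4 / 4 * (24 * A ^ 4 * B)" using \<sigma>4 by (intro mult_left_mono) auto
    also have "\<dots> = 6 * B * (\<bar>\<mu>\<bar> * A) ^ 4" by (simp add: power_mult_distrib power_even_abs)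
    finally show ?thesis .
  qed
  have "exp (w - 6 * B * (\<bar>\<mu>\<bar> * A) ^ 4) \<le> expectation (\<lambda>x. exp (\<mu> * X x))"
  proof (cases "0 \<le> w")
    case True
    have "exp (w - 6 * B * (\<bar>\<mu>\<bar> * A) ^ 4) \<le> exp (w - w\<^sup>2)" using w_sq[OF True] by simp
    also have "\<dots> \<le> 1 + w" by (rule exp_minus_square_le[OF True])
    finally show ?thesis using ge by simp
  next
    case False
    have "0 \<le> 6 * B * (\<bar>\<mu>\<bar> * A) ^ 4" using A B by simp
    then have "exp (w - 6 * B * (\<bar>\<mu>\<bar> * A) ^ 4) \<le> 1" using False unfolding exp_le_one_iff by linarith
    then show ?thesis using ge1 by linarith
  qed
  then show ?thesis by (simp add: w_def \<sigma>_def)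
qed

lemma mgf_upper:
  fixes X :: "'a \<Rightarrow> real"
  assumes rv[measurable]: "random_variable borel X" and int2: "integrable M (\<lambda>x. (X x)\<^sup>2)"
    and c: "expectation X = 0" and A: "0 \<le> A" and B: "0 \<le> B"
    and mom: "\<And>m. m \<ge> 3 \<Longrightarrow> integrable M (\<lambda>x. \<bar>X x\<bar> ^ m) \<and>
       expectation (\<lambda>x. \<bar>X x\<bar> ^ m) \<le> fact m * A ^ m * B"
    and lam: "\<bar>\<mu>\<bar> * A \<le> 1/2"
  shows "expectation (\<lambda>x. exp (\<mu> * X x)) \<le> exp (\<mu>\<^sup>2 / 2 * expectation (\<lambda>x. (X x)\<^sup>2) + 2 * B * (\<bar>\<mu>\<bar> * A) ^ 3)"
proof -
  have "expectation (\<lambda>x. exp (\<mu> * X x)) \<le> 1 + (\<mu>\<^sup>2 / 2 * expectation (\<lambda>x. (X x)\<^sup>2) + 2 * B * (\<bar>\<mu>\<bar> * A) ^ 3)"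
    using mgf_taylor(2)[OF assms] by linarith
  also have "\<dots> \<le> exp (\<mu>\<^sup>2 / 2 * expectation (\<lambda>x. (X x)\<^sup>2) + 2 * B * (\<bar>\<mu>\<bar> * A) ^ 3)"
    by (rule exp_ge_add_one_self)
  finally show ?thesis .
qed

section \<open>Independent blocks and a maximal inequality\<close>

lemma mgf_sum_indep:
  fixes X :: "'i \<Rightarrow> 'a \<Rightarrow> real"
  assumes indep: "indep_vars (\<lambda>_. borel) X I" and J: "J \<subseteq> I" "finite J"
    and int: "\<And>j. j \<in> J \<Longrightarrow> integrable M (\<lambda>x. exp (t j * X j x))"
  shows "integrable M (\<lambda>x. exp (\<Sum>j\<in>J. t j * X j x))"
    and "expectation (\<lambda>x. exp (\<Sum>j\<in>J. t j * X j x)) = (\<Prod>j\<in>J. expectation (\<lambda>x. exp (t j * X j x)))"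
proof -
  have ind: "indep_vars (\<lambda>_. borel) (\<lambda>j x. exp (t j * X j x)) J"
    by (rule indep_vars_compose2[OF indep_vars_subset[OF indep J(1)]]) measurable
  have eq: "exp (\<Sum>j\<in>J. t j * X j x) = (\<Prod>j\<in>J. exp (t j * X j x))" for x
    using J(2) by (rule exp_sum)
  show "integrable M (\<lambda>x. exp (\<Sum>j\<in>J. t j * X j x))"
    unfolding eq by (rule indep_vars_integrable[OF J(2) ind int])
  show "expectation (\<lambda>x. exp (\<Sum>j\<in>J. t j * X j x)) = (\<Prod>j\<in>J. expectation (\<lambda>x. exp (t j * X j x)))"
    unfolding eq by (rule indep_vars_lebesgue_integral[OF J(2) ind int])
qed

lemma indep_vars_block_sums:
  fixes X :: "nat \<Rightarrow> 'a \<Rightarrow> real"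
  assumes indep: "indep_vars (\<lambda>_. borel) X {1..k}" and l: "\<And>i j. i \<le> j \<Longrightarrow> j \<le> m \<Longrightarrow> l i \<le> l j" "l m \<le> k"
  shows "indep_vars (\<lambda>_. borel) (\<lambda>i x. \<Sum>h\<in>{l i<..l (Suc i)}. X h x) {..<m}"
proof -
  have "indep_vars (\<lambda>i. PiM {l i<..l (Suc i)} (\<lambda>_. borel)) (\<lambda>i \<omega>. restrict (\<lambda>h. X h \<omega>) {l i<..l (Suc i)}) {..<m}"
  proof (rule indep_vars_restrict[OF indep])
    show "{l i<..l (Suc i)} \<subseteq> {1..k}" if "i \<in> {..<m}" for i
      using l(1)[of "Suc i" m] l(2) that by auto
    show "disjoint_family_on (\<lambda>i. {l i<..l (Suc i)}) {..<m}"
      unfolding disjoint_family_on_def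
    proof (intro ballI impI)
      fix i j assume ij: "i \<in> {..<m}" "j \<in> {..<m}" "i \<noteq> j"
      then have "Suc i \<le> j \<or> Suc j \<le> i" by linarith
      then have "l (Suc i) \<le> l j \<or> l (Suc j) \<le> l i" using l(1) ij by auto
      then show "{l i<..l (Suc i)} \<inter> {l j<..l (Suc j)} = {}" by auto
    qed
  qed
  then have "indep_vars (\<lambda>_. borel) (\<lambda>i x. (\<lambda>w. \<Sum>h\<in>{l i<..l (Suc i)}. w h) (restrict (\<lambda>h. X h x) {l i<..l (Suc i)})) {..<m}"
    by (rule indep_vars_compose2) (auto intro!: borel_measurable_sum)
  then show ?thesis by simp
qed

text \<open>Stop at the first \<open>j\<close> with partial sum above \<open>2 * x\<close>. The
  remaining sum is independent of this event and stays within \<open>x\<close> with probability at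
  least 1/2, in which case the full sum still exceeds \<open>x\<close>.\<close>

lemma Ottaviani:
  fixes X :: "nat \<Rightarrow> 'a \<Rightarrow> real"
  assumes indep: "indep_vars (\<lambda>_. borel) X {1..k}" and lr: "l \<le> r" "r \<le> k"
    and half: "\<And>j. j \<in> {l..r} \<Longrightarrow> \<P>(\<omega> in M. x < \<bar>\<Sum>h\<in>{j<..r}. X h \<omega>\<bar>) \<le> 1/2"
  shows "\<P>(\<omega> in M. \<exists>j\<in>{l..r}. 2 * x < \<bar>\<Sum>h\<in>{l<..j}. X h \<omega>\<bar>) \<le> 2 * \<P>(\<omega> in M. x < \<bar>\<Sum>h\<in>{l<..r}. X h \<omega>\<bar>)"
proof -
  have rv: "random_variable borel (X h)" if "h \<in> {1..k}" for h
    using indep that by (auto simp: indep_vars_def)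
  have sm: "(\<lambda>\<omega>. \<Sum>h\<in>{i<..j}. X h \<omega>) \<in> borel_measurable M" if "j \<le> k" for i j
    using that by (intro borel_measurable_sum rv) auto
  define S where "S j \<omega> = (\<Sum>h\<in>{l<..j}. X h \<omega>)" for j \<omega>
  define T where "T j \<omega> = (\<Sum>h\<in>{j<..r}. X h \<omega>)" for j \<omega>
  have ST: "S r \<omega> = S j \<omega> + T j \<omega>" if "j \<in> {l..r}" for j \<omega>
  proof -
    have "{l<..r} = {l<..j} \<union> {j<..r}" using that by auto
    then show ?thesis unfolding S_def T_def by (simp add: sum.union_disjoint)
  qed
  \<comment> \<open>First passage at \<open>j\<close>: these events are disjoint and depend only on
    summands up to \<open>j\<close>, whereas \<open>B j\<close> depends only on later ones.\<close>
  define A where "A j = {\<omega>\<in>space M. 2 * x < \<bar>S j \<omega>\<bar> \<and> (\<forall>i\<in>{l..<j}. \<bar>S i \<omega>\<bar> \<le> 2 * x)}" for j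
  define B where "B j = {\<omega>\<in>space M. \<bar>T j \<omega>\<bar> \<le> x}" for j
  have AB: "A j \<in> events" "B j \<in> events" "prob (A j \<inter> B j) = prob (A j) * prob (B j)" if j: "j \<in> {l..r}" for j
  proof -
    let ?P = "PiM {l<..j} (\<lambda>_. borel :: real measure)" and ?Q = "PiM {j<..r} (\<lambda>_. borel :: real measure)"
    let ?U = "\<lambda>\<omega>. restrict (\<lambda>i. X i \<omega>) {l<..j}" and ?V = "\<lambda>\<omega>. restrict (\<lambda>i. X i \<omega>) {j<..r}"
    have iv: "indep_var ?P ?U ?Q ?V"
      by (rule indep_var_restrict[OF indep]) (use j lr in auto)
    have mU: "?U \<in> measurable M ?P" and mV: "?V \<in> measurable M ?Q"
      using iv by (auto dest: indep_var_rv1 indep_var_rv2)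
    \<comment> \<open>The same events as sets of coordinate vectors, the form in which independence
      of two disjoint groups of variables is available.\<close>
    define A' where "A' = {w\<in>space ?P. 2 * x < \<bar>\<Sum>h\<in>{l<..j}. w h\<bar> \<and> (\<forall>i\<in>{l..<j}. \<bar>\<Sum>h\<in>{l<..i}. w h\<bar> \<le> 2 * x)}"
    define B' where "B' = {w\<in>space ?Q. \<bar>\<Sum>h\<in>{j<..r}. w h\<bar> \<le> x}"
    have pm: "(\<lambda>w. \<Sum>h\<in>{l<..i}. w h) \<in> borel_measurable ?P" if "i \<le> j" for i
      using that by (intro borel_measurable_sum measurable_component_singleton) auto
    have qm: "(\<lambda>w. \<Sum>h\<in>{j<..r}. w h) \<in> borel_measurable ?Q"
      by (intro borel_measurable_sum measurable_component_singleton) auto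
    have A'm: "A' \<in> sets ?P"
      unfolding A'_def
      by (intro sets.sets_Collect_conj sets.sets_Collect_finite_All borel_measurable_less borel_measurable_le
           borel_measurable_abs pm borel_measurable_const) auto
    have B'm: "B' \<in> sets ?Q"
      unfolding B'_def by (intro borel_measurable_le borel_measurable_abs qm borel_measurable_const)
    have Aeq: "A j = ?U -` A' \<inter> space M"
    proof -
      have "(\<Sum>h\<in>{l<..i}. ?U \<omega> h) = S i \<omega>" if "i \<le> j" for i \<omega>
        unfolding S_def using that by (intro sum.cong) auto
      then show ?thesis using mU by (auto simp: A_def A'_def space_PiM)
    qed
    have Beq: "B j = ?V -` B' \<inter> space M"
      using mV by (auto simp: B_def B'_def T_def space_PiM)
    show "A j \<in> events" unfolding Aeq by (rule measurable_sets[OF mU A'm])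
    show "B j \<in> events" unfolding Beq by (rule measurable_sets[OF mV B'm])
    have "A j \<inter> B j = (\<lambda>\<omega>. (?U \<omega>, ?V \<omega>)) -` (A' \<times> B') \<inter> space M"
      unfolding Aeq Beq by auto
    then show "prob (A j \<inter> B j) = prob (A j) * prob (B j)"
      unfolding Aeq Beq using indep_varD[OF iv A'm B'm] by simp
  qed
  have halfB: "1/2 \<le> prob (B j)" if j: "j \<in> {l..r}" for j
  proof -
    have m: "{\<omega>\<in>space M. x < \<bar>T j \<omega>\<bar>} \<in> events"
      unfolding T_def using sm[OF lr(2)] by measurable
    have "B j = space M - {\<omega>\<in>space M. x < \<bar>T j \<omega>\<bar>}" by (auto simp: B_def)
    then have "prob (B j) = 1 - \<P>(\<omega> in M. x < \<bar>T j \<omega>\<bar>)" using prob_compl[OF m] by simp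
    then show ?thesis using half[OF j] by (simp add: T_def)
  qed
  have djA: "disjoint_family_on A {l..r}"
    unfolding disjoint_family_on_def
  proof (intro ballI impI)
    fix i j assume "i \<in> {l..r}" "j \<in> {l..r}" "i \<noteq> j"
    then have "(i < j \<and> i \<in> {l..<j}) \<or> (j < i \<and> j \<in> {l..<i})" by auto
    then show "A i \<inter> A j = {}" by (force simp: A_def)
  qed
  have un: "{\<omega>\<in>space M. \<exists>j\<in>{l..r}. 2 * x < \<bar>S j \<omega>\<bar>} \<subseteq> (\<Union>j\<in>{l..r}. A j)"
  proof
    fix \<omega> assume w: "\<omega> \<in> {\<omega>\<in>space M. \<exists>j\<in>{l..r}. 2 * x < \<bar>S j \<omega>\<bar>}"
    define j where "j = (LEAST j. j \<in> {l..r} \<and> 2 * x < \<bar>S j \<omega>\<bar>)"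
    have j: "j \<in> {l..r} \<and> 2 * x < \<bar>S j \<omega>\<bar>"
      unfolding j_def by (rule LeastI_ex) (use w in auto)
    have "\<bar>S i \<omega>\<bar> \<le> 2 * x" if "i \<in> {l..<j}" for i
    proof (rule ccontr)
      assume "\<not> \<bar>S i \<omega>\<bar> \<le> 2 * x"
      then have "j \<le> i" unfolding j_def using that j by (intro Least_le) auto
      then show False using that by simp
    qed
    then show "\<omega> \<in> (\<Union>j\<in>{l..r}. A j)" using j w by (auto simp: A_def)
  qed
  have "\<P>(\<omega> in M. \<exists>j\<in>{l..r}. 2 * x < \<bar>S j \<omega>\<bar>) \<le> prob (\<Union>j\<in>{l..r}. A j)"
    using un AB(1) by (intro finite_measure_mono sets.finite_UN) auto
  also have "\<dots> = (\<Sum>j\<in>{l..r}. prob (A j))"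
    using AB(1) djA by (intro finite_measure_finite_Union) auto
  also have "\<dots> \<le> (\<Sum>j\<in>{l..r}. 2 * prob (A j \<inter> B j))"
  proof (rule sum_mono)
    fix j assume j: "j \<in> {l..r}"
    have "prob (A j) * (1/2) \<le> prob (A j) * prob (B j)" using halfB[OF j] by (intro mult_left_mono) auto
    then show "prob (A j) \<le> 2 * prob (A j \<inter> B j)" using AB(3)[OF j] by simp
  qed
  also have "\<dots> = 2 * prob (\<Union>j\<in>{l..r}. A j \<inter> B j)"
  proof -
    have "disjoint_family_on (\<lambda>j. A j \<inter> B j) {l..r}" using djA unfolding disjoint_family_on_def by blast
    then have "prob (\<Union>j\<in>{l..r}. A j \<inter> B j) = (\<Sum>j\<in>{l..r}. prob (A j \<inter> B j))"
      using AB(1,2) by (intro finite_measure_finite_Union) auto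
    then show ?thesis by (simp add: sum_distrib_left)
  qed
  also have "prob (\<Union>j\<in>{l..r}. A j \<inter> B j) \<le> \<P>(\<omega> in M. x < \<bar>S r \<omega>\<bar>)"
  proof (rule finite_measure_mono)
    show "(\<Union>j\<in>{l..r}. A j \<inter> B j) \<subseteq> {\<omega>\<in>space M. x < \<bar>S r \<omega>\<bar>}"
    proof (rule UN_least, rule subsetI)
      fix j \<omega> assume j: "j \<in> {l..r}" "\<omega> \<in> A j \<inter> B j"
      then show "\<omega> \<in> {\<omega>\<in>space M. x < \<bar>S r \<omega>\<bar>}"
        using ST[OF j(1), of \<omega>] by (auto simp: A_def B_def)
    qed
    show "{\<omega>\<in>space M. x < \<bar>S r \<omega>\<bar>} \<in> events"
      unfolding S_def using sm[OF lr(2)] by measurable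
  qed
  finally show ?thesis by (simp add: S_def)
qed

section \<open>Exponential bounds from Laplace transforms\<close>

lemma Chernoff_scaled:
  fixes Z :: "'a \<Rightarrow> real"
  assumes a: "a > 0" and int: "integrable M (\<lambda>x. exp (Z x / a))" and E: "expectation (\<lambda>x. exp (Z x / a)) \<le> exp (K / a)"
  shows "\<P>(x in M. y \<le> Z x) \<le> exp (- (y - K) / a)"
proof -
  have "\<P>(x in M. y \<le> Z x) = \<P>(x in M. exp (y / a) \<le> exp (Z x / a))"
    using a by (simp add: divide_le_cancel)
  also have "\<dots> \<le> expectation (\<lambda>x. exp (Z x / a)) / exp (y / a)"
    by (rule integral_Markov_inequality_measure[OF int, of "{}"]) auto
  also have "\<dots> \<le> exp (K / a) / exp (y / a)"
    using E by (intro divide_right_mono) auto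
  also have "\<dots> = exp (- (y - K) / a)" by (simp add: exp_diff[symmetric] diff_divide_distrib[symmetric])
  finally show ?thesis .
qed

text \<open>Exponential tilting: \<open>\<theta> = x / v\<close> moves the mean of \<open>Z\<close> to \<open>x\<close>, and the two tails that are
  cut off are controlled by the moments at \<open>\<theta> \<plusminus> \<delta> / v\<close>.\<close>

lemma tilting_bound:
  fixes Z :: "'a \<Rightarrow> real"
  assumes a: "a > 0" and v: "v > 0" and \<delta>: "\<delta> > 0" and Z[measurable]: "Z \<in> borel_measurable M"
    and \<theta>: "\<theta> = x / v" and h: "h = \<delta> / v"
    and int: "integrable M (\<lambda>\<omega>. exp (\<theta> * Z \<omega> / a))" "integrable M (\<lambda>\<omega>. exp ((\<theta> + h) * Z \<omega> / a))"
       "integrable M (\<lambda>\<omega>. exp ((\<theta> - h) * Z \<omega> / a))"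
    and lo: "exp ((\<theta>\<^sup>2 * v / 2 - \<rho>) / a) \<le> expectation (\<lambda>\<omega>. exp (\<theta> * Z \<omega> / a))"
    and up: "expectation (\<lambda>\<omega>. exp ((\<theta> + h) * Z \<omega> / a)) \<le> exp (((\<theta> + h)\<^sup>2 * v / 2 + \<rho>) / a)"
       "expectation (\<lambda>\<omega>. exp ((\<theta> - h) * Z \<omega> / a)) \<le> exp (((\<theta> - h)\<^sup>2 * v / 2 + \<rho>) / a)"
  shows "exp ((\<theta>\<^sup>2 * v / 2 - \<rho>) / a) \<le> exp ((\<theta> * x + \<bar>\<theta>\<bar> * \<delta>) / a) * \<P>(\<omega> in M. \<bar>Z \<omega> - x\<bar> < \<delta>)
      + 2 * exp ((\<theta>\<^sup>2 * v / 2 - \<delta>\<^sup>2 / (2 * v) + \<rho>) / a)"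
proof -
  have h0: "h > 0" using h v \<delta> by simp
  let ?S = "{\<omega>\<in>space M. \<bar>Z \<omega> - x\<bar> < \<delta>}"
  \<comment> \<open>Outside the window one of the additional factors
    \<open>exp (h * (Z \<omega> - (x + \<delta>)) / a)\<close> and
    \<open>exp (h * ((x - \<delta>) - Z \<omega>) / a)\<close> is at least 1, so each tail is
    dominated by a transform at a shifted parameter.\<close>
  have pw: "exp (\<theta> * Z \<omega> / a) \<le> exp ((\<theta> * x + \<bar>\<theta>\<bar> * \<delta>) / a) * indicator ?S \<omega>
      + exp (- h * (x + \<delta>) / a) * exp ((\<theta> + h) * Z \<omega> / a) + exp (h * (x - \<delta>) / a) * exp ((\<theta> - h) * Z \<omega> / a)"
    (is "?l \<le> ?a + ?b + ?c") if "\<omega> \<in> space M" for \<omega>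
  proof -
    have pos: "0 \<le> ?a" "0 \<le> ?b" "0 \<le> ?c" by (auto simp: indicator_def)
    consider "\<bar>Z \<omega> - x\<bar> < \<delta>" | "x + \<delta> \<le> Z \<omega>" | "Z \<omega> \<le> x - \<delta>" by linarith
    then show ?thesis
    proof cases
      case 1
      have "\<theta> * (Z \<omega> - x) \<le> \<bar>\<theta>\<bar> * \<bar>Z \<omega> - x\<bar>" using abs_ge_self[of "\<theta> * (Z \<omega> - x)"] by (simp add: abs_mult)
      also have "\<dots> \<le> \<bar>\<theta>\<bar> * \<delta>" using 1 by (intro mult_left_mono) auto
      finally have "\<theta> * Z \<omega> \<le> \<theta> * x + \<bar>\<theta>\<bar> * \<delta>" by (simp add: right_diff_distrib)
      then have "?l \<le> ?a" using a that 1 by (simp add: divide_right_mono)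
      then show ?thesis using pos by linarith
    next
      case 2
      have "?b = exp ((\<theta> * Z \<omega> + h * (Z \<omega> - (x + \<delta>))) / a)"
        unfolding exp_add[symmetric] add_divide_distrib[symmetric] by (simp add: algebra_simps)
      moreover have "0 \<le> h * (Z \<omega> - (x + \<delta>))" using h0 2 by simp
      ultimately have "?l \<le> ?b" using a by (simp add: divide_right_mono)
      then show ?thesis using pos by linarith
    next
      case 3
      have "?c = exp ((\<theta> * Z \<omega> + h * ((x - \<delta>) - Z \<omega>)) / a)"
        unfolding exp_add[symmetric] add_divide_distrib[symmetric] by (simp add: algebra_simps)
      moreover have "0 \<le> h * ((x - \<delta>) - Z \<omega>)" using h0 3 by simp
      ultimately have "?l \<le> ?c" using a by (simp add: divide_right_mono)
      then show ?thesis using pos by linarith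
    qed
  qed
  have S: "?S \<in> events" by measurable
  have iS: "integrable M (indicator ?S :: 'a \<Rightarrow> real)"
    using S by (intro integrable_real_indicator) (simp_all add: less_top[symmetric])
  have i1: "integrable M (\<lambda>\<omega>. exp ((\<theta> * x + \<bar>\<theta>\<bar> * \<delta>) / a) * indicator ?S \<omega>)"
    and i2: "integrable M (\<lambda>\<omega>. exp (- h * (x + \<delta>) / a) * exp ((\<theta> + h) * Z \<omega> / a))"
    and i3: "integrable M (\<lambda>\<omega>. exp (h * (x - \<delta>) / a) * exp ((\<theta> - h) * Z \<omega> / a))"
    by (intro integrable_mult_right iS int)+
  have "exp ((\<theta>\<^sup>2 * v / 2 - \<rho>) / a) \<le> expectation (\<lambda>\<omega>. exp (\<theta> * Z \<omega> / a))" by (rule lo)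
  also have "\<dots> \<le> expectation (\<lambda>\<omega>. exp ((\<theta> * x + \<bar>\<theta>\<bar> * \<delta>) / a) * indicator ?S \<omega>
      + exp (- h * (x + \<delta>) / a) * exp ((\<theta> + h) * Z \<omega> / a) + exp (h * (x - \<delta>) / a) * exp ((\<theta> - h) * Z \<omega> / a))"
    by (intro integral_mono Bochner_Integration.integrable_add integrable_mult_right int iS pw)
  also have "\<dots> = exp ((\<theta> * x + \<bar>\<theta>\<bar> * \<delta>) / a) * prob ?S
      + exp (- h * (x + \<delta>) / a) * expectation (\<lambda>\<omega>. exp ((\<theta> + h) * Z \<omega> / a))
      + exp (h * (x - \<delta>) / a) * expectation (\<lambda>\<omega>. exp ((\<theta> - h) * Z \<omega> / a))"
    unfolding Bochner_Integration.integral_add[OF Bochner_Integration.integrable_add[OF i1 i2] i3]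
      Bochner_Integration.integral_add[OF i1 i2] using S by simp
  also have "exp (- h * (x + \<delta>) / a) * expectation (\<lambda>\<omega>. exp ((\<theta> + h) * Z \<omega> / a))
      \<le> exp (- h * (x + \<delta>) / a) * exp (((\<theta> + h)\<^sup>2 * v / 2 + \<rho>) / a)"
    using up(1) by (intro mult_left_mono) auto
  also have "\<dots> = exp ((\<theta>\<^sup>2 * v / 2 - \<delta>\<^sup>2 / (2 * v) + \<rho>) / a)"
  proof -
    \<comment> \<open>Completing the square with \<open>x = \<theta> * v\<close> and
      \<open>\<delta> = h * v\<close>: each tail loses exactly
      \<open>\<delta>\<^sup>2 / (2 * v)\<close> against the main term.\<close>
    have "- h * (x + \<delta>) + ((\<theta> + h)\<^sup>2 * v / 2 + \<rho>) = \<theta>\<^sup>2 * v / 2 - \<delta>\<^sup>2 / (2 * v) + \<rho>"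
      unfolding \<theta> h using v by (simp add: power2_eq_square field_simps)
    then show ?thesis unfolding exp_add[symmetric] add_divide_distrib[symmetric] by simp
  qed
  also have "exp (h * (x - \<delta>) / a) * expectation (\<lambda>\<omega>. exp ((\<theta> - h) * Z \<omega> / a))
      \<le> exp (h * (x - \<delta>) / a) * exp (((\<theta> - h)\<^sup>2 * v / 2 + \<rho>) / a)"
    using up(2) by (intro mult_left_mono) auto
  also have "\<dots> = exp ((\<theta>\<^sup>2 * v / 2 - \<delta>\<^sup>2 / (2 * v) + \<rho>) / a)"
  proof -
    have "h * (x - \<delta>) + ((\<theta> - h)\<^sup>2 * v / 2 + \<rho>) = \<theta>\<^sup>2 * v / 2 - \<delta>\<^sup>2 / (2 * v) + \<rho>"
      unfolding \<theta> h using v by (simp add: power2_eq_square field_simps)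
    then show ?thesis unfolding exp_add[symmetric] add_divide_distrib[symmetric] by simp
  qed
  finally show ?thesis by simp
qed

end

section \<open>Separation, direction nets, logarithms and measurability\<close>

lemma compact_closed_separated:
  fixes K F :: "'a::metric_space set"
  assumes "compact K" "closed F" "K \<inter> F = {}"
  shows "\<exists>\<delta>>0. \<forall>x\<in>K. \<forall>y\<in>F. \<delta> \<le> dist x y"
proof (cases "K = {} \<or> F = {}")
  case True
  then show ?thesis by (intro exI[of _ 1]) auto
next
  case False
  have "continuous_on K (\<lambda>x. infdist x F)" by (intro continuous_on_infdist continuous_on_id)
  then obtain x0 where x0: "x0 \<in> K" "\<And>x. x \<in> K \<Longrightarrow> infdist x0 F \<le> infdist x F"
    using continuous_attains_inf[OF assms(1)] False by blast
  have "infdist x0 F \<noteq> 0"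
    using in_closed_iff_infdist_zero[OF assms(2)] False x0 assms(3) by blast
  then have "infdist x0 F > 0" using infdist_nonneg[of x0 F] by linarith
  then show ?thesis using x0(2) infdist_le order_trans by (intro exI[of _ "infdist x0 F"]) blast
qed

text \<open>Rounding the coordinates of a unit vector to a fine lattice leaves finitely many
  directions that almost realise the norm. The rounded vectors need not be unit vectors, hence the
  slack in the second claim.\<close>

lemma finite_direction_net:
  fixes \<delta> :: real
  assumes m: "m > 0" and \<delta>: "0 < \<delta>" "\<delta> \<le> 1"
  obtains G :: "(nat \<Rightarrow> real) set" where "finite G"
    "\<And>u. u \<in> G \<Longrightarrow> (\<Sum>i<m. (u i)\<^sup>2) \<le> 1 + \<delta>"
    "\<And>x r. r > 0 \<Longrightarrow> (\<Sum>i<m. (x i)\<^sup>2) = r\<^sup>2 \<Longrightarrow> \<exists>u\<in>G. (1 - \<delta>) * r \<le> (\<Sum>i<m. u i * x i)"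
proof -
  \<comment> \<open>Rounding changes the square of a coordinate by at most
    \<open>2 * d + d\<^sup>2\<close>, which is at most \<open>3 * d\<close>; over \<open>m\<close>
    coordinates this is \<open>\<delta>\<close>.\<close>
  define d where "d = \<delta> / (3 * m)"
  have d: "d > 0" "3 * (m * d) = \<delta>" using m \<delta> by (auto simp: d_def)
  have d1: "d \<le> 1"
  proof -
    have "1 * d \<le> real m * d" using m d by (intro mult_right_mono) auto
    then show ?thesis using d \<delta> by linarith
  qed
  define N where "N = \<lceil>1 / d\<rceil> + 1"
  define G where "G = {u \<in> {..<m} \<rightarrow>\<^sub>E (\<lambda>j. d * of_int j) ` {-N..N}. (\<Sum>i<m. (u i)\<^sup>2) \<le> 1 + \<delta>}"
  show ?thesis
  proof (rule that[of G])
    show "finite G" unfolding G_def by (rule finite_subset[OF _ finite_PiE[of "{..<m}" "\<lambda>_. (\<lambda>j. d * of_int j) ` {-N..N}"]]) auto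
    show "(\<Sum>i<m. (u i)\<^sup>2) \<le> 1 + \<delta>" if "u \<in> G" for u using that by (simp add: G_def)
    fix x :: "nat \<Rightarrow> real" and r :: real
    assume r: "r > 0" and x: "(\<Sum>i<m. (x i)\<^sup>2) = r\<^sup>2"
    define y where "y i = x i / r" for i
    have y: "(\<Sum>i<m. (y i)\<^sup>2) = 1"
      using x r by (simp add: y_def power_divide sum_divide_distrib[symmetric])
    have y1: "\<bar>y i\<bar> \<le> 1" if "i < m" for i
    proof -
      have "(y i)\<^sup>2 \<le> (\<Sum>i<m. (y i)\<^sup>2)" using that by (intro member_le_sum) auto
      then show ?thesis using y by (simp add: abs_square_le_1)
    qed
    \<comment> \<open>The restriction makes the vector extensional on the first \<open>m\<close>
      indices, so it belongs to a finite product set.\<close>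
    define u where "u = restrict (\<lambda>i. d * of_int \<lfloor>y i / d\<rfloor>) {..<m}"
    have uy: "\<bar>u i - y i\<bar> \<le> d" if "i < m" for i
    proof -
      have "of_int \<lfloor>y i / d\<rfloor> \<le> y i / d" "y i / d < of_int \<lfloor>y i / d\<rfloor> + 1" by linarith+
      then have "d * of_int \<lfloor>y i / d\<rfloor> \<le> d * (y i / d)" "d * (y i / d) < d * (of_int \<lfloor>y i / d\<rfloor> + 1)"
        using d(1) by (auto intro: mult_left_mono mult_strict_left_mono simp del: times_divide_eq_right)
      then have "d * of_int \<lfloor>y i / d\<rfloor> \<le> y i" "y i < d * of_int \<lfloor>y i / d\<rfloor> + d"
        using d(1) by (simp_all add: distrib_left)
      then show ?thesis using that by (simp add: u_def)
    qed
    have "(\<Sum>i<m. (u i)\<^sup>2) \<le> (\<Sum>i<m. (y i)\<^sup>2 + 3 * d)"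
    proof (rule sum_mono)
      fix i assume "i \<in> {..<m}"
      then have i: "\<bar>u i - y i\<bar> \<le> d" "\<bar>y i\<bar> \<le> 1" using uy y1 by auto
      have "(u i)\<^sup>2 = (y i)\<^sup>2 + 2 * (y i * (u i - y i)) + (u i - y i)\<^sup>2" by (simp add: power2_eq_square algebra_simps)
      moreover have "\<bar>y i * (u i - y i)\<bar> \<le> 1 * d"
        unfolding abs_mult using i d by (intro mult_mono) auto
      moreover have "\<bar>u i - y i\<bar> * \<bar>u i - y i\<bar> \<le> d * 1"
        using i d d1 by (intro mult_mono) auto
      then have "(u i - y i)\<^sup>2 \<le> d" by (simp add: power2_eq_square)
      ultimately show "(u i)\<^sup>2 \<le> (y i)\<^sup>2 + 3 * d" by linarith
    qed
    also have "\<dots> = 1 + \<delta>" using y d by (simp add: sum.distrib)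
    finally have usq: "(\<Sum>i<m. (u i)\<^sup>2) \<le> 1 + \<delta>" .
    have "u \<in> {..<m} \<rightarrow>\<^sub>E (\<lambda>j. d * of_int j) ` {-N..N}"
    proof (rule PiE_I)
      fix i assume i: "i \<in> {..<m}"
      have "\<bar>y i / d\<bar> \<le> 1 / d" using y1[of i] i d by (simp add: abs_divide divide_right_mono)
      then have "\<lfloor>y i / d\<rfloor> \<in> {-N..N}" unfolding N_def atLeastAtMost_iff by linarith
      then show "u i \<in> (\<lambda>j. d * of_int j) ` {-N..N}" using i by (auto simp: u_def)
    qed (simp add: u_def)
    then have "u \<in> G" using usq by (simp add: G_def)
    moreover have "(1 - \<delta>) * r \<le> (\<Sum>i<m. u i * x i)"
    proof -
      have "(\<Sum>i<m. (y i)\<^sup>2 - d) \<le> (\<Sum>i<m. u i * y i)"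
      proof (rule sum_mono)
        fix i assume "i \<in> {..<m}"
        then have i: "\<bar>u i - y i\<bar> \<le> d" "\<bar>y i\<bar> \<le> 1" using uy y1 by auto
        have "u i * y i = (y i)\<^sup>2 + (u i - y i) * y i" by (simp add: power2_eq_square algebra_simps)
        moreover have "\<bar>(u i - y i) * y i\<bar> \<le> d * 1"
          unfolding abs_mult using i d by (intro mult_mono) auto
        ultimately show "(y i)\<^sup>2 - d \<le> u i * y i" by linarith
      qed
      then have "1 - m * d \<le> (\<Sum>i<m. u i * y i)" using y by (simp add: sum_subtractf)
      moreover have "m * d \<le> \<delta>" using d \<delta> by linarith
      ultimately have "(1 - \<delta>) * r \<le> (\<Sum>i<m. u i * y i) * r" using r by (intro mult_right_mono) auto
      also have "\<dots> = (\<Sum>i<m. u i * x i)" using r by (simp add: y_def sum_distrib_right)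
      finally show ?thesis .
    qed
    ultimately show "\<exists>u\<in>G. (1 - \<delta>) * r \<le> (\<Sum>i<m. u i * x i)" by blast
  qed
qed

lemma scaled_ln_ereal_le:
  assumes "a > 0" "0 \<le> p" "p \<le> exp (- \<beta> / a)"
  shows "ereal a * ln_ereal p \<le> ereal (- \<beta>)"
proof (cases "p = 0")
  case True
  then show ?thesis using assms by (simp add: ln_ereal_def)
next
  case False
  then have "ln p \<le> ln (exp (- \<beta> / a))" using assms by (subst ln_le_cancel_iff) auto
  then have "a * ln p \<le> a * (- \<beta> / a)" using assms by (intro mult_left_mono) auto
  then show ?thesis using assms False by (simp add: ln_ereal_def)
qed

lemma scaled_ln_ereal_ge:
  assumes "a > 0" "exp (- \<beta> / a) \<le> p"
  shows "ereal (- \<beta>) \<le> ereal a * ln_ereal p"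
proof -
  have p: "0 < p" using assms(2) exp_gt_zero by (rule order.strict_trans2[rotated])
  then have "ln (exp (- \<beta> / a)) \<le> ln p" using assms by (subst ln_le_cancel_iff) auto
  then have "a * (- \<beta> / a) \<le> a * ln p" using assms by (intro mult_left_mono) auto
  then show ?thesis using assms p by (simp add: ln_ereal_def)
qed

text \<open>In the nonseparable uniform topology, measurability of all evaluations does not give
  Borel measurability. The jump times are deterministic, so the process is a fixed continuous linear
  image of its finitely many partial sums.\<close>

lemma partial_sum_process_measurable:
  assumes X: "\<And>j. j \<in> {1..k} \<Longrightarrow> X j \<in> borel_measurable M"
  shows "partial_sum_process M X k \<in> borel_measurable M"
proof -
  define e where "e i = (if i = k then Cadlag (indicator {1})
      else Cadlag (\<lambda>t. indicator {row_var M X i / row_var M X k ..< row_var M X (Suc i) / row_var M X k} t))" for i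
  have ap: "apply_cadlag (e i) t = (if i = k then indicator {1} t
      else indicator {row_var M X i / row_var M X k ..< row_var M X (Suc i) / row_var M X k} t)" if i: "i \<le> k" for i t
  proof (cases "i = k")
    case True
    have "apply_cadlag (Cadlag (indicator {1})) = indicator {1}"
      by (rule Cadlag_inverse) (auto simp: cadlag_on_unit_indicator_1 indicator_def)
    then show ?thesis using True by (simp add: e_def)
  next
    case False
    then have "Suc i \<le> k" using i by simp
    then have "indicator {row_var M X i / row_var M X k ..< row_var M X (Suc i) / row_var M X k} t = (0::real)" if "t \<notin> {0..1}" for t
      using that row_var_ratio_bounds(1)[OF i, of M X] row_var_ratio_bounds(2)[of "Suc i" k M X] by (auto simp: indicator_def)
    then show ?thesis
      using False by (auto simp: e_def Cadlag_inverse cadlag_on_unit_indicator)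
  qed
  define \<Phi> where "\<Phi> c = (\<Sum>i\<le>k. c i *\<^sub>R e i)" for c :: "nat \<Rightarrow> real"
  have apply_sum: "apply_cadlag (\<Sum>i\<in>J. c i *\<^sub>R e i) t = (\<Sum>i\<in>J. c i * apply_cadlag (e i) t)" for J c t
    by (induction J rule: infinite_finite_induct) auto
  \<comment> \<open>The \<open>min\<close> keeps all coordinates of the infinite vector among the
    partial sums up to \<open>k\<close>, whose measurability is known.\<close>
  have eq: "partial_sum_process M X k \<omega> = \<Phi> (\<lambda>i. row_sum X (min i k) \<omega> / row_sd M X k)" for \<omega>
  proof (rule cadlag_eqI)
    fix t :: real
    have "apply_cadlag (\<Phi> (\<lambda>i. row_sum X (min i k) \<omega> / row_sd M X k)) t
        = (\<Sum>i<k. row_sum X i \<omega> / row_sd M X k *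
          indicator {row_var M X i / row_var M X k ..< row_var M X (Suc i) / row_var M X k} t)
        + row_sum X k \<omega> / row_sd M X k * indicator {1} t"
      unfolding \<Phi>_def apply_sum lessThan_Suc_atMost[symmetric]
      by (simp add: ap)
    also have "(\<Sum>i<k. row_sum X i \<omega> / row_sd M X k *
          indicator {row_var M X i / row_var M X k ..< row_var M X (Suc i) / row_var M X k} t)
        = (\<Sum>i=1..k. row_sum X (i - 1) \<omega> / row_sd M X k *
          indicator {row_var M X (i - 1) / row_var M X k ..< row_var M X i / row_var M X k} t)"
      by (rule sum.reindex_bij_witness[of _ "\<lambda>i. i - 1" Suc]) auto
    finally show "apply_cadlag (partial_sum_process M X k \<omega>) t
        = apply_cadlag (\<Phi> (\<lambda>i. row_sum X (min i k) \<omega> / row_sd M X k)) t"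
      by (simp add: partial_sum_process.rep_eq)
  qed
  have cont: "continuous_on UNIV \<Phi>"
    unfolding \<Phi>_def by (intro continuous_on_sum continuous_on_scaleR continuous_on_const continuous_on_product_coordinates)
  have "(\<lambda>\<omega>. (\<lambda>i. row_sum X (min i k) \<omega> / row_sd M X k)) \<in> borel_measurable M"
    unfolding row_sum_def
    by (intro measurable_coordinatewise_then_product borel_measurable_divide borel_measurable_sum X borel_measurable_const) auto
  then have "(\<lambda>\<omega>. \<Phi> (\<lambda>i. row_sum X (min i k) \<omega> / row_sd M X k)) \<in> borel_measurable M"
    by (rule measurable_compose[OF _ borel_measurable_continuous_onI[OF cont]])
  then show ?thesis unfolding eq[symmetric] .
qed

subsection \<open>Triangular arrays\<close>

locale mdp_array =
  fixes M :: "nat \<Rightarrow> 'a measure"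
    and k :: "nat \<Rightarrow> nat"
    and X :: "nat \<Rightarrow> nat \<Rightarrow> 'a \<Rightarrow> real"
    and A :: "nat \<Rightarrow> nat \<Rightarrow> real"
    and B a s :: "nat \<Rightarrow> real"
    and n\<^sub>0 :: nat
    and C :: real
  assumes prob: "\<And>n. n \<ge> 1 \<Longrightarrow> prob_space (M n)"
    and indep: "\<And>n. n \<ge> 1 \<Longrightarrow> prob_space.indep_vars (M n) (\<lambda>_. borel) (X n) {1..k n}"
    and square_integrable:
      "\<And>n j. n \<ge> 1 \<Longrightarrow> j \<in> {1..k n} \<Longrightarrow> integrable (M n) (\<lambda>\<omega>. (X n j \<omega>)\<^sup>2)"
    and centered: "\<And>n j. n \<ge> 1 \<Longrightarrow> j \<in> {1..k n} \<Longrightarrow> prob_space.expectation (M n) (X n j) = 0"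
    and s_def: "\<And>n. s n = row_sd (M n) (X n) (k n)"
    and var_pos: "\<And>n. n \<ge> 1 \<Longrightarrow> (s n)\<^sup>2 > 0"
    and n0_ge: "n\<^sub>0 \<ge> 1"
    and A_nonneg: "\<And>n j. n \<ge> n\<^sub>0 \<Longrightarrow> j \<in> {1..k n} \<Longrightarrow> A n j \<ge> 0"
    and B_nonneg: "\<And>n. n \<ge> n\<^sub>0 \<Longrightarrow> B n \<ge> 0"
    and moments: "\<And>n j m. n \<ge> n\<^sub>0 \<Longrightarrow> j \<in> {1..k n} \<Longrightarrow> m \<ge> 3 \<Longrightarrow>
      integrable (M n) (\<lambda>\<omega>. \<bar>X n j \<omega>\<bar> ^ m) \<and>
      prob_space.expectation (M n) (\<lambda>\<omega>. \<bar>X n j \<omega>\<bar> ^ m) \<le> fact m * A n j ^ m * B n"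
    and a_pos: "\<And>n. n \<ge> 1 \<Longrightarrow> a n > 0"
    and a_lim: "a \<longlonglongrightarrow> 0"
    and A_small: "\<And>\<epsilon>. \<epsilon> > 0 \<Longrightarrow>
      \<forall>\<^sub>F n in sequentially. \<forall>j\<in>{1..k n}. A n j \<le> \<epsilon> * (sqrt (a n) * s n)"
    and C_pos: "C > 0"
    and A_bound: "\<And>n. n \<ge> n\<^sub>0 \<Longrightarrow> B n / (s n)\<^sup>2 * (\<Sum>j=1..k n. (A n j)\<^sup>2) \<le> C"
begin

text \<open>The increment of the process, scaled by \<open>sqrt (a n)\<close>, over the indices in
  \<open>J\<close>.\<close>

definition Z :: "nat \<Rightarrow> nat set \<Rightarrow> 'a \<Rightarrow> real" where
  "Z n J \<omega> = sqrt (a n) / s n * (\<Sum>j\<in>J. X n j \<omega>)"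

text \<open>The share of the row variance carried by \<open>J\<close>. Second moments stand for
  variances, as the variables are centred.\<close>

definition v :: "nat \<Rightarrow> nat set \<Rightarrow> real" where
  "v n J = (\<Sum>j\<in>J. \<integral>\<omega>. (X n j \<omega>)\<^sup>2 \<partial>M n) / (s n)\<^sup>2"

lemma s_pos: "n \<ge> 1 \<Longrightarrow> s n > 0"
  using var_pos[of n] by (simp add: s_def row_sd_def row_var_nonneg less_le)

lemma rv: "n \<ge> 1 \<Longrightarrow> j \<in> {1..k n} \<Longrightarrow> X n j \<in> borel_measurable (M n)"
  using indep[of n] by (auto simp: prob_space.indep_vars_def[OF prob])

lemma Z_measurable: "n \<ge> 1 \<Longrightarrow> J \<subseteq> {1..k n} \<Longrightarrow> Z n J \<in> borel_measurable (M n)"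
  unfolding Z_def[abs_def] by (intro borel_measurable_times borel_measurable_const borel_measurable_sum rv) auto

text \<open>Multiplying the transforms of the summands leaves the Gaussian exponent plus third- and
  fourth-order errors. Both are at most a constant times \<open>\<kappa> * \<beta> j\<close>, and
  the bound with \<open>C\<close> controls the sum of the \<open>\<beta> j\<close> by
  \<open>C * \<theta>\<^sup>2 / a n\<close>.\<close>

lemma mgf_Z:
  assumes n: "n \<ge> n\<^sub>0" and J: "J \<subseteq> {1..k n}" and \<epsilon>: "0 \<le> \<epsilon>" "\<bar>\<theta>\<bar> * \<epsilon> \<le> 1/2"
    and small: "\<forall>j\<in>{1..k n}. A n j \<le> \<epsilon> * (sqrt (a n) * s n)"
  shows "integrable (M n) (\<lambda>\<omega>. exp (\<theta> * Z n J \<omega> / a n))"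
    and "(\<integral>\<omega>. exp (\<theta> * Z n J \<omega> / a n) \<partial>M n) \<le> exp ((\<theta>\<^sup>2 * v n J / 2 + 5 * C * (\<bar>\<theta>\<bar> * \<epsilon>) * \<theta>\<^sup>2) / a n)"
    and "exp ((\<theta>\<^sup>2 * v n J / 2 - 5 * C * (\<bar>\<theta>\<bar> * \<epsilon>) * \<theta>\<^sup>2) / a n) \<le> (\<integral>\<omega>. exp (\<theta> * Z n J \<omega> / a n) \<partial>M n)"
proof -
  have n1: "n \<ge> 1" using n n0_ge by simp
  interpret prob_space "M n" by (rule prob[OF n1])
  note sp = s_pos[OF n1] and ap = a_pos[OF n1]
  have finJ: "finite J" using J finite_subset by blast
  \<comment> \<open>The parameter acting on an unscaled summand when \<open>Z n J\<close> carries
    the weight \<open>\<theta> / a n\<close>.\<close>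
  define \<mu> where "\<mu> = \<theta> / (sqrt (a n) * s n)"
  have ex: "\<theta> * Z n J \<omega> / a n = (\<Sum>j\<in>J. \<mu> * X n j \<omega>)" for \<omega>
  proof -
    have "\<theta> * (sqrt (a n) / s n) / a n = \<mu>"
      using ap sp by (simp add: \<mu>_def field_simps)
    then have "\<theta> * Z n J \<omega> / a n = \<mu> * (\<Sum>j\<in>J. X n j \<omega>)" unfolding Z_def by (metis mult.assoc times_divide_eq_left)
    then show ?thesis by (simp add: sum_distrib_left)
  qed
  have \<mu>2: "\<mu>\<^sup>2 = \<theta>\<^sup>2 / (a n * (s n)\<^sup>2)" using ap by (simp add: \<mu>_def power_divide power_mult_distrib)
  define \<kappa> where "\<kappa> = \<bar>\<theta>\<bar> * \<epsilon>"
  have \<kappa>: "0 \<le> \<kappa>" "\<kappa> \<le> 1/2" using \<epsilon> by (auto simp: \<kappa>_def)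
  have muA: "\<bar>\<mu>\<bar> * A n j \<le> \<kappa>" "0 \<le> \<bar>\<mu>\<bar> * A n j" if "j \<in> J" for j
  proof -
    have "j \<in> {1..k n}" using that J by auto
    then have "\<bar>\<mu>\<bar> * A n j \<le> \<bar>\<mu>\<bar> * (\<epsilon> * (sqrt (a n) * s n))" using small by (intro mult_left_mono) auto
    also have "\<dots> = \<kappa>" using ap sp by (simp add: \<mu>_def \<kappa>_def abs_mult abs_divide)
    finally show "\<bar>\<mu>\<bar> * A n j \<le> \<kappa>" .
    show "0 \<le> \<bar>\<mu>\<bar> * A n j" using A_nonneg[OF n \<open>j \<in> {1..k n}\<close>] by simp
  qed
  have B0: "0 \<le> B n" by (rule B_nonneg[OF n])
  define \<beta> where "\<beta> j = B n * (\<bar>\<mu>\<bar> * A n j)\<^sup>2" for j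
  have \<beta>0: "0 \<le> \<beta> j" for j using B0 by (simp add: \<beta>_def)
  have \<beta>sum: "(\<Sum>j\<in>J. \<beta> j) \<le> C * \<theta>\<^sup>2 / a n"
  proof -
    have "(\<Sum>j\<in>J. \<beta> j) \<le> (\<Sum>j=1..k n. \<beta> j)" using J \<beta>0 by (intro sum_mono2) auto
    also have "\<dots> = \<mu>\<^sup>2 * (B n * (\<Sum>j=1..k n. (A n j)\<^sup>2))"
      by (simp add: \<beta>_def power_mult_distrib sum_distrib_left mult_ac)
    also have "\<dots> = \<theta>\<^sup>2 / a n * (B n / (s n)\<^sup>2 * (\<Sum>j=1..k n. (A n j)\<^sup>2))"
      unfolding \<mu>2 by simp
    also have "\<dots> \<le> \<theta>\<^sup>2 / a n * C" using A_bound[OF n] ap by (intro mult_left_mono) auto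
    finally show ?thesis by (simp add: mult_ac)
  qed
  have cube: "2 * B n * (\<bar>\<mu>\<bar> * A n j) ^ 3 \<le> 2 * \<kappa> * \<beta> j" if "j \<in> J" for j
  proof -
    have "2 * B n * (\<bar>\<mu>\<bar> * A n j) ^ 3 = 2 * (\<beta> j * (\<bar>\<mu>\<bar> * A n j))"
      by (simp add: \<beta>_def power2_eq_square power3_eq_cube)
    also have "\<dots> \<le> 2 * (\<beta> j * \<kappa>)" using muA[OF that] \<beta>0 by (intro mult_left_mono) auto
    finally show ?thesis by (simp add: mult_ac)
  qed
  have quart: "6 * B n * (\<bar>\<mu>\<bar> * A n j) ^ 4 \<le> 3 * \<kappa> * \<beta> j" if "j \<in> J" for j
  proof -
    have "6 * B n * (\<bar>\<mu>\<bar> * A n j) ^ 4 = 6 * (\<beta> j * (\<bar>\<mu>\<bar> * A n j)\<^sup>2)"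
      by (simp add: \<beta>_def power2_eq_square power4_eq_xxxx)
    also have "(\<bar>\<mu>\<bar> * A n j)\<^sup>2 \<le> \<kappa> * (1/2)"
      unfolding power2_eq_square using muA[OF that] \<kappa> by (intro mult_mono) auto
    finally have "6 * B n * (\<bar>\<mu>\<bar> * A n j) ^ 4 \<le> 6 * (\<beta> j * (\<kappa> * (1/2)))" using \<beta>0[of j] by (simp add: mult_left_mono)
    then show ?thesis by (simp add: mult_ac)
  qed
  define \<sigma> where "\<sigma> j = (\<integral>\<omega>. (X n j \<omega>)\<^sup>2 \<partial>M n)" for j
  have \<sigma>sum: "(\<Sum>j\<in>J. \<mu>\<^sup>2 / 2 * \<sigma> j) = \<theta>\<^sup>2 * v n J / 2 / a n"
    unfolding sum_distrib_left[symmetric] unfolding \<mu>2 v_def \<sigma>_def by simp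
  have prem: "random_variable borel (X n j)" "integrable (M n) (\<lambda>x. (X n j x)\<^sup>2)" "expectation (X n j) = 0"
      "0 \<le> A n j" "0 \<le> B n"
      "\<And>m. m \<ge> 3 \<Longrightarrow> integrable (M n) (\<lambda>x. \<bar>X n j x\<bar> ^ m) \<and>
       expectation (\<lambda>x. \<bar>X n j x\<bar> ^ m) \<le> fact m * A n j ^ m * B n"
      "\<bar>\<mu>\<bar> * A n j \<le> 1/2" if "j \<in> J" for j
  proof -
    have j: "j \<in> {1..k n}" using that J by auto
    show "random_variable borel (X n j)" "integrable (M n) (\<lambda>x. (X n j x)\<^sup>2)" "expectation (X n j) = 0"
      "0 \<le> A n j" "0 \<le> B n"
      "\<And>m. m \<ge> 3 \<Longrightarrow> integrable (M n) (\<lambda>x. \<bar>X n j x\<bar> ^ m) \<and>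
       expectation (\<lambda>x. \<bar>X n j x\<bar> ^ m) \<le> fact m * A n j ^ m * B n"
      using j n n1 rv square_integrable centered A_nonneg B_nonneg moments by auto
    show "\<bar>\<mu>\<bar> * A n j \<le> 1/2" using muA[OF that] \<kappa> by linarith
  qed
  have ints: "integrable (M n) (\<lambda>x. exp (\<mu> * X n j x))" if "j \<in> J" for j
    by (rule mgf_taylor(1)[OF prem[OF that]])
  have S: "integrable (M n) (\<lambda>\<omega>. exp (\<Sum>j\<in>J. \<mu> * X n j \<omega>))"
    "expectation (\<lambda>\<omega>. exp (\<Sum>j\<in>J. \<mu> * X n j \<omega>)) = (\<Prod>j\<in>J. expectation (\<lambda>\<omega>. exp (\<mu> * X n j \<omega>)))"
    by (rule mgf_sum_indep[OF indep[OF n1] J finJ ints]; assumption)+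
  show "integrable (M n) (\<lambda>\<omega>. exp (\<theta> * Z n J \<omega> / a n))" unfolding ex by (rule S(1))
  \<comment> \<open>The 5 is 2 from the cubic error plus 3 from the quartic one, where
    \<open>\<kappa> \<le> 1/2\<close> turns 6 into 3.\<close>
  have k5: "5 * \<kappa> * (\<Sum>j\<in>J. \<beta> j) \<le> 5 * C * \<kappa> * \<theta>\<^sup>2 / a n"
  proof -
    have "5 * \<kappa> * (\<Sum>j\<in>J. \<beta> j) \<le> 5 * \<kappa> * (C * \<theta>\<^sup>2 / a n)" using \<kappa> by (intro mult_left_mono[OF \<beta>sum]) auto
    then show ?thesis by (simp add: mult_ac)
  qed
  have b0: "0 \<le> \<kappa> * (\<Sum>j\<in>J. \<beta> j)" using \<kappa> \<beta>0 by (simp add: sum_nonneg)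
  have "(\<integral>\<omega>. exp (\<theta> * Z n J \<omega> / a n) \<partial>M n) \<le> (\<Prod>j\<in>J. exp (\<mu>\<^sup>2 / 2 * \<sigma> j + 2 * \<kappa> * \<beta> j))"
    unfolding ex S(2)
  proof (rule prod_mono)
    fix j assume j: "j \<in> J"
    have "expectation (\<lambda>\<omega>. exp (\<mu> * X n j \<omega>)) \<le> exp (\<mu>\<^sup>2 / 2 * \<sigma> j + 2 * B n * (\<bar>\<mu>\<bar> * A n j) ^ 3)"
      unfolding \<sigma>_def by (rule mgf_upper[OF prem[OF j]])
    also have "\<dots> \<le> exp (\<mu>\<^sup>2 / 2 * \<sigma> j + 2 * \<kappa> * \<beta> j)" using cube[OF j] by simp
    finally show "0 \<le> expectation (\<lambda>\<omega>. exp (\<mu> * X n j \<omega>)) \<and>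
        expectation (\<lambda>\<omega>. exp (\<mu> * X n j \<omega>)) \<le> exp (\<mu>\<^sup>2 / 2 * \<sigma> j + 2 * \<kappa> * \<beta> j)" by (simp add: integral_nonneg_AE)
  qed
  also have "\<dots> = exp (\<theta>\<^sup>2 * v n J / 2 / a n + 2 * \<kappa> * (\<Sum>j\<in>J. \<beta> j))"
    unfolding exp_sum[OF finJ, symmetric] sum.distrib \<sigma>sum sum_distrib_left ..
  also have "\<dots> \<le> exp ((\<theta>\<^sup>2 * v n J / 2 + 5 * C * \<kappa> * \<theta>\<^sup>2) / a n)"
    unfolding exp_le_cancel_iff add_divide_distrib using k5 b0 by linarith
  finally show "(\<integral>\<omega>. exp (\<theta> * Z n J \<omega> / a n) \<partial>M n) \<le> exp ((\<theta>\<^sup>2 * v n J / 2 + 5 * C * (\<bar>\<theta>\<bar> * \<epsilon>) * \<theta>\<^sup>2) / a n)"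
    unfolding \<kappa>_def .
  have "exp ((\<theta>\<^sup>2 * v n J / 2 - 5 * C * \<kappa> * \<theta>\<^sup>2) / a n) \<le> exp (\<theta>\<^sup>2 * v n J / 2 / a n - 5 * \<kappa> * (\<Sum>j\<in>J. \<beta> j))"
    unfolding exp_le_cancel_iff diff_divide_distrib using k5 by linarith
  also have "\<dots> = (\<Prod>j\<in>J. exp (\<mu>\<^sup>2 / 2 * \<sigma> j - 5 * \<kappa> * \<beta> j))"
    unfolding exp_sum[OF finJ, symmetric] sum_subtractf \<sigma>sum sum_distrib_left ..
  also have "\<dots> \<le> (\<integral>\<omega>. exp (\<theta> * Z n J \<omega> / a n) \<partial>M n)"
    unfolding ex S(2)
  proof (rule prod_mono)
    fix j assume j: "j \<in> J"
    have "exp (\<mu>\<^sup>2 / 2 * \<sigma> j - 5 * \<kappa> * \<beta> j) \<le> exp (\<mu>\<^sup>2 / 2 * \<sigma> j - 2 * B n * (\<bar>\<mu>\<bar> * A n j) ^ 3 - 6 * B n * (\<bar>\<mu>\<bar> * A n j) ^ 4)"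
      unfolding exp_le_cancel_iff using cube[OF j] quart[OF j] by linarith
    also have "\<dots> \<le> expectation (\<lambda>\<omega>. exp (\<mu> * X n j \<omega>))"
      unfolding \<sigma>_def by (rule mgf_lower[OF prem[OF j]])
    finally show "0 \<le> exp (\<mu>\<^sup>2 / 2 * \<sigma> j - 5 * \<kappa> * \<beta> j) \<and> exp (\<mu>\<^sup>2 / 2 * \<sigma> j - 5 * \<kappa> * \<beta> j) \<le> expectation (\<lambda>\<omega>. exp (\<mu> * X n j \<omega>))" by simp
  qed
  finally show "exp ((\<theta>\<^sup>2 * v n J / 2 - 5 * C * (\<bar>\<theta>\<bar> * \<epsilon>) * \<theta>\<^sup>2) / a n) \<le> (\<integral>\<omega>. exp (\<theta> * Z n J \<omega> / a n) \<partial>M n)"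
    unfolding \<kappa>_def .
qed

text \<open>The threshold for \<open>n\<close> is uniform in \<open>J\<close>. This matters because
  later the blocks vary with \<open>n\<close>, and the maximal inequality uses all end segments of a
  block at once.\<close>

lemma mgf_Z_eventually:
  assumes \<eta>: "\<eta> > 0"
  shows "\<forall>\<^sub>F n in sequentially. \<forall>J\<subseteq>{1..k n}.
      integrable (M n) (\<lambda>\<omega>. exp (\<theta> * Z n J \<omega> / a n)) \<and>
      (\<integral>\<omega>. exp (\<theta> * Z n J \<omega> / a n) \<partial>M n) \<le> exp ((\<theta>\<^sup>2 * v n J / 2 + \<eta>) / a n) \<and>
      exp ((\<theta>\<^sup>2 * v n J / 2 - \<eta>) / a n) \<le> (\<integral>\<omega>. exp (\<theta> * Z n J \<omega> / a n) \<partial>M n)"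
proof -
  define K where "K = 5 * C * \<bar>\<theta>\<bar> * \<theta>\<^sup>2 + 1"
  have K: "K > 0" using C_pos by (simp add: K_def add_nonneg_pos)
  \<comment> \<open>The first bound ensures the hypothesis
    \<open>\<bar>\<theta>\<bar> * \<epsilon> \<le> 1/2\<close>, the second keeps the total error
    below \<open>\<eta>\<close>.\<close>
  define \<epsilon> where "\<epsilon> = min (1 / (2 * (\<bar>\<theta>\<bar> + 1))) (\<eta> / K)"
  have \<epsilon>: "\<epsilon> > 0" using \<eta> K by (simp add: \<epsilon>_def)
  have e1: "\<bar>\<theta>\<bar> * \<epsilon> \<le> 1/2"
  proof -
    have "\<bar>\<theta>\<bar> * \<epsilon> \<le> \<bar>\<theta>\<bar> * (1 / (2 * (\<bar>\<theta>\<bar> + 1)))" by (intro mult_left_mono) (auto simp: \<epsilon>_def)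
    also have "\<dots> \<le> 1/2" by (simp add: divide_le_eq)
    finally show ?thesis .
  qed
  have e2: "5 * C * (\<bar>\<theta>\<bar> * \<epsilon>) * \<theta>\<^sup>2 \<le> \<eta>"
  proof -
    have "5 * C * (\<bar>\<theta>\<bar> * \<epsilon>) * \<theta>\<^sup>2 = (5 * C * \<bar>\<theta>\<bar> * \<theta>\<^sup>2) * \<epsilon>" by (simp add: mult_ac)
    also have "\<dots> \<le> K * \<epsilon>" using \<epsilon> by (intro mult_right_mono) (auto simp: K_def)
    also have "\<dots> \<le> K * (\<eta> / K)" using K by (intro mult_left_mono) (auto simp: \<epsilon>_def)
    finally show ?thesis using K by simp
  qed
  show ?thesis
    using A_small[OF \<epsilon>] eventually_ge_at_top[of n\<^sub>0]
  proof eventually_elim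
    case (elim n)
    have n1: "n \<ge> 1" using elim n0_ge by simp
    show ?case
    proof (intro allI impI)
      fix J assume J: "J \<subseteq> {1..k n}"
      note G = mgf_Z[OF elim(2) J less_imp_le[OF \<epsilon>] e1 elim(1)]
      have "exp ((\<theta>\<^sup>2 * v n J / 2 + 5 * C * (\<bar>\<theta>\<bar> * \<epsilon>) * \<theta>\<^sup>2) / a n) \<le> exp ((\<theta>\<^sup>2 * v n J / 2 + \<eta>) / a n)"
        "exp ((\<theta>\<^sup>2 * v n J / 2 - \<eta>) / a n) \<le> exp ((\<theta>\<^sup>2 * v n J / 2 - 5 * C * (\<bar>\<theta>\<bar> * \<epsilon>) * \<theta>\<^sup>2) / a n)"
        unfolding exp_le_cancel_iff using e2 a_pos[OF n1] by (auto intro!: divide_right_mono)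
      then show "integrable (M n) (\<lambda>\<omega>. exp (\<theta> * Z n J \<omega> / a n)) \<and>
        (\<integral>\<omega>. exp (\<theta> * Z n J \<omega> / a n) \<partial>M n) \<le> exp ((\<theta>\<^sup>2 * v n J / 2 + \<eta>) / a n) \<and>
        exp ((\<theta>\<^sup>2 * v n J / 2 - \<eta>) / a n) \<le> (\<integral>\<omega>. exp (\<theta> * Z n J \<omega> / a n) \<partial>M n)"
        using G(2,3) by (intro conjI G(1)) (rule order_trans, assumption, assumption)+
    qed
  qed
qed

text \<open>The fourth moment bound and the assumptions on \<open>A\<close> show that the squared
  share is at most \<open>24 * C * a n\<close>, which tends to 0.\<close>

lemma v_single_eventually:
  assumes \<eta>: "\<eta> > 0"
  shows "\<forall>\<^sub>F n in sequentially. \<forall>j\<in>{1..k n}. v n {j} \<le> \<eta>"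
proof -
  have "\<eta>\<^sup>2 / (24 * C) > 0" using \<eta> C_pos by simp
  then have "\<forall>\<^sub>F n in sequentially. a n < \<eta>\<^sup>2 / (24 * C)" using order_tendstoD(2)[OF a_lim] by simp
  then show ?thesis
    using A_small[OF zero_less_one] eventually_ge_at_top[of n\<^sub>0]
  proof eventually_elim
    case (elim n)
    have n1: "n \<ge> 1" using elim n0_ge by simp
    interpret prob_space "M n" by (rule prob[OF n1])
    note sp = s_pos[OF n1] and ap = a_pos[OF n1]
    show ?case
    proof
      fix j assume j: "j \<in> {1..k n}"
      define \<sigma> where "\<sigma> = (\<integral>\<omega>. (X n j \<omega>)\<^sup>2 \<partial>M n)"
      have A0: "0 \<le> A n j" and B0: "0 \<le> B n" using A_nonneg B_nonneg j elim by auto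
      have "\<sigma>\<^sup>2 \<le> fact 4 * A n j ^ 4 * B n"
        unfolding \<sigma>_def using moments[OF elim(3) j, of 4]
        by (intro expectation_power4_bound square_integrable n1 j) auto
      then have "\<sigma>\<^sup>2 \<le> 24 * ((A n j)\<^sup>2 * (B n * (A n j)\<^sup>2))"
        by (simp add: fact_numeral power2_eq_square power4_eq_xxxx mult_ac)
      also have "(A n j)\<^sup>2 * (B n * (A n j)\<^sup>2) \<le> (a n * (s n)\<^sup>2) * (C * (s n)\<^sup>2)"
      proof (rule mult_mono)
        have "A n j \<le> sqrt (a n) * s n" using elim(2) j by simp
        then have "(A n j)\<^sup>2 \<le> (sqrt (a n) * s n)\<^sup>2" using A0 by (rule power_mono)
        then show "(A n j)\<^sup>2 \<le> a n * (s n)\<^sup>2" using ap by (simp add: power_mult_distrib)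
        have "B n * (A n j)\<^sup>2 \<le> B n * (\<Sum>j=1..k n. (A n j)\<^sup>2)"
          using j B0 by (intro mult_left_mono member_le_sum) auto
        also have "\<dots> \<le> C * (s n)\<^sup>2"
          using A_bound[OF elim(3)] sp by (simp add: field_simps)
        finally show "B n * (A n j)\<^sup>2 \<le> C * (s n)\<^sup>2" .
      qed (use ap B0 in auto)
      finally have le: "\<sigma>\<^sup>2 \<le> 24 * C * a n * ((s n)\<^sup>2)\<^sup>2" by (simp add: power2_eq_square[of "(s n)\<^sup>2"] mult_ac)
      have "(v n {j})\<^sup>2 = \<sigma>\<^sup>2 / ((s n)\<^sup>2)\<^sup>2" by (simp add: v_def \<sigma>_def power_divide)
      also have "\<dots> \<le> 24 * C * a n" using le sp by (simp add: divide_le_eq)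
      also have "\<dots> \<le> \<eta>\<^sup>2"
      proof -
        have "a n * (24 * C) < \<eta>\<^sup>2" using elim(1) C_pos by (simp add: pos_less_divide_eq)
        then show ?thesis by (subst mult.commute) (rule less_imp_le)
      qed
      finally show "v n {j} \<le> \<eta>" by (rule power2_le_imp_le) (use \<eta> in simp)
    qed
  qed
qed

text \<open>Constant factors disappear at speed \<open>a n\<close>: each is absorbed by an
  arbitrarily small change of the exponent.\<close>

lemma exp_div_a_eventually_ge:
  assumes "\<eta> > 0"
  shows "\<forall>\<^sub>F n in sequentially. c \<le> exp (\<eta> / a n)"
proof -
  have "\<eta> / (\<bar>c\<bar> + 1) > 0" using assms by simp
  then have "\<forall>\<^sub>F n in sequentially. a n < \<eta> / (\<bar>c\<bar> + 1)" using order_tendstoD(2)[OF a_lim] by simp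
  then show ?thesis
    using eventually_ge_at_top[of 1]
  proof eventually_elim
    case (elim n)
    have "a n * (\<bar>c\<bar> + 1) < \<eta>" using elim(1) by (simp add: less_divide_eq)
    then have "\<bar>c\<bar> + 1 \<le> \<eta> / a n" using a_pos[OF elim(2)] by (simp add: le_divide_eq mult.commute)
    moreover have "1 + \<eta> / a n \<le> exp (\<eta> / a n)" by (rule exp_ge_add_one_self)
    ultimately show ?case by linarith
  qed
qed

text \<open>The parameter \<open>K\<close> is left free instead of being optimised; a large
  \<open>K\<close> later outweighs the fixed error 1 in the exponent.\<close>

lemma tail_Z_eventually:
  fixes K x :: real
  assumes K: "K \<ge> 0"
  shows "\<forall>\<^sub>F n in sequentially. \<forall>J\<subseteq>{1..k n}.
      \<P>(\<omega> in M n. x \<le> \<bar>Z n J \<omega>\<bar>) \<le> 2 * exp (- (K * x - K\<^sup>2 * v n J / 2 - 1) / a n)"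
  using mgf_Z_eventually[OF zero_less_one, of K] mgf_Z_eventually[OF zero_less_one, of "- K"] eventually_ge_at_top[of 1]
proof eventually_elim
  case (elim n)
  interpret prob_space "M n" by (rule prob[OF elim(3)])
  note ap = a_pos[OF elim(3)]
  show ?case
  proof (intro allI impI)
    fix J assume J: "J \<subseteq> {1..k n}"
    have [measurable]: "Z n J \<in> borel_measurable (M n)" by (rule Z_measurable[OF elim(3) J])
    have 1: "\<P>(\<omega> in M n. K * x \<le> K * Z n J \<omega>) \<le> exp (- (K * x - (K\<^sup>2 * v n J / 2 + 1)) / a n)"
      using elim(1) J by (intro Chernoff_scaled ap) blast+
    have 2: "\<P>(\<omega> in M n. K * x \<le> - K * Z n J \<omega>) \<le> exp (- (K * x - ((- K)\<^sup>2 * v n J / 2 + 1)) / a n)"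
      using elim(2) J by (intro Chernoff_scaled ap) blast+
    have "\<P>(\<omega> in M n. x \<le> \<bar>Z n J \<omega>\<bar>)
       \<le> prob ({\<omega>\<in>space (M n). K * x \<le> K * Z n J \<omega>} \<union> {\<omega>\<in>space (M n). K * x \<le> - K * Z n J \<omega>})"
    proof (rule finite_measure_mono)
      show "{\<omega>\<in>space (M n). x \<le> \<bar>Z n J \<omega>\<bar>} \<subseteq> {\<omega>\<in>space (M n). K * x \<le> K * Z n J \<omega>} \<union> {\<omega>\<in>space (M n). K * x \<le> - K * Z n J \<omega>}"
      proof
        fix \<omega> assume "\<omega> \<in> {\<omega>\<in>space (M n). x \<le> \<bar>Z n J \<omega>\<bar>}"
        then have w: "\<omega> \<in> space (M n)" "x \<le> Z n J \<omega> \<or> x \<le> - Z n J \<omega>" by auto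
        then have "K * x \<le> K * Z n J \<omega> \<or> K * x \<le> K * (- Z n J \<omega>)" using mult_left_mono[OF _ K] by blast
        then show "\<omega> \<in> {\<omega>\<in>space (M n). K * x \<le> K * Z n J \<omega>} \<union> {\<omega>\<in>space (M n). K * x \<le> - K * Z n J \<omega>}" using w by auto
      qed
    qed measurable
    also have "\<dots> \<le> \<P>(\<omega> in M n. K * x \<le> K * Z n J \<omega>) + \<P>(\<omega> in M n. K * x \<le> - K * Z n J \<omega>)"
      by (rule measure_Un_le) measurable
    finally show "\<P>(\<omega> in M n. x \<le> \<bar>Z n J \<omega>\<bar>) \<le> 2 * exp (- (K * x - K\<^sup>2 * v n J / 2 - 1) / a n)"
      using 1 2 by (simp add: diff_diff_eq)
  qed
qed

section \<open>Oscillation inside a block\<close>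

lemma v_mono: "J \<subseteq> J' \<Longrightarrow> finite J' \<Longrightarrow> v n J \<le> v n J'"
  unfolding v_def by (intro divide_right_mono sum_mono2) auto

text \<open>Any prescribed rate \<open>R\<close> is reached by taking the exponential parameter
  \<open>K\<close> large and then the block variance so small that the quadratic term stays
  bounded.\<close>

lemma oscillation_eventually:
  fixes x R :: real
  assumes x: "x > 0"
  shows "\<exists>w>0. \<forall>\<^sub>F n in sequentially. \<forall>l r. l \<le> r \<and> r \<le> k n \<and> v n {l<..r} \<le> w \<longrightarrow>
      \<P>(\<omega> in M n. \<exists>j\<in>{l..r}. x < \<bar>Z n {l<..j} \<omega>\<bar>) \<le> 4 * exp (- R / a n)"
proof -
  define R' where "R' = max R 0"
  \<comment> \<open>Of \<open>R' + 3\<close>, the fixed error costs 1 and the variance term at most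
    1/2, so \<open>R' + 1\<close> remains. The unit beyond \<open>R'\<close> makes the tails at most
    1/2, as the maximal inequality demands; \<open>R'\<close> replaces a possibly negative
    \<open>R\<close>.\<close>
  define K where "K = 2 * (R' + 3) / x"
  have K: "K > 0" "K * (x/2) = R' + 3" using x by (auto simp: K_def R'_def)
  define w where "w = 1 / K\<^sup>2"
  have w: "w > 0" "K\<^sup>2 * w = 1" using K by (auto simp: w_def)
  show ?thesis
  proof (intro exI[of _ w] conjI w(1))
    show "\<forall>\<^sub>F n in sequentially. \<forall>l r. l \<le> r \<and> r \<le> k n \<and> v n {l<..r} \<le> w \<longrightarrow>
      \<P>(\<omega> in M n. \<exists>j\<in>{l..r}. x < \<bar>Z n {l<..j} \<omega>\<bar>) \<le> 4 * exp (- R / a n)"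
      using tail_Z_eventually[OF less_imp_le[OF K(1)], of "x/2"] exp_div_a_eventually_ge[OF zero_less_one, of 4] eventually_ge_at_top[of 1]
    proof eventually_elim
      case (elim n)
      interpret prob_space "M n" by (rule prob[OF elim(3)])
      note ap = a_pos[OF elim(3)] and sp = s_pos[OF elim(3)]
      show ?case
      proof (intro allI impI, elim conjE)
        fix l r assume lr: "l \<le> r" "r \<le> k n" "v n {l<..r} \<le> w"
        define c where "c = sqrt (a n) / s n"
        have c: "c > 0" using ap sp by (simp add: c_def)
        have Zc: "\<bar>Z n J \<omega>\<bar> = c * \<bar>\<Sum>j\<in>J. X n j \<omega>\<bar>" for J \<omega>
          unfolding Z_def c_def[symmetric] abs_mult using c by simp
        \<comment> \<open>The maximal inequality speaks of unscaled sums and doubles the threshold,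
          so half of \<open>x\<close> is translated back by the factor \<open>c\<close>.\<close>
        define y where "y = x / 2 / c"
        have ylt: "y < \<bar>\<Sum>j\<in>J. X n j \<omega>\<bar> \<longleftrightarrow> x / 2 < \<bar>Z n J \<omega>\<bar>" for J \<omega>
          unfolding Zc y_def pos_divide_less_eq[OF c] by (simp only: mult.commute)
        have "2 * y = x / c" by (simp add: y_def)
        then have y2lt: "2 * y < \<bar>\<Sum>j\<in>J. X n j \<omega>\<bar> \<longleftrightarrow> x < \<bar>Z n J \<omega>\<bar>" for J \<omega>
          unfolding Zc using c by (simp add: pos_divide_less_eq mult.commute)
        have tail: "\<P>(\<omega> in M n. y < \<bar>\<Sum>h\<in>{j<..r}. X n h \<omega>\<bar>) \<le> 2 * exp (- (R' + 1) / a n)" if j: "j \<in> {l..r}" for j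
        proof -
          have sub: "{j<..r} \<subseteq> {1..k n}" using lr by auto
          have [measurable]: "Z n {j<..r} \<in> borel_measurable (M n)" by (rule Z_measurable[OF elim(3) sub])
          have "v n {j<..r} \<le> v n {l<..r}" using j by (intro v_mono) auto
          then have "K\<^sup>2 * v n {j<..r} \<le> K\<^sup>2 * w" using lr by (intro mult_left_mono) auto
          then have Kb: "R' + 1 \<le> K * (x/2) - K\<^sup>2 * v n {j<..r} / 2 - 1" using K w by linarith
          have "\<P>(\<omega> in M n. y < \<bar>\<Sum>h\<in>{j<..r}. X n h \<omega>\<bar>) = \<P>(\<omega> in M n. x/2 < \<bar>Z n {j<..r} \<omega>\<bar>)"
            unfolding ylt ..
          also have "\<dots> \<le> \<P>(\<omega> in M n. x/2 \<le> \<bar>Z n {j<..r} \<omega>\<bar>)"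
            by (intro finite_measure_mono) auto
          also have "\<dots> \<le> 2 * exp (- (K * (x/2) - K\<^sup>2 * v n {j<..r} / 2 - 1) / a n)"
            using elim(1) sub by blast
          also have "\<dots> \<le> 2 * exp (- (R' + 1) / a n)"
            using Kb ap by (simp add: divide_le_cancel)
          finally show ?thesis .
        qed
        have half: "\<P>(\<omega> in M n. y < \<bar>\<Sum>h\<in>{j<..r}. X n h \<omega>\<bar>) \<le> 1/2" if j: "j \<in> {l..r}" for j
        proof -
          have "exp (- (R' + 1) / a n) \<le> exp (- 1 / a n)"
            unfolding exp_le_cancel_iff using ap by (intro divide_right_mono) (auto simp: R'_def)
          also have "\<dots> = inverse (exp (1 / a n))" by (simp add: exp_minus)
          also have "\<dots> \<le> inverse 4" using elim(2) by (intro le_imp_inverse_le) auto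
          finally show ?thesis using tail[OF j] by simp
        qed
        have "\<P>(\<omega> in M n. \<exists>j\<in>{l..r}. x < \<bar>Z n {l<..j} \<omega>\<bar>) = \<P>(\<omega> in M n. \<exists>j\<in>{l..r}. 2 * y < \<bar>\<Sum>h\<in>{l<..j}. X n h \<omega>\<bar>)"
          unfolding y2lt ..
        also have "\<dots> \<le> 2 * \<P>(\<omega> in M n. y < \<bar>\<Sum>h\<in>{l<..r}. X n h \<omega>\<bar>)"
          by (rule Ottaviani[OF indep[OF elim(3)] lr(1,2) half])
        also have "\<dots> \<le> 2 * (2 * exp (- (R' + 1) / a n))"
          using tail[of l] lr by (intro mult_left_mono) auto
        also have "exp (- (R' + 1) / a n) \<le> exp (- R / a n)"
          unfolding exp_le_cancel_iff using ap by (intro divide_right_mono) (auto simp: R'_def)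
        finally show "\<P>(\<omega> in M n. \<exists>j\<in>{l..r}. x < \<bar>Z n {l<..j} \<omega>\<bar>) \<le> 4 * exp (- R / a n)" by simp
      qed
    qed
  qed
qed

text \<open>The right-continuous inverse of the variance clock. Taking the last admissible index
  agrees with the half-open intervals of the process also when some variances vanish.\<close>

definition tau :: "nat \<Rightarrow> real \<Rightarrow> nat" where
  "tau n t = Max {l\<in>{..k n}. v n {0<..l} \<le> t}"

text \<open>The value 0 at \<open>i = 0\<close> is imposed because \<open>tau n 0\<close> is
  positive when the first variances vanish. With it the cells begin at the first summand and the
  path starts at 0.\<close>

definition L :: "nat \<Rightarrow> nat \<Rightarrow> nat \<Rightarrow> nat" where
  "L n m i = (if i = 0 then 0 else tau n (real i / m))"

definition D :: "nat \<Rightarrow> nat \<Rightarrow> nat \<Rightarrow> 'a \<Rightarrow> real" where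
  "D n m i = Z n {L n m i<..L n m (Suc i)}"

section \<open>The variance clock and the grid cells\<close>

lemma v_eq_row_var:
  assumes n: "n \<ge> 1" and l: "l \<le> k n"
  shows "v n {0<..l} = row_var (M n) (X n) l / row_var (M n) (X n) (k n)"
proof -
  have "(s n)\<^sup>2 = row_var (M n) (X n) (k n)" by (simp add: s_def row_sd_def row_var_nonneg)
  moreover have "(\<Sum>j\<in>{0<..l}. \<integral>\<omega>. (X n j \<omega>)\<^sup>2 \<partial>M n) = row_var (M n) (X n) l"
    unfolding row_var_def using l centered[OF n] by (intro sum.cong) auto
  ultimately show ?thesis by (simp add: v_def)
qed

lemma v_full: "n \<ge> 1 \<Longrightarrow> v n {0<..k n} = 1"
  using var_pos[of n] by (simp add: v_eq_row_var s_def row_sd_def row_var_nonneg)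

lemma v_block: "l \<le> r \<Longrightarrow> v n {l<..r} = v n {0<..r} - v n {0<..l}"
proof -
  assume "l \<le> r"
  then have "{0<..r} = {0<..l} \<union> {l<..r}" by auto
  then have "v n {0<..r} = v n {0<..l} + v n {l<..r}"
    unfolding v_def by (simp add: sum.union_disjoint add_divide_distrib)
  then show ?thesis by simp
qed

lemma Z_block: "l \<le> r \<Longrightarrow> Z n {l<..r} \<omega> = Z n {0<..r} \<omega> - Z n {0<..l} \<omega>"
proof -
  assume "l \<le> r"
  then have "{0<..r} = {0<..l} \<union> {l<..r}" by auto
  then have "Z n {0<..r} \<omega> = Z n {0<..l} \<omega> + Z n {l<..r} \<omega>"
    unfolding Z_def by (simp add: sum.union_disjoint distrib_left)
  then show ?thesis by simp
qed

lemma v_empty: "v n {} = 0" by (simp add: v_def)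

lemma tau_props:
  assumes t: "0 \<le> t"
  shows "tau n t \<le> k n" "v n {0<..tau n t} \<le> t" "\<And>l. l \<le> k n \<Longrightarrow> v n {0<..l} \<le> t \<Longrightarrow> l \<le> tau n t"
proof -
  let ?S = "{l\<in>{..k n}. v n {0<..l} \<le> t}"
  have fin: "finite ?S" by simp
  have "0 \<in> ?S" using t by (simp add: v_empty)
  then have "tau n t \<in> ?S" unfolding tau_def by (intro Max_in[OF fin]) auto
  then show "tau n t \<le> k n" "v n {0<..tau n t} \<le> t" by auto
  show "l \<le> tau n t" if "l \<le> k n" "v n {0<..l} \<le> t" for l
    unfolding tau_def using that by (intro Max_ge[OF fin]) auto
qed

lemma tau_mono: "0 \<le> t \<Longrightarrow> t \<le> t' \<Longrightarrow> tau n t \<le> tau n t'"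
  using tau_props[of t n] tau_props(3)[of t' "tau n t" n] by auto

text \<open>One index further the clock has passed \<open>t\<close>, so the defect is at most the
  share of a single summand.\<close>

lemma tau_lower:
  assumes n: "n \<ge> 1" and t: "0 \<le> t" "t \<le> 1" and \<eta>: "0 \<le> \<eta>" "\<And>j. j \<in> {1..k n} \<Longrightarrow> v n {j} \<le> \<eta>"
  shows "t - \<eta> \<le> v n {0<..tau n t}"
proof (cases "tau n t = k n")
  case True
  then show ?thesis using v_full[OF n] t \<eta> by simp
next
  case False
  then have lt: "Suc (tau n t) \<le> k n" using tau_props(1)[OF t(1), of n] by simp
  have "\<not> v n {0<..Suc (tau n t)} \<le> t" using tau_props(3)[OF t(1) lt] by auto
  moreover have "v n {0<..Suc (tau n t)} - v n {0<..tau n t} = v n {Suc (tau n t)}"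
  proof -
    have "{tau n t<..Suc (tau n t)} = {Suc (tau n t)}" by auto
    then show ?thesis using v_block[of "tau n t" "Suc (tau n t)" n] by simp
  qed
  moreover have "v n {Suc (tau n t)} \<le> \<eta>" using \<eta>(2) lt by simp
  ultimately show ?thesis by linarith
qed

text \<open>Replaces the evaluation of the path by a partial sum stopped at the clock; all later
  estimates of the path go through this identity.\<close>

lemma process_eq_Z:
  assumes n: "n \<ge> 1" and t: "t \<in> {0..1}"
  shows "apply_cadlag (sqrt (a n) *\<^sub>R partial_sum_process (M n) (X n) (k n) \<omega>) t = Z n {0<..tau n t} \<omega>"
proof -
  have t0: "0 \<le> t" using t by simp
  have rs: "row_sum (X n) l \<omega> = (\<Sum>j\<in>{0<..l}. X n j \<omega>)" for l
    unfolding row_sum_def by (intro sum.cong) auto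
  have "apply_cadlag (partial_sum_process (M n) (X n) (k n) \<omega>) t = row_sum (X n) (tau n t) \<omega> / s n"
  proof (cases "t = 1")
    case True
    have "tau n t = k n" using tau_props(1)[OF t0, of n] tau_props(3)[OF t0, of "k n" n] True v_full[OF n] by simp
    then show ?thesis using True by (simp add: partial_sum_process_1 s_def)
  next
    case False
    then have t1: "t < 1" using t by simp
    have "tau n t \<noteq> k n" using tau_props(2)[OF t0, of n] v_full[OF n] t1 by auto
    then have lt: "Suc (tau n t) \<le> k n" using tau_props(1)[OF t0, of n] by simp
    \<comment> \<open>Hence \<open>t\<close> lies in the half-open interval number
      \<open>Suc (tau n t)\<close>, on which the process holds the sum up to the preceding
      index.\<close>
    have "\<not> v n {0<..Suc (tau n t)} \<le> t" using tau_props(3)[OF t0 lt] by auto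
    then have "t \<in> {row_var (M n) (X n) (Suc (tau n t) - 1) / row_var (M n) (X n) (k n) ..<
        row_var (M n) (X n) (Suc (tau n t)) / row_var (M n) (X n) (k n)}"
      using tau_props(1,2)[OF t0, of n] v_eq_row_var[OF n] lt by simp
    then have "apply_cadlag (partial_sum_process (M n) (X n) (k n) \<omega>) t = row_sum (X n) (Suc (tau n t) - 1) \<omega> / row_sd (M n) (X n) (k n)"
      using lt by (intro partial_sum_process_eq) auto
    then show ?thesis by (simp add: s_def)
  qed
  then show ?thesis by (simp add: Z_def rs)
qed

lemma L_mono:
  assumes m: "m > 0" and ij: "i \<le> j"
  shows "L n m i \<le> L n m j"
  using ij by (auto simp: L_def intro!: tau_mono divide_right_mono)

lemma L_le: "L n m i \<le> k n"
  by (auto simp: L_def tau_props)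

lemma L_0 [simp]: "L n m 0 = 0" by (simp add: L_def)

lemma L_variance:
  assumes n: "n \<ge> 1" and m: "m > 0" and i: "i \<le> m" and \<eta>: "0 \<le> \<eta>" "\<And>j. j \<in> {1..k n} \<Longrightarrow> v n {j} \<le> \<eta>"
  shows "real i / m - \<eta> \<le> v n {0<..L n m i}" "v n {0<..L n m i} \<le> real i / m"
proof -
  have "0 \<le> real i / m" "real i / m \<le> 1" using i m by auto
  then show "real i / m - \<eta> \<le> v n {0<..L n m i}" "v n {0<..L n m i} \<le> real i / m"
    using tau_lower[OF n _ _ \<eta>, of "real i / m"] tau_props(2)[of "real i / m" n] \<eta>
    by (auto simp: L_def v_empty)
qed

lemma block_variance_eventually:
  assumes m: "m > 0" and \<eta>: "\<eta> > 0"
  shows "\<forall>\<^sub>F n in sequentially. \<forall>i<m. \<bar>v n {L n m i<..L n m (Suc i)} - 1 / m\<bar> \<le> \<eta>"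
  using v_single_eventually[OF \<eta>] eventually_ge_at_top[of 1]
proof eventually_elim
  case (elim n)
  show ?case
  proof (intro allI impI)
    fix i assume i: "i < m"
    have e: "\<And>j. j \<in> {1..k n} \<Longrightarrow> v n {j} \<le> \<eta>" using elim by blast
    have "real (Suc i) / m = real i / m + 1 / m" by (simp add: add_divide_distrib)
    then show "\<bar>v n {L n m i<..L n m (Suc i)} - 1 / m\<bar> \<le> \<eta>"
      using L_variance[OF elim(2) m _ less_imp_le[OF \<eta>] e, of i] L_variance[OF elim(2) m _ less_imp_le[OF \<eta>] e, of "Suc i"] i
        v_block[OF L_mono[OF m, of i "Suc i" n], of n] unfolding abs_le_iff by auto
  qed
qed

lemma D_measurable: "n \<ge> 1 \<Longrightarrow> D n m i \<in> borel_measurable (M n)"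
  unfolding D_def using L_le[of n m "Suc i"] by (intro Z_measurable) auto

lemma D_indep:
  assumes n: "n \<ge> 1" and m: "m > 0"
  shows "prob_space.indep_vars (M n) (\<lambda>_. borel) (D n m) {..<m}"
proof -
  interpret prob_space "M n" by (rule prob[OF n])
  have "indep_vars (\<lambda>_. borel) (\<lambda>i x. \<Sum>h\<in>{L n m i<..L n m (Suc i)}. X n h x) {..<m}"
    using L_mono[OF m] L_le by (intro indep_vars_block_sums[OF indep[OF n]]) auto
  then have "indep_vars (\<lambda>_. borel) (\<lambda>i x. sqrt (a n) / s n * (\<Sum>h\<in>{L n m i<..L n m (Suc i)}. X n h x)) {..<m}"
    by (rule indep_vars_compose2) measurable
  then show ?thesis by (simp add: D_def[abs_def] Z_def[abs_def])
qed

lemma mgf_D_eventually: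
  assumes m: "m > 0" and \<eta>: "\<eta> > 0"
  shows "\<forall>\<^sub>F n in sequentially. \<forall>i<m.
      integrable (M n) (\<lambda>\<omega>. exp (\<theta> * D n m i \<omega> / a n)) \<and>
      (\<integral>\<omega>. exp (\<theta> * D n m i \<omega> / a n) \<partial>M n) \<le> exp ((\<theta>\<^sup>2 * (1 / m) / 2 + \<eta>) / a n) \<and>
      exp ((\<theta>\<^sup>2 * (1 / m) / 2 - \<eta>) / a n) \<le> (\<integral>\<omega>. exp (\<theta> * D n m i \<omega> / a n) \<partial>M n)"
proof -
  \<comment> \<open>Half of \<open>\<eta>\<close> pays for the transform of the block. This
    deviation of the block variance from \<open>1 / m\<close> costs at most the other half.\<close>
  have e2: "\<eta> / (\<theta>\<^sup>2 + 1) > 0" using \<eta> by (simp add: add_nonneg_pos)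
  show ?thesis
    using mgf_Z_eventually[OF half_gt_zero[OF \<eta>], of \<theta>] block_variance_eventually[OF m e2] eventually_ge_at_top[of 1]
  proof eventually_elim
    case (elim n)
    note ap = a_pos[OF elim(3)]
    show ?case
    proof (intro allI impI)
      fix i assume i: "i < m"
      define u where "u = v n {L n m i<..L n m (Suc i)}"
      have sub: "{L n m i<..L n m (Suc i)} \<subseteq> {1..k n}" using L_le[of n m "Suc i"] by auto
      have "\<bar>u - 1 / m\<bar> \<le> \<eta> / (\<theta>\<^sup>2 + 1)" using elim(2) i by (simp add: u_def)
      then have "\<theta>\<^sup>2 * \<bar>u - 1 / m\<bar> \<le> \<theta>\<^sup>2 * (\<eta> / (\<theta>\<^sup>2 + 1))" by (intro mult_left_mono) auto
      also have "\<dots> \<le> \<eta>" using \<eta> by (simp add: divide_le_eq add_nonneg_pos mult.commute)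
      finally have "\<bar>\<theta>\<^sup>2 * u - \<theta>\<^sup>2 * (1 / m)\<bar> \<le> \<eta>"
        by (simp only: right_diff_distrib[symmetric] abs_mult abs_power2)
      moreover have "p / 2 + \<eta> / 2 \<le> q / 2 + \<eta> \<and> q / 2 - \<eta> \<le> p / 2 - \<eta> / 2" if "\<bar>p - q\<bar> \<le> \<eta>" for p q :: real
        using that unfolding abs_le_iff by linarith
      ultimately have "\<theta>\<^sup>2 * u / 2 + \<eta> / 2 \<le> \<theta>\<^sup>2 * (1 / m) / 2 + \<eta>" "\<theta>\<^sup>2 * (1 / m) / 2 - \<eta> \<le> \<theta>\<^sup>2 * u / 2 - \<eta> / 2"
        by blast+
      then have "exp ((\<theta>\<^sup>2 * u / 2 + \<eta> / 2) / a n) \<le> exp ((\<theta>\<^sup>2 * (1 / m) / 2 + \<eta>) / a n)"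
        "exp ((\<theta>\<^sup>2 * (1 / m) / 2 - \<eta>) / a n) \<le> exp ((\<theta>\<^sup>2 * u / 2 - \<eta> / 2) / a n)"
        unfolding exp_le_cancel_iff using ap by (auto intro: divide_right_mono simp del: times_divide_eq_right)
      moreover have "integrable (M n) (\<lambda>\<omega>. exp (\<theta> * D n m i \<omega> / a n))"
        "(\<integral>\<omega>. exp (\<theta> * D n m i \<omega> / a n) \<partial>M n) \<le> exp ((\<theta>\<^sup>2 * u / 2 + \<eta> / 2) / a n)"
        "exp ((\<theta>\<^sup>2 * u / 2 - \<eta> / 2) / a n) \<le> (\<integral>\<omega>. exp (\<theta> * D n m i \<omega> / a n) \<partial>M n)"
        using elim(1) sub unfolding D_def u_def by blast+
      ultimately show "integrable (M n) (\<lambda>\<omega>. exp (\<theta> * D n m i \<omega> / a n)) \<and>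
        (\<integral>\<omega>. exp (\<theta> * D n m i \<omega> / a n) \<partial>M n) \<le> exp ((\<theta>\<^sup>2 * (1 / m) / 2 + \<eta>) / a n) \<and>
        exp ((\<theta>\<^sup>2 * (1 / m) / 2 - \<eta>) / a n) \<le> (\<integral>\<omega>. exp (\<theta> * D n m i \<omega> / a n) \<partial>M n)"
        by (meson order_trans)
    qed
  qed
qed

subsection \<open>The moderate deviation principle\<close>

text \<open>The complement of the energy ellipsoid is covered by finitely many half-spaces, so the
  exponential Chebyshev inequality suffices.\<close>

lemma energy_upper_eventually:
  assumes m: "m > 0" and \<beta>: "\<beta> > 0" and \<eta>: "\<eta> > 0"
  shows "\<forall>\<^sub>F n in sequentially.
     \<P>(\<omega> in M n. \<beta> \<le> real m / 2 * (\<Sum>i<m. (D n m i \<omega>)\<^sup>2)) \<le> exp (- (\<beta> - \<eta>) / a n)"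
proof -
  \<comment> \<open>The net and the rounded radius together replace 1 by
    \<open>(1 - \<delta>) ^ 3\<close>, a loss of at most \<open>3 * \<delta> * \<beta>\<close>,
    which this choice keeps below \<open>\<eta> / 4\<close>.\<close>
  define \<delta> where "\<delta> = min 1 (\<eta> / (12 * \<beta>))"
  have \<delta>: "0 < \<delta>" "\<delta> \<le> 1" using \<beta> \<eta> by (auto simp: \<delta>_def)
  have \<delta>\<beta>: "3 * \<delta> * \<beta> \<le> \<eta> / 4"
  proof -
    have "\<delta> * \<beta> \<le> \<eta> / (12 * \<beta>) * \<beta>" using \<beta> by (intro mult_right_mono) (auto simp: \<delta>_def)
    also have "\<dots> = \<eta> / 12" using \<beta> by simp
    finally show ?thesis by simp
  qed
  obtain G :: "(nat \<Rightarrow> real) set" where G: "finite G"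
    "\<And>u. u \<in> G \<Longrightarrow> (\<Sum>i<m. (u i)\<^sup>2) \<le> 1 + \<delta>"
    "\<And>x r. r > 0 \<Longrightarrow> (\<Sum>i<m. (x i)\<^sup>2) = r\<^sup>2 \<Longrightarrow> \<exists>u\<in>G. (1 - \<delta>) * r \<le> (\<Sum>i<m. u i * x i)"
    using finite_direction_net[OF m \<delta>] by blast
  define \<rho> where "\<rho> = sqrt (2 * \<beta> / m)"
  have \<rho>: "\<rho> > 0" "\<rho>\<^sup>2 = 2 * \<beta> / m" using \<beta> m by (auto simp: \<rho>_def)
  \<comment> \<open>With \<open>\<rho>\<close> the radius of the sphere of energy
    \<open>\<beta>\<close>, this maximises \<open>\<theta> * (1 - \<delta>) * \<rho> -
    \<theta>\<^sup>2 / (2 * m)\<close>, the exponent for a unit direction.\<close>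
  define \<theta> where "\<theta> = m * \<rho> * (1 - \<delta>)"
  have \<theta>0: "\<theta> \<ge> 0" using \<rho> \<delta> by (simp add: \<theta>_def)
  define y where "y = 2 * \<beta> * (1 - \<delta>)\<^sup>2"
  have \<theta>y: "\<theta> * ((1 - \<delta>) * \<rho>) = y"
  proof -
    have "\<theta> * ((1 - \<delta>) * \<rho>) = m * \<rho>\<^sup>2 * (1 - \<delta>)\<^sup>2" by (simp add: \<theta>_def power2_eq_square)
    then show ?thesis using m by (simp add: \<rho>(2) y_def)
  qed
  have \<theta>2: "\<theta>\<^sup>2 / (2 * m) = \<beta> * (1 - \<delta>)\<^sup>2"
    using m by (simp add: \<theta>_def power_mult_distrib \<rho>(2)) (simp add: power2_eq_square)
  define K where "K = \<beta> * (1 - \<delta>)\<^sup>2 * (1 + \<delta>) + \<eta> / 4"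
  have yK: "\<beta> - \<eta> / 2 \<le> y - K"
  proof -
    have "y - K = \<beta> * ((1 - \<delta>)\<^sup>2 * (1 - \<delta>)) - \<eta> / 4" by (simp add: y_def K_def algebra_simps)
    moreover have "1 - 3 * \<delta> \<le> (1 - \<delta>)\<^sup>2 * (1 - \<delta>)"
    proof -
      have "(1 - \<delta>)\<^sup>2 * (1 - \<delta>) = 1 - 3 * \<delta> + \<delta> * \<delta> * (3 - \<delta>)" by (simp add: power2_eq_square algebra_simps)
      then show ?thesis using \<delta> by simp
    qed
    then have "\<beta> * (1 - 3 * \<delta>) \<le> \<beta> * ((1 - \<delta>)\<^sup>2 * (1 - \<delta>))" using \<beta> by (intro mult_left_mono) auto
    then have "\<beta> - 3 * \<delta> * \<beta> \<le> \<beta> * ((1 - \<delta>)\<^sup>2 * (1 - \<delta>))" by (simp add: algebra_simps)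
    ultimately show ?thesis using \<delta>\<beta> by linarith
  qed
  \<comment> \<open>The \<open>m\<close> independent cells each contribute one such error; in total
    they cost \<open>\<eta> / 4\<close>.\<close>
  define \<eta>' where "\<eta>' = \<eta> / (4 * m)"
  have \<eta>': "\<eta>' > 0" "m * \<eta>' = \<eta> / 4" using \<eta> m by (auto simp: \<eta>'_def)
  define Q where "Q n t i \<longleftrightarrow> integrable (M n) (\<lambda>\<omega>. exp (t * D n m i \<omega> / a n)) \<and>
      (\<integral>\<omega>. exp (t * D n m i \<omega> / a n) \<partial>M n) \<le> exp ((t\<^sup>2 * (1 / m) / 2 + \<eta>') / a n)" for n t i
  have "\<forall>\<^sub>F n in sequentially. \<forall>u\<in>G. \<forall>i\<in>{..<m}. Q n (\<theta> * u i) i"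
  proof (intro eventually_ball_finite G(1) ballI finite_lessThan)
    fix u i assume "u \<in> G" "i \<in> {..<m}"
    then show "\<forall>\<^sub>F n in sequentially. Q n (\<theta> * u i) i"
      using mgf_D_eventually[OF m \<eta>'(1), of "\<theta> * u i"] by (auto elim!: eventually_mono simp: Q_def)
  qed
  then show ?thesis
    using exp_div_a_eventually_ge[OF half_gt_zero[OF \<eta>], of "card G"] eventually_ge_at_top[of 1]
  proof eventually_elim
    case (elim n)
    interpret prob_space "M n" by (rule prob[OF elim(3)])
    note ap = a_pos[OF elim(3)]
    have Dm[measurable]: "D n m i \<in> borel_measurable (M n)" for i by (rule D_measurable[OF elim(3)])
    define E where "E u = {\<omega>\<in>space (M n). y \<le> \<theta> * (\<Sum>i<m. u i * D n m i \<omega>)}" for u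
    have Em: "E u \<in> events" for u unfolding E_def by measurable
    have PE: "prob (E u) \<le> exp (- (\<beta> - \<eta> / 2) / a n)" if u: "u \<in> G" for u
    proof -
      have t: "\<theta> * (\<Sum>i<m. u i * D n m i \<omega>) / a n = (\<Sum>i<m. (\<theta> * u i / a n) * D n m i \<omega>)" for \<omega>
        by (simp add: sum_distrib_left sum_divide_distrib mult_ac)
      have Qi: "integrable (M n) (\<lambda>\<omega>. exp (\<theta> * u i / a n * D n m i \<omega>))"
         "expectation (\<lambda>\<omega>. exp (\<theta> * u i / a n * D n m i \<omega>)) \<le> exp (((\<theta> * u i)\<^sup>2 * (1 / m) / 2 + \<eta>') / a n)" if "i \<in> {..<m}" for i
        using elim(1) u that unfolding Q_def by auto
      have S1: "integrable (M n) (\<lambda>\<omega>. exp (\<theta> * (\<Sum>i<m. u i * D n m i \<omega>) / a n))"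
        unfolding t by (rule mgf_sum_indep(1)[OF D_indep[OF elim(3) m] order_refl finite_lessThan Qi(1)])
      have "expectation (\<lambda>\<omega>. exp (\<theta> * (\<Sum>i<m. u i * D n m i \<omega>) / a n)) = (\<Prod>i<m. expectation (\<lambda>\<omega>. exp (\<theta> * u i / a n * D n m i \<omega>)))"
        unfolding t by (rule mgf_sum_indep(2)[OF D_indep[OF elim(3) m] order_refl finite_lessThan Qi(1)])
      also have "\<dots> \<le> (\<Prod>i<m. exp (((\<theta> * u i)\<^sup>2 * (1 / m) / 2 + \<eta>') / a n))"
        using Qi(2) by (intro prod_mono conjI integral_nonneg_AE) auto
      also have "\<dots> = exp (\<Sum>i<m. ((\<theta> * u i)\<^sup>2 * (1 / m) / 2 + \<eta>') / a n)" by (simp add: exp_sum)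
      also have "(\<Sum>i<m. ((\<theta> * u i)\<^sup>2 * (1 / m) / 2 + \<eta>') / a n) = (\<theta>\<^sup>2 / (2 * m) * (\<Sum>i<m. (u i)\<^sup>2) + m * \<eta>') / a n"
      proof -
        have "(\<theta> * u i)\<^sup>2 * (1 / m) / 2 = \<theta>\<^sup>2 / (2 * m) * (u i)\<^sup>2" for i
          by (simp add: power_mult_distrib)
        then show ?thesis
          unfolding sum_divide_distrib[symmetric] by (simp only: sum.distrib sum_distrib_left sum_constant card_lessThan)
      qed
      also have "exp \<dots> \<le> exp (K / a n)"
        unfolding exp_le_cancel_iff
      proof (intro divide_right_mono)
        have "\<theta>\<^sup>2 / (2 * m) * (\<Sum>i<m. (u i)\<^sup>2) \<le> \<theta>\<^sup>2 / (2 * m) * (1 + \<delta>)"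
          using G(2)[OF u] by (intro mult_left_mono) auto
        then show "\<theta>\<^sup>2 / (2 * m) * (\<Sum>i<m. (u i)\<^sup>2) + m * \<eta>' \<le> K" unfolding K_def \<eta>'(2) \<theta>2 by simp
      qed (use ap in simp)
      finally have "prob (E u) \<le> exp (- (y - K) / a n)" unfolding E_def by (intro Chernoff_scaled ap S1)
      also have "\<dots> \<le> exp (- (\<beta> - \<eta> / 2) / a n)" unfolding exp_le_cancel_iff using yK ap by (intro divide_right_mono) auto
      finally show ?thesis .
    qed
    have "\<P>(\<omega> in M n. \<beta> \<le> real m / 2 * (\<Sum>i<m. (D n m i \<omega>)\<^sup>2)) \<le> prob (\<Union>u\<in>G. E u)"
    proof (rule finite_measure_mono)
      show "(\<Union>u\<in>G. E u) \<in> events" using G(1) Em by (intro sets.finite_UN) auto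
      show "{\<omega>\<in>space (M n). \<beta> \<le> real m / 2 * (\<Sum>i<m. (D n m i \<omega>)\<^sup>2)} \<subseteq> (\<Union>u\<in>G. E u)"
      proof
        fix \<omega> assume w: "\<omega> \<in> {\<omega>\<in>space (M n). \<beta> \<le> real m / 2 * (\<Sum>i<m. (D n m i \<omega>)\<^sup>2)}"
        define r where "r = sqrt (\<Sum>i<m. (D n m i \<omega>)\<^sup>2)"
        have r2: "(\<Sum>i<m. (D n m i \<omega>)\<^sup>2) = r\<^sup>2" by (simp add: r_def sum_nonneg)
        have "2 * \<beta> / m \<le> (\<Sum>i<m. (D n m i \<omega>)\<^sup>2)" using w m by (simp add: divide_le_eq mult_ac)
        then have r: "\<rho> \<le> r" unfolding \<rho>_def r_def by (rule real_sqrt_le_mono)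
        then have "r > 0" using \<rho> by linarith
        from G(3)[OF this r2] obtain u where u: "u \<in> G" "(1 - \<delta>) * r \<le> (\<Sum>i<m. u i * D n m i \<omega>)" by blast
        have "(1 - \<delta>) * \<rho> \<le> (1 - \<delta>) * r" using r \<delta> by (intro mult_left_mono) auto
        then have "\<theta> * ((1 - \<delta>) * \<rho>) \<le> \<theta> * (\<Sum>i<m. u i * D n m i \<omega>)" using u \<theta>0 by (intro mult_left_mono) auto
        then show "\<omega> \<in> (\<Union>u\<in>G. E u)" using w u(1) by (auto simp: E_def \<theta>y)
      qed
    qed
    also have "\<dots> \<le> (\<Sum>u\<in>G. prob (E u))" using Em by (intro finite_measure_subadditive_finite G(1)) auto
    also have "\<dots> \<le> (\<Sum>u\<in>G. exp (- (\<beta> - \<eta> / 2) / a n))" by (intro sum_mono PE)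
    also have "\<dots> = real (card G) * exp (- (\<beta> - \<eta> / 2) / a n)" by simp
    also have "\<dots> \<le> exp (\<eta> / 2 / a n) * exp (- (\<beta> - \<eta> / 2) / a n)" using elim(2) by (intro mult_right_mono) auto
    also have "\<dots> = exp (- (\<beta> - \<eta>) / a n)" unfolding exp_add[symmetric] add_divide_distrib[symmetric] by simp
    finally show ?case .
  qed
qed

text \<open>Tilting with variance \<open>1 / m\<close>: the discarded tails are exponentially
  smaller than the main term as soon as the error of the transforms is small compared with the gain
  from the window.\<close>

lemma block_lower_eventually:
  assumes m: "m > 0" and \<delta>: "\<delta> > 0" and \<eta>: "\<eta> > 0"
  shows "\<forall>\<^sub>F n in sequentially. \<forall>i<m.
     exp (- (real m / 2 * x\<^sup>2 + \<eta>) / a n) \<le> \<P>(\<omega> in M n. \<bar>D n m i \<omega> - x\<bar> < \<delta>)"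
proof -
  define V where "V = 1 / real m"
  have V: "V > 0" using m by (simp add: V_def)
  define \<theta> where "\<theta> = x / V"
  \<comment> \<open>The window is narrowed so that the factor
    \<open>\<bar>\<theta>\<bar> * \<delta>'\<close>, which measures the variation of the tilt across
    it, costs at most \<open>\<eta> / 3\<close>.\<close>
  define \<delta>' where "\<delta>' = min \<delta> (\<eta> / (3 * (\<bar>\<theta>\<bar> + 1)))"
  have \<delta>': "\<delta>' > 0" "\<delta>' \<le> \<delta>" using \<delta> \<eta> by (auto simp: \<delta>'_def)
  have \<theta>\<delta>: "\<bar>\<theta>\<bar> * \<delta>' \<le> \<eta> / 3"
  proof -
    have "\<bar>\<theta>\<bar> * \<delta>' \<le> (\<bar>\<theta>\<bar> + 1) * (\<eta> / (3 * (\<bar>\<theta>\<bar> + 1)))" using \<delta>' by (intro mult_mono) (auto simp: \<delta>'_def)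
    also have "\<dots> = \<eta> / 3"
    proof -
      have "\<bar>\<theta>\<bar> + 1 \<noteq> 0" by linarith
      then show ?thesis by (simp add: field_simps)
    qed
    finally show ?thesis .
  qed
  define h where "h = \<delta>' / V"
  define \<kappa> where "\<kappa> = \<delta>'\<^sup>2 / (2 * V)"
  have \<kappa>: "\<kappa> > 0" using \<delta>' V by (simp add: \<kappa>_def)
  \<comment> \<open>With \<open>\<rho> \<le> \<kappa> / 4\<close> the tails lag behind the main term
    by \<open>\<kappa> - 2 * \<rho>\<close>, at least \<open>\<kappa> / 2\<close>; the latter
    absorbs the factor 4, so the two tails take at most half of the main term.\<close>
  define \<rho> where "\<rho> = min (\<kappa> / 4) (\<eta> / 3)"
  have \<rho>: "\<rho> > 0" "\<rho> \<le> \<kappa> / 4" "\<rho> \<le> \<eta> / 3" using \<kappa> \<eta> by (auto simp: \<rho>_def)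
  have \<theta>x: "\<theta>\<^sup>2 * V / 2 - \<theta> * x = - (real m / 2 * x\<^sup>2)"
    using m by (simp add: \<theta>_def V_def power2_eq_square)
  have \<eta>3: "\<eta> / 3 > 0" using \<eta> by simp
  show ?thesis
    using mgf_D_eventually[OF m \<rho>(1), of \<theta>] mgf_D_eventually[OF m \<rho>(1), of "\<theta> + h"] mgf_D_eventually[OF m \<rho>(1), of "\<theta> - h"]
      exp_div_a_eventually_ge[OF half_gt_zero[OF \<kappa>], of 4] exp_div_a_eventually_ge[OF \<eta>3, of 2] eventually_ge_at_top[of 1]
  proof eventually_elim
    case (elim n)
    interpret prob_space "M n" by (rule prob[OF elim(6)])
    note ap = a_pos[OF elim(6)]
    show ?case
    proof (intro allI impI)
      fix i assume i: "i < m"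
      have Dm[measurable]: "D n m i \<in> borel_measurable (M n)" by (rule D_measurable[OF elim(6)])
      define e1 where "e1 = exp ((\<theta>\<^sup>2 * V / 2 - \<rho>) / a n)"
      \<comment> \<open>The three losses of \<open>\<eta> / 3\<close> are the factor 2, the
        variation of the tilt in the window, and later \<open>\<rho>\<close>.\<close>
      define W where "W = \<eta> / 3 + (\<theta> * x + \<bar>\<theta>\<bar> * \<delta>')"
      define P where "P = \<P>(\<omega> in M n. \<bar>D n m i \<omega> - x\<bar> < \<delta>')"
      have T: "e1 \<le> exp ((\<theta> * x + \<bar>\<theta>\<bar> * \<delta>') / a n) * P
          + 2 * exp ((\<theta>\<^sup>2 * V / 2 - \<delta>'\<^sup>2 / (2 * V) + \<rho>) / a n)"
        unfolding e1_def P_def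
        by (rule tilting_bound[OF ap V \<delta>'(1) Dm \<theta>_def h_def]) (use elim(1,2,3) i in \<open>auto simp: V_def\<close>)
      have "4 * exp ((\<theta>\<^sup>2 * V / 2 - \<kappa> + \<rho>) / a n) \<le> exp (\<kappa> / 2 / a n) * exp ((\<theta>\<^sup>2 * V / 2 - \<kappa> + \<rho>) / a n)"
        using elim(4) by (intro mult_right_mono) auto
      also have "\<dots> \<le> e1"
        unfolding e1_def exp_add[symmetric] add_divide_distrib[symmetric] exp_le_cancel_iff
        using \<rho>(2) ap by (intro divide_right_mono) auto
      finally have "e1 \<le> 2 * (exp ((\<theta> * x + \<bar>\<theta>\<bar> * \<delta>') / a n) * P)" using T unfolding \<kappa>_def by linarith
      also have "\<dots> \<le> exp (\<eta> / 3 / a n) * (exp ((\<theta> * x + \<bar>\<theta>\<bar> * \<delta>') / a n) * P)"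
        using elim(5) by (intro mult_right_mono) (auto simp: P_def)
      also have "\<dots> = exp (W / a n) * P"
        by (simp add: W_def exp_add add_divide_distrib)
      finally have "e1 * exp (- W / a n) \<le> exp (W / a n) * P * exp (- W / a n)"
        by (intro mult_right_mono) auto
      also have "\<dots> = P" by (simp add: exp_minus)
      also have "e1 * exp (- W / a n) = exp ((\<theta>\<^sup>2 * V / 2 - \<rho> - W) / a n)"
        unfolding e1_def exp_add[symmetric] add_divide_distrib[symmetric] by simp
      finally have PP: "exp ((\<theta>\<^sup>2 * V / 2 - \<rho> - (\<eta> / 3 + (\<theta> * x + \<bar>\<theta>\<bar> * \<delta>'))) / a n) \<le> P"
        unfolding W_def .
      have "exp (- (real m / 2 * x\<^sup>2 + \<eta>) / a n) \<le> exp ((\<theta>\<^sup>2 * V / 2 - \<rho> - (\<eta> / 3 + (\<theta> * x + \<bar>\<theta>\<bar> * \<delta>'))) / a n)"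
        unfolding exp_le_cancel_iff using \<rho>(3) \<theta>\<delta> \<theta>x ap by (intro divide_right_mono) linarith+
      also note PP
      also have "P \<le> \<P>(\<omega> in M n. \<bar>D n m i \<omega> - x\<bar> < \<delta>)"
        unfolding P_def using \<delta>' by (intro finite_measure_mono) auto
      finally show "exp (- (real m / 2 * x\<^sup>2 + \<eta>) / a n) \<le> \<P>(\<omega> in M n. \<bar>D n m i \<omega> - x\<bar> < \<delta>)" .
    qed
  qed
qed

lemma blocks_lower_eventually:
  fixes x :: "nat \<Rightarrow> real"
  assumes m: "m > 0" and \<delta>: "\<delta> > 0" and \<eta>: "\<eta> > 0"
  shows "\<forall>\<^sub>F n in sequentially.
     exp (- (real m / 2 * (\<Sum>i<m. (x i)\<^sup>2) + \<eta>) / a n) \<le> \<P>(\<omega> in M n. \<forall>i<m. \<bar>D n m i \<omega> - x i\<bar> < \<delta>)"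
proof -
  define \<eta>' where "\<eta>' = \<eta> / m"
  have \<eta>': "\<eta>' > 0" "m * \<eta>' = \<eta>" using \<eta> m by (auto simp: \<eta>'_def)
  have "\<forall>\<^sub>F n in sequentially. \<forall>i\<in>{..<m}. exp (- (real m / 2 * (x i)\<^sup>2 + \<eta>') / a n) \<le> \<P>(\<omega> in M n. \<bar>D n m i \<omega> - x i\<bar> < \<delta>)"
  proof (intro eventually_ball_finite ballI finite_lessThan)
    fix i assume "i \<in> {..<m}"
    then show "\<forall>\<^sub>F n in sequentially. exp (- (real m / 2 * (x i)\<^sup>2 + \<eta>') / a n) \<le> \<P>(\<omega> in M n. \<bar>D n m i \<omega> - x i\<bar> < \<delta>)"
      using block_lower_eventually[OF m \<delta> \<eta>'(1), of "x i"] by (auto elim!: eventually_mono)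
  qed
  then show ?thesis
    using eventually_ge_at_top[of 1]
  proof eventually_elim
    case (elim n)
    interpret prob_space "M n" by (rule prob[OF elim(2)])
    have "exp (- (real m / 2 * (\<Sum>i<m. (x i)\<^sup>2) + \<eta>) / a n) = exp (\<Sum>i<m. - (real m / 2 * (x i)\<^sup>2 + \<eta>') / a n)"
    proof -
      have "(\<Sum>i<m. - (real m / 2 * (x i)\<^sup>2 + \<eta>') / a n) = - (real m / 2 * (\<Sum>i<m. (x i)\<^sup>2) + m * \<eta>') / a n"
        unfolding sum_divide_distrib[symmetric] sum_negf sum.distrib sum_distrib_left by simp
      then show ?thesis by (simp only: \<eta>'(2))
    qed
    also have "\<dots> = (\<Prod>i<m. exp (- (real m / 2 * (x i)\<^sup>2 + \<eta>') / a n))" by (rule exp_sum) simp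
    also have "\<dots> \<le> (\<Prod>i<m. \<P>(\<omega> in M n. \<bar>D n m i \<omega> - x i\<bar> < \<delta>))"
      using elim(1) by (intro prod_mono) auto
    also have "\<dots> = (\<Prod>i<m. prob (D n m i -` {y. \<bar>y - x i\<bar> < \<delta>} \<inter> space (M n)))"
      by (intro prod.cong arg_cong[where f=prob]) auto
    also have "\<dots> = prob (\<Inter>i\<in>{..<m}. D n m i -` {y. \<bar>y - x i\<bar> < \<delta>} \<inter> space (M n))"
      using m by (intro indep_varsD_finite[OF D_indep[OF elim(2) m], symmetric]) auto
    also have "(\<Inter>i\<in>{..<m}. D n m i -` {y. \<bar>y - x i\<bar> < \<delta>} \<inter> space (M n)) = {\<omega>\<in>space (M n). \<forall>i<m. \<bar>D n m i \<omega> - x i\<bar> < \<delta>}"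
      using m by auto
    finally show ?case .
  qed
qed

text \<open>The right end of a cell is included among the \<open>j\<close>, so outside this event
  the increments \<open>D n m i\<close> are bounded by \<open>x\<close> as well.\<close>

definition Bad :: "nat \<Rightarrow> nat \<Rightarrow> real \<Rightarrow> 'a set" where
  "Bad n m x = {\<omega>\<in>space (M n). \<exists>i<m. \<exists>j\<in>{L n m i..L n m (Suc i)}. x < \<bar>Z n {L n m i<..j} \<omega>\<bar>}"

lemma Bad_block_measurable:
  assumes n: "n \<ge> 1"
  shows "{\<omega>\<in>space (M n). \<exists>j\<in>{L n m i..L n m (Suc i)}. x < \<bar>Z n {L n m i<..j} \<omega>\<bar>} \<in> sets (M n)"
proof (intro sets.sets_Collect_finite_Ex)
  fix j assume "j \<in> {L n m i..L n m (Suc i)}"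
  then have "{L n m i<..j} \<subseteq> {1..k n}" using L_le[of n m "Suc i"] by auto
  then have [measurable]: "Z n {L n m i<..j} \<in> borel_measurable (M n)" by (rule Z_measurable[OF n])
  show "{\<omega>\<in>space (M n). x < \<bar>Z n {L n m i<..j} \<omega>\<bar>} \<in> sets (M n)" by measurable
qed simp

lemma Bad_eq: "Bad n m x = (\<Union>i<m. {\<omega>\<in>space (M n). \<exists>j\<in>{L n m i..L n m (Suc i)}. x < \<bar>Z n {L n m i<..j} \<omega>\<bar>})"
  by (auto simp: Bad_def)

lemma Bad_measurable: "n \<ge> 1 \<Longrightarrow> Bad n m x \<in> sets (M n)"
  unfolding Bad_eq by (intro sets.finite_UN Bad_block_measurable) auto

text \<open>Exponential equivalence of the process and its values on a grid: the rate
  \<open>R\<close> is arbitrary, and \<open>m0\<close> is chosen before \<open>n\<close>. Fine grids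
  have cells of small variance, to which the oscillation bound applies.\<close>

lemma Bad_eventually:
  fixes x R :: real
  assumes x: "x > 0"
  shows "\<exists>m0>0. \<forall>m\<ge>m0. \<forall>\<^sub>F n in sequentially. measure (M n) (Bad n m x) \<le> exp (- R / a n)"
proof -
  \<comment> \<open>The spare unit in the rate absorbs the factor \<open>4 * m\<close> of the union
    over the cells.\<close>
  obtain w where w: "w > 0" and osc: "\<forall>\<^sub>F n in sequentially. \<forall>l r. l \<le> r \<and> r \<le> k n \<and> v n {l<..r} \<le> w \<longrightarrow>
      \<P>(\<omega> in M n. \<exists>j\<in>{l..r}. x < \<bar>Z n {l<..j} \<omega>\<bar>) \<le> 4 * exp (- (R + 1) / a n)"
    using oscillation_eventually[OF x, of "R + 1"] by blast
  obtain m1 where m1: "1 / real (Suc m1) < w / 2" using nat_approx_posE[OF half_gt_zero[OF w]] by blast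
  show ?thesis
  proof (intro exI[of _ "Suc m1"] conjI allI impI)
    fix m assume mm: "m \<ge> Suc m1"
    then have m: "m > 0" by simp
    have "1 / real m \<le> 1 / real (Suc m1)" using mm by (intro divide_left_mono) auto
    then have mw: "1 / real m \<le> w / 2" using m1 by linarith
    show "\<forall>\<^sub>F n in sequentially. measure (M n) (Bad n m x) \<le> exp (- R / a n)"
      using osc block_variance_eventually[OF m half_gt_zero[OF w]] exp_div_a_eventually_ge[OF zero_less_one, of "4 * m"] eventually_ge_at_top[of 1]
    proof eventually_elim
      case (elim n)
      interpret prob_space "M n" by (rule prob[OF elim(4)])
      have "prob (Bad n m x) \<le> (\<Sum>i<m. \<P>(\<omega> in M n. \<exists>j\<in>{L n m i..L n m (Suc i)}. x < \<bar>Z n {L n m i<..j} \<omega>\<bar>))"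
        unfolding Bad_eq using Bad_block_measurable[OF elim(4)] by (intro finite_measure_subadditive_finite) auto
      also have "\<dots> \<le> (\<Sum>i<m. 4 * exp (- (R + 1) / a n))"
      proof (rule sum_mono)
        fix i assume "i \<in> {..<m}"
        then have "\<bar>v n {L n m i<..L n m (Suc i)} - 1 / m\<bar> \<le> w / 2" using elim(2) by auto
        then have "v n {L n m i<..L n m (Suc i)} \<le> w" using mw by linarith
        then show "\<P>(\<omega> in M n. \<exists>j\<in>{L n m i..L n m (Suc i)}. x < \<bar>Z n {L n m i<..j} \<omega>\<bar>) \<le> 4 * exp (- (R + 1) / a n)"
          using elim(1) L_mono[OF m, of i "Suc i" n] L_le[of n m "Suc i"] by auto
      qed
      also have "\<dots> = (4 * m) * exp (- (R + 1) / a n)" by simp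
      also have "\<dots> \<le> exp (1 / a n) * exp (- (R + 1) / a n)" using elim(3) by (intro mult_right_mono) auto
      also have "\<dots> = exp (- R / a n)" unfolding exp_add[symmetric] add_divide_distrib[symmetric] by simp
      finally show ?case .
    qed
  qed simp
qed

definition Y :: "nat \<Rightarrow> 'a \<Rightarrow> cadlag" where
  "Y n \<omega> = sqrt (a n) *\<^sub>R partial_sum_process (M n) (X n) (k n) \<omega>"

text \<open>By monotonicity the clock at \<open>t\<close> stays between the two ends of the cell, so
  the difference is one of the partial sums excluded by \<open>Bad\<close>.\<close>

lemma Y_near_grid:
  assumes n: "n \<ge> 1" and m: "m > 0" and \<omega>: "\<omega> \<in> space (M n)" "\<omega> \<notin> Bad n m x"
    and i: "i < m" "real i / m \<le> t" "t \<le> (real i + 1) / m"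
  shows "\<bar>apply_cadlag (Y n \<omega>) t - Z n {0<..L n m i} \<omega>\<bar> \<le> x"
proof -
  have "0 \<le> real i / m" "(real i + 1) / m \<le> 1" using i(1) by auto
  then have t: "t \<in> {0..1}" using i unfolding atLeastAtMost_iff by linarith
  then have t0: "0 \<le> t" by simp
  have lo: "L n m i \<le> tau n t" using i(2) tau_mono[of "real i / m" t n] by (auto simp: L_def)
  have "tau n t \<le> tau n ((real i + 1) / m)" using tau_mono[OF t0 i(3)] .
  then have hi: "tau n t \<le> L n m (Suc i)" by (simp add: L_def add.commute)
  have "\<bar>Z n {L n m i<..tau n t} \<omega>\<bar> \<le> x"
    using \<omega> i(1) lo hi unfolding Bad_def by force
  then show ?thesis using process_eq_Z[OF n t] Z_block[OF lo] by (simp add: Y_def)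
qed

lemma exists_grid_cell:
  assumes "m > 0" "t \<in> {0..1::real}"
  shows "\<exists>i<m. real i / m \<le> t \<and> t \<le> (real i + 1) / m"
proof (cases "t = 1")
  case True
  have "real (m - 1) + 1 = real m" using assms(1) by simp
  then show ?thesis using True assms by (intro exI[of _ "m - 1"]) (auto simp: divide_le_eq)
next
  case False
  define i where "i = nat \<lfloor>real m * t\<rfloor>"
  have "real i = of_int \<lfloor>real m * t\<rfloor>" using assms by (simp add: i_def)
  then have i: "real i \<le> real m * t" "real m * t < real i + 1" by linarith+
  have "real m * t < real m * 1" using False assms by (intro mult_strict_left_mono) auto
  then have "i < m" using i by linarith
  then show ?thesis using i assms(1) by (intro exI[of _ i]) (auto simp: field_simps)
qed

section \<open>Upper and lower bounds for the paths\<close>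

lemma Y_measurable: "n \<ge> 1 \<Longrightarrow> partial_sum_process (M n) (X n) (k n) \<in> borel_measurable (M n)"
  by (intro partial_sum_process_measurable rv)

lemma Y_event: "n \<ge> 1 \<Longrightarrow> \<Gamma> \<in> sets borel \<Longrightarrow> {\<omega>\<in>space (M n). Y n \<omega> \<in> \<Gamma>} \<in> sets (M n)"
proof -
  assume n: "n \<ge> 1" and \<Gamma>: "\<Gamma> \<in> sets borel"
  have "continuous_on UNIV (\<lambda>z::cadlag. sqrt (a n) *\<^sub>R z)" by (intro continuous_intros)
  then have "Y n \<in> borel_measurable (M n)"
    unfolding Y_def[abs_def] by (intro measurable_compose[OF Y_measurable[OF n] borel_measurable_continuous_onI])
  then show ?thesis using measurable_sets[OF _ \<Gamma>] by (auto simp: vimage_def Int_def conj_commute)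
qed

text \<open>The compact level set of some \<open>\<beta>' > \<beta>\<close> keeps a distance
  \<open>\<delta>\<close> from the closure of the set. Outside the bad event the process is within
  \<open>2 * x\<close> of its interpolation, so a path in the set forces discrete energy at least
  \<open>\<beta>'\<close>.\<close>

lemma mdp_upper:
  assumes \<Gamma>: "\<Gamma> \<in> sets borel" and \<beta>: "ereal \<beta> < (INF z\<in>closure \<Gamma>. mdp_rate z)"
  shows "\<forall>\<^sub>F n in sequentially. \<P>(\<omega> in M n. Y n \<omega> \<in> \<Gamma>) \<le> exp (- \<beta> / a n)"
proof (cases "\<beta> \<le> 0")
  case True
  show ?thesis using eventually_ge_at_top[of 1]
  proof eventually_elim
    case (elim n)
    have "\<P>(\<omega> in M n. Y n \<omega> \<in> \<Gamma>) \<le> 1" by (rule prob_space.prob_le_1[OF prob[OF elim]])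
    also have "1 \<le> exp (- \<beta> / a n)" using True a_pos[OF elim] by (simp add: divide_nonpos_pos)
    finally show ?case .
  qed
next
  case False
  then have \<beta>0: "\<beta> > 0" by simp
  \<comment> \<open>The gap is spent in two halves: one on the error of the energy bound, one on the
    factor 2 from adding two events.\<close>
  obtain \<beta>' where \<beta>': "\<beta> < \<beta>'" "ereal \<beta>' < (INF z\<in>closure \<Gamma>. mdp_rate z)"
    using ereal_dense2[OF \<beta>] by auto
  have "{z. mdp_rate z \<le> ereal \<beta>'} \<inter> closure \<Gamma> = {}"
  proof -
    have "\<not> mdp_rate z \<le> ereal \<beta>'" if "z \<in> closure \<Gamma>" for z
      using INF_lower[OF that, of mdp_rate] \<beta>'(2) by (meson leD le_less_trans order.strict_trans2)
    then show ?thesis by blast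
  qed
  then have "\<exists>\<delta>>0. \<forall>z\<in>{z. mdp_rate z \<le> ereal \<beta>'}. \<forall>y\<in>closure \<Gamma>. \<delta> \<le> dist z y"
    by (intro compact_closed_separated compact_mdp_rate_level) auto
  then obtain \<delta> where \<delta>: "\<delta> > 0" "\<And>z y. mdp_rate z \<le> ereal \<beta>' \<Longrightarrow> y \<in> closure \<Gamma> \<Longrightarrow> \<delta> \<le> dist z y"
    by blast
  \<comment> \<open>The oscillation of the process and the increment of the interpolation cost
    \<open>x\<close> each; their sum must stay below \<open>\<delta>\<close>.\<close>
  define x where "x = \<delta> / 3"
  have x: "x > 0" using \<delta> by (simp add: x_def)
  obtain m where m: "m > 0" and bad: "\<forall>\<^sub>F n in sequentially. measure (M n) (Bad n m x) \<le> exp (- \<beta>' / a n)"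
    using Bad_eventually[OF x, of \<beta>'] by blast
  define \<eta> where "\<eta> = (\<beta>' - \<beta>) / 2"
  have \<eta>: "\<eta> > 0" using \<beta>' by (simp add: \<eta>_def)
  have \<beta>'0: "\<beta>' > 0" using \<beta>0 \<beta>' by simp
  show ?thesis
    using bad energy_upper_eventually[OF m \<beta>'0 \<eta>] exp_div_a_eventually_ge[OF \<eta>, of 2] eventually_ge_at_top[of 1]
  proof eventually_elim
    case (elim n)
    interpret prob_space "M n" by (rule prob[OF elim(4)])
    note ap = a_pos[OF elim(4)]
    have [measurable]: "D n m i \<in> borel_measurable (M n)" for i by (rule D_measurable[OF elim(4)])
    let ?En = "{\<omega>\<in>space (M n). \<beta>' \<le> real m / 2 * (\<Sum>i<m. (D n m i \<omega>)\<^sup>2)}"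
    have Enm: "?En \<in> events" by measurable
    have sub: "{\<omega>\<in>space (M n). Y n \<omega> \<in> \<Gamma>} \<subseteq> ?En \<union> Bad n m x"
    proof
      fix \<omega> assume w: "\<omega> \<in> {\<omega>\<in>space (M n). Y n \<omega> \<in> \<Gamma>}"
      show "\<omega> \<in> ?En \<union> Bad n m x"
      proof (rule ccontr)
        assume "\<omega> \<notin> ?En \<union> Bad n m x"
        then have nb: "\<omega> \<notin> Bad n m x" and en: "real m / 2 * (\<Sum>i<m. (D n m i \<omega>)\<^sup>2) \<le> \<beta>'" using w by auto
        define y where "y i = Z n {0<..L n m i} \<omega>" for i
        have y0: "y 0 = 0" by (simp add: y_def Z_def)
        have yD: "y (Suc i) - y i = D n m i \<omega>" for i
          using Z_block[OF L_mono[OF m, of i "Suc i" n]] by (simp add: y_def D_def)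
        obtain p where p: "mdp_rate p \<le> ereal (real m / 2 * (\<Sum>i<m. (y (Suc i) - y i)\<^sup>2))"
          "\<And>i t. i < m \<Longrightarrow> real i / m \<le> t \<Longrightarrow> t \<le> (real i + 1) / m \<Longrightarrow> apply_cadlag p t = y i + (real m * t - i) * (y (Suc i) - y i)"
          using cadlag_linear_interpolation[of y m, OF y0 m] by blast
        have "mdp_rate p \<le> ereal \<beta>'" using p(1) en unfolding yD by (meson ereal_less_eq(3) order_trans)
        moreover have "Y n \<omega> \<in> closure \<Gamma>" using w closure_subset by auto
        ultimately have "\<delta> \<le> dist p (Y n \<omega>)" by (rule \<delta>(2))
        moreover have "norm (p - Y n \<omega>) \<le> 2 * x"
        proof (rule norm_cadlag_le)
          fix t :: real assume "t \<in> {0..1}"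
          then obtain i where i: "i < m" "real i / m \<le> t" "t \<le> (real i + 1) / m" using exists_grid_cell[OF m] by blast
          have "\<bar>apply_cadlag (Y n \<omega>) t - y i\<bar> \<le> x"
            unfolding y_def using w nb by (intro Y_near_grid[OF elim(4) m _ _ i]) auto
          moreover have "\<bar>D n m i \<omega>\<bar> \<le> x"
            using nb w i(1) L_mono[OF m, of i "Suc i" n] unfolding Bad_def D_def by force
          moreover have "0 \<le> real m * t - i" "real m * t - i \<le> 1" using i m by (auto simp: field_simps)
          then have "\<bar>(real m * t - i) * D n m i \<omega>\<bar> \<le> 1 * \<bar>D n m i \<omega>\<bar>" unfolding abs_mult by (intro mult_right_mono) auto
          ultimately show "\<bar>apply_cadlag (p - Y n \<omega>) t\<bar> \<le> 2 * x"
            unfolding apply_cadlag_diff p(2)[OF i] yD by linarith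
        qed
        ultimately show False using x unfolding dist_norm x_def by linarith
      qed
    qed
    have "\<P>(\<omega> in M n. Y n \<omega> \<in> \<Gamma>) \<le> prob (?En \<union> Bad n m x)"
      using sub Enm Bad_measurable[OF elim(4)] by (intro finite_measure_mono) auto
    also have "\<dots> \<le> prob ?En + prob (Bad n m x)"
      using Enm Bad_measurable[OF elim(4)] by (intro measure_Un_le) auto
    also have "\<dots> \<le> exp (- (\<beta>' - \<eta>) / a n) + exp (- \<beta>' / a n)" using elim(1,2) by linarith
    also have "exp (- \<beta>' / a n) \<le> exp (- (\<beta>' - \<eta>) / a n)"
      unfolding exp_le_cancel_iff using \<eta> ap by (intro divide_right_mono) auto
    also have "exp (- (\<beta>' - \<eta>) / a n) + exp (- (\<beta>' - \<eta>) / a n) = 2 * exp (- (\<beta>' - \<eta>) / a n)" by simp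
    also have "\<dots> \<le> exp (\<eta> / a n) * exp (- (\<beta>' - \<eta>) / a n)" using elim(3) by (intro mult_right_mono) auto
    also have "\<dots> = exp (- \<beta> / a n)" unfolding exp_add[symmetric] add_divide_distrib[symmetric] by (simp add: \<eta>_def)
    finally show ?case by simp
  qed
qed

text \<open>If all cell increments follow those of \<open>z\<close> and the bad event fails, the
  path stays in a ball around \<open>z\<close>. The rate of the bad event is made larger than the
  cost of following \<open>z\<close>, so removing it is harmless.\<close>

lemma mdp_lower:
  assumes \<Gamma>: "\<Gamma> \<in> sets borel" and z: "z \<in> interior \<Gamma>" "mdp_rate z = ereal \<beta>" and \<eta>: "\<eta> > 0"
  shows "\<forall>\<^sub>F n in sequentially. exp (- (\<beta> + \<eta>) / a n) \<le> \<P>(\<omega> in M n. Y n \<omega> \<in> \<Gamma>)"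
proof -
  have zle: "mdp_rate z \<le> ereal \<beta>" using z by simp
  note zD = mdp_rate_leD[OF zle]
  obtain e where e: "e > 0" "ball z e \<subseteq> \<Gamma>" using z(1) mem_interior by blast
  \<comment> \<open>The three errors are the oscillation of the process, the deviation at grid
    points and the modulus of \<open>z\<close>; together they give \<open>3 * x < e\<close>.\<close>
  define x where "x = e / 4"
  have x: "x > 0" using e by (simp add: x_def)
  define \<eta>' where "\<eta>' = \<eta> / 2"
  have \<eta>': "\<eta>' > 0" using \<eta> by (simp add: \<eta>'_def)
  obtain m0 where bad0: "\<And>m. m \<ge> m0 \<Longrightarrow> \<forall>\<^sub>F n in sequentially. measure (M n) (Bad n m x) \<le> exp (- (\<beta> + \<eta>) / a n)"
    using Bad_eventually[OF x, of "\<beta> + \<eta>"] by blast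
  have "x\<^sup>2 / (2 * \<beta> + 1) > 0" using x zD(4) by simp
  \<comment> \<open>By the Hoelder bound \<open>z\<close> then varies by at most \<open>x\<close>
    within a cell; the 1 in the denominator covers \<open>\<beta> = 0\<close>.\<close>
  then obtain m1 where m1: "1 / real (Suc m1) < x\<^sup>2 / (2 * \<beta> + 1)" using nat_approx_posE by blast
  define m where "m = max m0 (Suc m1)"
  have m: "m > 0" "m \<ge> m0" "m \<ge> Suc m1" by (auto simp: m_def)
  have mod: "\<bar>apply_cadlag z t - apply_cadlag z t'\<bar> \<le> x" if t: "t \<in> {0..1}" "t' \<in> {0..1}" "\<bar>t - t'\<bar> \<le> 1 / m" for t t'
  proof -
    have "1 / real m \<le> 1 / real (Suc m1)" using m(3) by (intro divide_left_mono) auto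
    then have "\<bar>t - t'\<bar> \<le> x\<^sup>2 / (2 * \<beta> + 1)" using t m1 by linarith
    then have "(2 * \<beta> + 1) * \<bar>t - t'\<bar> \<le> x\<^sup>2" using zD(4) by (simp add: le_divide_eq mult.commute)
    moreover have "2 * \<beta> * \<bar>t - t'\<bar> \<le> (2 * \<beta> + 1) * \<bar>t - t'\<bar>" by (intro mult_right_mono) auto
    ultimately have "sqrt (2 * \<beta> * \<bar>t - t'\<bar>) \<le> sqrt (x\<^sup>2)" by (intro real_sqrt_le_mono) linarith
    then show ?thesis using mdp_rate_Hoelder[OF zle t(1,2)] x by simp
  qed
  define xs where "xs i = apply_cadlag z ((real i + 1) / m) - apply_cadlag z (real i / m)" for i
  have energy: "real m / 2 * (\<Sum>i<m. (xs i)\<^sup>2) \<le> \<beta>"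
  proof -
    have "(\<Sum>i\<in>{..<m}. (apply_cadlag z ((real i + 1) / m) - apply_cadlag z (real i / m))\<^sup>2 / ((real i + 1) / m - real i / m)) \<le> 2 * \<beta>"
    proof (rule mdp_rate_energy[OF zle])
      show "0 \<le> real i / m \<and> real i / m < (real i + 1) / m \<and> (real i + 1) / m \<le> 1" if "i \<in> {..<m}" for i
        using m that by (auto simp: divide_strict_right_mono)
      show "disjoint_family_on (\<lambda>i. {real i / m<..<(real i + 1) / m}) {..<m}"
        by (rule disjoint_grid_cells)
    qed simp
    then have "real m * (\<Sum>i<m. (xs i)\<^sup>2) \<le> 2 * \<beta>"
      by (simp add: xs_def diff_divide_distrib[symmetric] sum_distrib_left mult.commute)
    then show ?thesis by simp
  qed
  \<comment> \<open>Errors of the increments accumulate along the grid, so each of the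
    \<open>m\<close> cells is allowed \<open>x / m\<close>.\<close>
  have xm: "x / m > 0" using x m by simp
  show ?thesis
    using bad0[OF m(2)] blocks_lower_eventually[OF m(1) xm \<eta>', of xs] exp_div_a_eventually_ge[OF \<eta>', of 2] eventually_ge_at_top[of 1]
  proof eventually_elim
    case (elim n)
    interpret prob_space "M n" by (rule prob[OF elim(4)])
    note ap = a_pos[OF elim(4)]
    have [measurable]: "D n m i \<in> borel_measurable (M n)" for i by (rule D_measurable[OF elim(4)])
    let ?G = "{\<omega>\<in>space (M n). \<forall>i<m. \<bar>D n m i \<omega> - xs i\<bar> < x / m}"
    have Gm: "?G \<in> events" by measurable
    have sub: "?G - Bad n m x \<subseteq> {\<omega>\<in>space (M n). Y n \<omega> \<in> \<Gamma>}"
    proof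
      fix \<omega> assume w: "\<omega> \<in> ?G - Bad n m x"
      have grid: "\<bar>Z n {0<..L n m i} \<omega> - apply_cadlag z (real i / m)\<bar> \<le> real i * (x / m)" if "i \<le> m" for i
        using that
      proof (induction i)
        case 0
        then show ?case using zD(1) by (simp add: Z_def)
      next
        case (Suc i)
        have "Z n {0<..L n m (Suc i)} \<omega> = Z n {0<..L n m i} \<omega> + D n m i \<omega>"
          using Z_block[OF L_mono[OF m(1), of i "Suc i" n]] by (simp add: D_def)
        moreover have "apply_cadlag z (real (Suc i) / m) = apply_cadlag z (real i / m) + xs i"
          by (simp add: xs_def add.commute)
        moreover have "\<bar>D n m i \<omega> - xs i\<bar> \<le> x / m" using w Suc_le_lessD[OF Suc.prems] by (auto intro: less_imp_le)
        moreover have "\<bar>Z n {0<..L n m i} \<omega> - apply_cadlag z (real i / m)\<bar> \<le> real i * (x / m)" using Suc by simp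
        moreover have "real (Suc i) * (x / m) = real i * (x / m) + x / m" by (simp add: distrib_right add_divide_distrib)
        ultimately show ?case by linarith
      qed
      have "norm (Y n \<omega> - z) \<le> 3 * x"
      proof (rule norm_cadlag_le)
        fix t :: real assume t: "t \<in> {0..1}"
        then obtain i where i: "i < m" "real i / m \<le> t" "t \<le> (real i + 1) / m" using exists_grid_cell[OF m(1)] by blast
        have "\<bar>apply_cadlag (Y n \<omega>) t - Z n {0<..L n m i} \<omega>\<bar> \<le> x"
          using w by (intro Y_near_grid[OF elim(4) m(1) _ _ i]) auto
        moreover have "\<bar>Z n {0<..L n m i} \<omega> - apply_cadlag z (real i / m)\<bar> \<le> x"
        proof -
          have "real i * (x / m) \<le> real m * (x / m)" using i x by (intro mult_right_mono) auto
          then show ?thesis using grid[of i] i m by simp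
        qed
        moreover have "\<bar>apply_cadlag z (real i / m) - apply_cadlag z t\<bar> \<le> x"
          using i t m by (intro mod) (auto simp: add_divide_distrib)
        ultimately show "\<bar>apply_cadlag (Y n \<omega> - z) t\<bar> \<le> 3 * x" unfolding apply_cadlag_diff by linarith
      qed
      then have "dist z (Y n \<omega>) < e" using e(1) unfolding dist_norm norm_minus_commute[of z] x_def by linarith
      then show "\<omega> \<in> {\<omega>\<in>space (M n). Y n \<omega> \<in> \<Gamma>}" using w e(2) by auto
    qed
    have "exp (- (\<beta> + \<eta>') / a n) \<le> exp (- (real m / 2 * (\<Sum>i<m. (xs i)\<^sup>2) + \<eta>') / a n)"
      unfolding exp_le_cancel_iff using energy ap by (intro divide_right_mono) auto
    also have "\<dots> \<le> prob ?G" by (rule elim(2))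
    also have "prob ?G \<le> prob (?G - Bad n m x) + prob (Bad n m x)"
    proof -
      have "prob ?G \<le> prob ((?G - Bad n m x) \<union> Bad n m x)"
        using Gm Bad_measurable[OF elim(4)] by (intro finite_measure_mono) auto
      also have "\<dots> \<le> prob (?G - Bad n m x) + prob (Bad n m x)"
        using Gm Bad_measurable[OF elim(4)] by (intro measure_Un_le) auto
      finally show ?thesis .
    qed
    also have "prob (?G - Bad n m x) \<le> \<P>(\<omega> in M n. Y n \<omega> \<in> \<Gamma>)"
      by (rule finite_measure_mono[OF sub Y_event[OF elim(4) \<Gamma>]])
    finally have le: "exp (- (\<beta> + \<eta>') / a n) \<le> \<P>(\<omega> in M n. Y n \<omega> \<in> \<Gamma>) + exp (- (\<beta> + \<eta>) / a n)"
      using elim(1) by linarith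
    \<comment> \<open>The bad event is at most half of the lower bound obtained for the cells; half
      of \<open>\<eta>\<close> was kept for this comparison.\<close>
    have "2 * exp (- (\<beta> + \<eta>) / a n) \<le> exp (\<eta>' / a n) * exp (- (\<beta> + \<eta>) / a n)" using elim(3) by (intro mult_right_mono) auto
    also have "\<dots> = exp (- (\<beta> + \<eta>') / a n)" unfolding exp_add[symmetric] add_divide_distrib[symmetric] by (simp add: \<eta>'_def)
    finally show ?case using le by linarith
  qed
qed

lemma mdp: "functional_mdp M (\<lambda>n. partial_sum_process (M n) (X n) (k n)) a mdp_rate"
  unfolding functional_mdp_def
proof (intro conjI allI impI ballI a_lim)
  show "partial_sum_process (M n) (X n) (k n) \<in> borel_measurable (M n)" if "1 \<le> n" for n
    by (rule Y_measurable[OF that])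
  show "compact {x. mdp_rate x \<le> \<alpha>}" if "\<alpha> < \<infinity>" for \<alpha>
    by (rule compact_mdp_rate_level[OF that])
  fix \<Gamma> :: "cadlag set" assume \<Gamma>: "\<Gamma> \<in> sets borel"
  define Ln where "Ln n = ereal (a n) * ln_ereal (\<P>(\<omega> in M n. Y n \<omega> \<in> \<Gamma>))" for n
  have lo: "- (INF z\<in>interior \<Gamma>. mdp_rate z) \<le> liminf Ln"
  proof -
    have "- liminf Ln \<le> (INF z\<in>interior \<Gamma>. mdp_rate z)"
    proof (rule INF_greatest)
      fix z assume z: "z \<in> interior \<Gamma>"
      have "0 \<le> mdp_rate z" by (simp add: mdp_rate_def)
      then consider \<beta> where "mdp_rate z = ereal \<beta>" | "mdp_rate z = \<infinity>" by (cases "mdp_rate z") auto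
      then show "- liminf Ln \<le> mdp_rate z"
      proof cases
        case (1 \<beta>)
        show ?thesis
        proof (rule ereal_le_epsilon2)
          fix \<eta> :: real assume \<eta>: "0 < \<eta>"
          have "\<forall>\<^sub>F n in sequentially. ereal (- (\<beta> + \<eta>)) \<le> Ln n"
            using mdp_lower[OF \<Gamma> z 1 \<eta>] eventually_ge_at_top[of 1]
          proof eventually_elim
            case (elim n)
            show ?case unfolding Ln_def by (rule scaled_ln_ereal_ge[OF a_pos[OF elim(2)] elim(1)])
          qed
          then have "ereal (- (\<beta> + \<eta>)) \<le> liminf Ln" by (rule Liminf_bounded)
          then have "- liminf Ln \<le> - ereal (- (\<beta> + \<eta>))" by (simp only: ereal_minus_le_minus)
          then show "- liminf Ln \<le> mdp_rate z + ereal \<eta>" by (simp add: 1 add.commute)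
        qed
      qed simp
    qed
    then show ?thesis by (metis ereal_minus_le_minus ereal_uminus_uminus)
  qed
  have up: "limsup Ln \<le> - (INF z\<in>closure \<Gamma>. mdp_rate z)"
  proof (rule ccontr)
    assume "\<not> limsup Ln \<le> - (INF z\<in>closure \<Gamma>. mdp_rate z)"
    \<comment> \<open>A real number strictly between the two sides treats finite and infinite infima
      alike.\<close>
    then obtain r where r: "- (INF z\<in>closure \<Gamma>. mdp_rate z) < ereal r" "ereal r < limsup Ln"
      using ereal_dense2 by (meson not_le)
    then have "ereal (- r) < (INF z\<in>closure \<Gamma>. mdp_rate z)"
      by (metis ereal_minus_less_minus ereal_uminus_uminus uminus_ereal.simps(1))
    from mdp_upper[OF \<Gamma> this] have "\<forall>\<^sub>F n in sequentially. Ln n \<le> ereal r"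
      using eventually_ge_at_top[of 1]
    proof eventually_elim
      case (elim n)
      have "Ln n \<le> ereal (- (- r))" unfolding Ln_def using elim(1)
        by (intro scaled_ln_ereal_le a_pos elim(2)) auto
      then show ?case by simp
    qed
    then have "limsup Ln \<le> ereal r" by (rule Limsup_bounded)
    then show False using r by simp
  qed
  show "let L = (\<lambda>n. ereal (a n) * ln_ereal (measure (M n) {\<omega>\<in>space (M n).
            sqrt (a n) *\<^sub>R partial_sum_process (M n) (X n) (k n) \<omega> \<in> \<Gamma>}))
         in - (INF z\<in>interior \<Gamma>. mdp_rate z) \<le> liminf L \<and> liminf L \<le> limsup L \<and>
            limsup L \<le> - (INF z\<in>closure \<Gamma>. mdp_rate z)"
    unfolding Let_def using lo up unfolding Ln_def Y_def by (auto intro: Liminf_le_Limsup)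
qed

end

theorem proposition9:
  fixes M :: "nat \<Rightarrow> 'a measure"
    and k :: "nat \<Rightarrow> nat"
    and X :: "nat \<Rightarrow> nat \<Rightarrow> 'a \<Rightarrow> real"
    and A :: "nat \<Rightarrow> nat \<Rightarrow> real"
    and B a s :: "nat \<Rightarrow> real"
    and n\<^sub>0 :: nat
    and C :: real
  assumes prob: "\<And>n. n \<ge> 1 \<Longrightarrow> prob_space (M n)"
    and k_pos: "\<And>n. n \<ge> 1 \<Longrightarrow> k n \<ge> 1"
    and indep: "\<And>n. n \<ge> 1 \<Longrightarrow> prob_space.indep_vars (M n) (\<lambda>_. borel) (X n) {1..k n}"
    and square_integrable:
      "\<And>n j. n \<ge> 1 \<Longrightarrow> j \<in> {1..k n} \<Longrightarrow> integrable (M n) (\<lambda>\<omega>. (X n j \<omega>)\<^sup>2)"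
    and centered: "\<And>n j. n \<ge> 1 \<Longrightarrow> j \<in> {1..k n} \<Longrightarrow> prob_space.expectation (M n) (X n j) = 0"
    and s_def: "\<And>n. s n = row_sd (M n) (X n) (k n)"
    and var_pos: "\<And>n. n \<ge> 1 \<Longrightarrow> (s n)\<^sup>2 > 0"
    and n\<^sub>0: "n\<^sub>0 \<ge> 1"
    and A_nonneg: "\<And>n j. n \<ge> n\<^sub>0 \<Longrightarrow> j \<in> {1..k n} \<Longrightarrow> A n j \<ge> 0"
    and B_nonneg: "\<And>n. n \<ge> n\<^sub>0 \<Longrightarrow> B n \<ge> 0"
    and moments: "\<And>n j m. n \<ge> n\<^sub>0 \<Longrightarrow> j \<in> {1..k n} \<Longrightarrow> m \<ge> 3 \<Longrightarrow>
      integrable (M n) (\<lambda>\<omega>. \<bar>X n j \<omega>\<bar> ^ m) \<and>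
      prob_space.expectation (M n) (\<lambda>\<omega>. \<bar>X n j \<omega>\<bar> ^ m) \<le> fact m * A n j ^ m * B n"
    and a_pos: "\<And>n. n \<ge> 1 \<Longrightarrow> a n > 0"
    and a_lim: "a \<longlonglongrightarrow> 0"
    and A_small: "\<And>\<epsilon>. \<epsilon> > 0 \<Longrightarrow>
      \<forall>\<^sub>F n in sequentially. \<forall>j\<in>{1..k n}. A n j \<le> \<epsilon> * (sqrt (a n) * s n)"
    and C_pos: "C > 0"
    and A_bound: "\<And>n. n \<ge> n\<^sub>0 \<Longrightarrow> B n / (s n)\<^sup>2 * (\<Sum>j=1..k n. (A n j)\<^sup>2) \<le> C"
  shows "functional_mdp M (\<lambda>n. partial_sum_process (M n) (X n) (k n)) a mdp_rate"
proof -
  interpret mdp_array M k X A B a s n\<^sub>0 C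
    by (rule mdp_array.intro) (fact assms)+
  show ?thesis by (rule mdp)
qed

end
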